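(* Let $K=W(k)[\frac1p]$ be a finite unramified extension of $\mathbb{Q}_p$, let $\mathbb{F}$ be a finite field of characteristic $p$, and let $V_{\mathbb{F}}$ be a finite-dimensional $\mathbb{F}$-vector space equipped with a continuous $\mathbb{F}$-linear action of $G_K$. Then $\mathcal{L}^{\leq p}_{\mathrm{crys}}(V_{\mathbb{F}})\subset\mathcal{L}^{\leq p}_{\mathrm{SD}}(V_{\mathbb{F}})$.
   Context: \textbf{Setup.} $k$ is a finite field of characteristic $p$, $K=W(k)[\frac1p]$, $\overline K$ an algebraic closure with completion $C$, $G_K=\operatorname{Gal}(\overline K/K)$. Fix a uniformiser $\pi$ of $K$ and a compatible system $(\pi^{1/p^n})_n$ of $p$-power roots in $\overline K$; $K_\infty=\bigcup_nK(\pi^{1/p^n})$. $\mathcal{O}_{C^\flat}=\varprojlim_{x\mapsto x^p}\mathcal{O}_C/p$ with fraction field $C^\flat$, valuation $v^\flat$ normalised so that the element $\pi^\flat\in\mathcal{O}_{C^\flat}$ defined by $(\pi^{1/p^n})_n$ has $v^\flat(\pi^\flat)=1$; $C^\flat$ has a $G_K$-action and the $p$-power Frobenius $\varphi$. View $k((u))\subset C^\flat$ via $u\mapsto\pi^\flat$. For $r\in\mathbb{Q}_{\ge0}$, $u^r\mathcal{O}_{C^\flat}$ is the ideal of elements of valuation $\geq r$. \textbf{Étale $\varphi$-module.} For a continuous representation $V_{\mathbb{F}}$ of $G_{K_\infty}$ on a finite-dimensional $\mathbb{F}$-vector space, $M_{\mathbb{F}}\subset V_{\mathbb{F}}\otimes_{\mathbb{F}_p}C^\flat$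 is the unique finite-dimensional $k((u))$-subspace, fixed pointwise by $G_{K_\infty}$, with $M_{\mathbb{F}}\otimes_{k((u))}C^\flat=V_{\mathbb{F}}\otimes_{\mathbb{F}_p}C^\flat$, on which the Frobenius $1\otimes\varphi$ induces an isomorphism $\varphi^*M_{\mathbb{F}}\xrightarrow{\sim}M_{\mathbb{F}}$. It is a module over $k((u))\otimes_{\mathbb{F}_p}\mathbb{F}$. \textbf{The sets.} Put $\mathfrak{S}_{\mathbb{F}}=k[[u]]\otimes_{\mathbb{F}_p}\mathbb{F}$. $\mathcal{L}^{\leq h}(V_{\mathbb{F}})$ is the set of finite projective $\mathfrak{S}_{\mathbb{F}}$-submodules $\mathfrak{M}\subset M_{\mathbb{F}}$ with $\mathfrak{M}[\frac1u]=M_{\mathbb{F}}$ and $u^h\mathfrak{M}\subset\mathfrak{M}^\varphi\subset\mathfrak{M}$, where $\mathfrak{M}^\varphi$ is the $k[[u]]$-span of $\varphi(\mathfrak{M})$. If the action extends to $G_K$, $\mathcal{L}^{\leq h}_{\mathrm{crys}}(V_{\mathbb{F}})$ is the set of $\mathfrak{M}\in\mathcal{L}^{\leq h}(V_{\mathbb{F}})$ such that for the $G_K$-action on $\mathfrak{M}\otimes_{k[[u]]}C^\flat=V_{\mathbb{F}}\otimes_{\mathbb{F}_p}C^\flat$ one has $(\sigma-1)(m)\in\mathfrak{M}\otimes_{k[[u]]}u^{p/(p-1)}\mathcal{O}_{C^\flat}$ for all $m\in\mathfrak{M}$, $\sigma\in G_K$. $\mathcal{L}^{\leq p}_{\mathrm{SD}}(V_{\mathbb{F}})$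 (the strongly divisible elements) is the set of $\mathfrak{M}\in\mathcal{L}^{\leq p}(V_{\mathbb{F}})$ for which there exist a $k[[u]]$-basis $(m_i)$ of $\mathfrak{M}$ and integers $r_i$ such that $(u^{r_i}m_i)$ is a $k[[u^p]]$-basis of $\varphi(\mathfrak{M})$. *)

theory Defs
  imports
    Complex_Main
    "HOL-Algebra.Algebraic_Closure_Type"
    "HOL-Algebra.Generated_Fields"
    "HOL-Library.Poly_Mapping"
    "HOL-Library.Function_Algebras"
begin

section \<open>Tensor products of abelian groups\<close>

text \<open>
  The tensor product is the free abelian group on pairs modulo the biadditivity relations.
  It is taken over the integers. It is only used below for vector spaces over the prime field with
  \<open>p\<close> elements; biadditive maps between such spaces are automatically bilinear over the
  prime field, so there it is the tensor product over the prime field.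
\<close>

inductive_set tensor_rel :: "(('a::ab_group_add \<times> 'b::ab_group_add) \<Rightarrow>\<^sub>0 int) set" where
  zero: "0 \<in> tensor_rel"
| diff: "x \<in> tensor_rel \<Longrightarrow> y \<in> tensor_rel \<Longrightarrow> x - y \<in> tensor_rel"
| left: "frag_of (a + a', b) - frag_of (a, b) - frag_of (a', b) \<in> tensor_rel"
| right: "frag_of (a, b + b') - frag_of (a, b) - frag_of (a, b') \<in> tensor_rel"

definition tensor_eq ::
  "(('a::ab_group_add \<times> 'b::ab_group_add) \<Rightarrow>\<^sub>0 int) \<Rightarrow> (('a \<times> 'b) \<Rightarrow>\<^sub>0 int) \<Rightarrow> bool"
  where "tensor_eq x y \<longleftrightarrow> x - y \<in> tensor_rel"

lemma tensor_rel_uminus: "x \<in> tensor_rel \<Longrightarrow> - x \<in> tensor_rel"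
  using tensor_rel.diff[OF tensor_rel.zero] by simp

lemma tensor_rel_add: "x \<in> tensor_rel \<Longrightarrow> y \<in> tensor_rel \<Longrightarrow> x + y \<in> tensor_rel"
  using tensor_rel.diff[OF _ tensor_rel_uminus] by fastforce

quotient_type (overloaded) ('a, 'b) tensor =
  "('a::ab_group_add \<times> 'b::ab_group_add) \<Rightarrow>\<^sub>0 int" / tensor_eq
proof (rule equivpI)
  show "reflp (tensor_eq :: (('a \<times> 'b) \<Rightarrow>\<^sub>0 int) \<Rightarrow> _)"
    by (simp add: reflp_def tensor_eq_def tensor_rel.zero)
  show "symp (tensor_eq :: (('a \<times> 'b) \<Rightarrow>\<^sub>0 int) \<Rightarrow> _)"
    unfolding symp_def tensor_eq_def using tensor_rel_uminus by fastforce
  show "transp (tensor_eq :: (('a \<times> 'b) \<Rightarrow>\<^sub>0 int) \<Rightarrow> _)"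
    unfolding transp_def tensor_eq_def using tensor_rel_add by fastforce
qed

instantiation tensor :: (ab_group_add, ab_group_add) ab_group_add
begin

lift_definition zero_tensor :: "('a, 'b) tensor" is 0 .

lift_definition plus_tensor :: "('a, 'b) tensor \<Rightarrow> ('a, 'b) tensor \<Rightarrow> ('a, 'b) tensor" is "(+)"
  unfolding tensor_eq_def by (subst add_diff_add) (rule tensor_rel_add)

lift_definition uminus_tensor :: "('a, 'b) tensor \<Rightarrow> ('a, 'b) tensor" is uminus
  unfolding tensor_eq_def by (subst minus_diff_minus) (rule tensor_rel_uminus)

lift_definition minus_tensor :: "('a, 'b) tensor \<Rightarrow> ('a, 'b) tensor \<Rightarrow> ('a, 'b) tensor" is "(-)"
proof -
  fix x x' y y' :: "('a \<times> 'b) \<Rightarrow>\<^sub>0 int"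
  assume "tensor_eq x x'" "tensor_eq y y'"
  then have "(x - x') - (y - y') \<in> tensor_rel"
    unfolding tensor_eq_def by (rule tensor_rel.diff)
  moreover have "(x - x') - (y - y') = (x - y) - (x' - y')"
    by (simp add: algebra_simps)
  ultimately show "tensor_eq (x - y) (x' - y')"
    by (simp add: tensor_eq_def)
qed

instance
  by standard (transfer; simp add: tensor_eq_def tensor_rel.zero algebra_simps)+

end

lift_definition tens :: "'a::ab_group_add \<Rightarrow> 'b::ab_group_add \<Rightarrow> ('a, 'b) tensor"
  is "\<lambda>a b. frag_of (a, b)" .

text \<open>
  The map \<open>f \<otimes> g\<close>. Choosing a representative is harmless precisely when \<open>f\<close> and \<open>g\<close> are
  additive, which holds in every use below; see \<open>tensor_map_tens\<close> and \<open>tensor_map_add\<close>.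
\<close>

definition tensor_map ::
  "('a::ab_group_add \<Rightarrow> 'c::ab_group_add) \<Rightarrow> ('b::ab_group_add \<Rightarrow> 'd::ab_group_add)
    \<Rightarrow> ('a, 'b) tensor \<Rightarrow> ('c, 'd) tensor"
  where "tensor_map f g t =
    abs_tensor (frag_extend (\<lambda>(a, b). frag_of (f a, g b)) (rep_tensor t))"

lemma tensor_map_abs:
  assumes "\<And>x y. f (x + y) = f x + f y" "\<And>x y. g (x + y) = g x + g y"
  shows "tensor_map f g (abs_tensor x) = abs_tensor (frag_extend (\<lambda>(a, b). frag_of (f a, g b)) x)"
proof -
  let ?F = "frag_extend (\<lambda>(a, b). frag_of (f a, g b))"
  have rel: "?F z \<in> tensor_rel" if "z \<in> tensor_rel" for z
    using that
  proof induction
    case zero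
    then show ?case by (simp add: tensor_rel.zero)
  next
    case (diff x y)
    then show ?case by (simp add: frag_extend_diff tensor_rel.diff)
  next
    case (left a a' b)
    then show ?case
      using tensor_rel.left[of "f a" "f a'" "g b"] by (simp add: frag_extend_diff assms)
  next
    case (right a b b')
    then show ?case
      using tensor_rel.right[of "f a" "g b" "g b'"] by (simp add: frag_extend_diff assms)
  qed
  have "tensor_eq (rep_tensor (abs_tensor x)) x"
    unfolding tensor.abs_eq_iff[symmetric] by (rule Quotient3_abs_rep[OF Quotient3_tensor])
  then have "tensor_eq (?F (rep_tensor (abs_tensor x))) (?F x)"
    unfolding tensor_eq_def frag_extend_diff[symmetric] by (rule rel)
  then show ?thesis
    by (simp add: tensor_map_def tensor.abs_eq_iff)
qed

lemma tensor_map_tens: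
  assumes "\<And>x y. f (x + y) = f x + f y" "\<And>x y. g (x + y) = g x + g y"
  shows "tensor_map f g (tens a b) = tens (f a) (g b)"
  by (simp add: tens.abs_eq tensor_map_abs[OF assms])

lemma tensor_map_add:
  assumes "\<And>x y. f (x + y) = f x + f y" "\<And>x y. g (x + y) = g x + g y"
  shows "tensor_map f g (s + t) = tensor_map f g s + tensor_map f g t"
proof -
  obtain x y where "s = abs_tensor x" "t = abs_tensor y"
    using Quotient3_abs_rep[OF Quotient3_tensor, symmetric] by blast
  then show ?thesis
    by (simp add: plus_tensor.abs_eq tensor_map_abs[OF assms] frag_extend_add)
qed

definition cscale :: "'d::field \<Rightarrow> ('a::ab_group_add, 'd) tensor \<Rightarrow> ('a, 'd) tensor"
  where "cscale c = tensor_map id ((*) c)"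

definition span_over :: "'d::field set \<Rightarrow> ('a::ab_group_add, 'd) tensor set \<Rightarrow> ('a, 'd) tensor set"
  where "span_over A S =
    {(\<Sum>i<n. cscale (c i) (s i)) | (n::nat) c s. (\<forall>i<n. c i \<in> A) \<and> (\<forall>i<n. s i \<in> S)}"

definition is_basis ::
  "'d::field set \<Rightarrow> ('a::ab_group_add, 'd) tensor set \<Rightarrow> nat \<Rightarrow> (nat \<Rightarrow> ('a, 'd) tensor) \<Rightarrow> bool"
  where "is_basis A N n b \<longleftrightarrow>
    N = {(\<Sum>i<n. cscale (c i) (b i)) | c. \<forall>i<n. c i \<in> A} \<and>
    (\<forall>c. (\<forall>i<n. c i \<in> A) \<and> (\<Sum>i<n. cscale (c i) (b i)) = 0 \<longrightarrow> (\<forall>i<n. c i = 0))"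


section \<open>The field \<open>K\<close>, its algebraic closure and the completion\<close>

text \<open>
  The ambient type \<open>'c\<close> is the field \<open>C\<close>; \<open>K\<close> and \<open>Kbar\<close> are subfields of it, and
  \<open>nrm\<close> is the absolute value with \<open>|p| = 1/p\<close>. Inside \<open>C\<close>, the field of \<open>p\<close>-adic numbers is the
  closure of the rational numbers. A finite unramified extension of it is the same thing as
  \<open>W(k)[1/p]\<close> for a finite field \<open>k\<close>, and \<open>k\<close> is then its residue field.
\<close>

definition Qp_in :: "('c::field_char_0 \<Rightarrow> real) \<Rightarrow> 'c set"
  where "Qp_in nrm = {x. \<forall>e>0. \<exists>q\<in>\<rat>. nrm (x - q) < e}"

definition poly_over :: "'c::field set \<Rightarrow> 'c poly set"
  where "poly_over L = {f. \<forall>n. coeff f n \<in> L}"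

definition is_algebraic_closure :: "'c::field set \<Rightarrow> 'c set \<Rightarrow> bool"
  where "is_algebraic_closure L M \<longleftrightarrow>
    subfield M ring_of_type_algebra \<and> L \<subseteq> M \<and>
    (\<forall>x\<in>M. \<exists>f\<in>poly_over L. f \<noteq> 0 \<and> poly f x = 0) \<and>
    (\<forall>f\<in>poly_over M. degree f > 0 \<longrightarrow> (\<exists>x\<in>M. poly f x = 0))"

locale unramified_field =
  fixes p :: nat
    and nrm :: "'c::field_char_0 \<Rightarrow> real"
    and K Kbar :: "'c set"
  assumes prime_p: "prime p"
    and nrm_nonneg: "nrm x \<ge> 0"
    and nrm_eq_0: "nrm x = 0 \<longleftrightarrow> x = 0"
    and nrm_mult: "nrm (x * y) = nrm x * nrm y"
    and nrm_add: "nrm (x + y) \<le> max (nrm x) (nrm y)"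
    and nrm_p: "nrm (of_nat p) = 1 / real p"
    and complete: "\<And>s :: nat \<Rightarrow> 'c.
      (\<forall>e>0. \<exists>N. \<forall>m\<ge>N. \<forall>n\<ge>N. nrm (s m - s n) < e) \<Longrightarrow> \<exists>x. (\<lambda>n. nrm (s n - x)) \<longlonglongrightarrow> 0"
    and K_subfield: "subfield K ring_of_type_algebra"
    and Qp_subset: "Qp_in nrm \<subseteq> K"
    and K_finite: "\<exists>(n::nat) b. K = {(\<Sum>i<n. c i * b i) | c. \<forall>i<n. c i \<in> Qp_in nrm}"
    and K_unramified: "nrm ` K = nrm ` Qp_in nrm"
    and Kbar_closure: "is_algebraic_closure K Kbar"
    and Kbar_dense: "\<forall>e>0. \<exists>y\<in>Kbar. nrm (x - y) < e"
begin

definition OC :: "'c ring"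
  where "OC = ring_of_type_algebra\<lparr>carrier := {x. nrm x \<le> 1}\<rparr>"

definition pOC :: "'c set"
  where "pOC = PIdl\<^bsub>OC\<^esub> (of_nat p)"

definition OC_mod_p :: "'c set ring"
  where "OC_mod_p = OC Quot pOC"

text \<open>The inverse limit of \<open>OC_mod_p\<close> along the \<open>p\<close>-power map.\<close>

definition tilt_ring :: "(nat \<Rightarrow> 'c set) ring"
  where "tilt_ring = \<lparr>
    carrier = {x. \<forall>n. x n \<in> carrier OC_mod_p \<and> x (Suc n) [^]\<^bsub>OC_mod_p\<^esub> p = x n},
    monoid.mult = (\<lambda>x y n. x n \<otimes>\<^bsub>OC_mod_p\<^esub> y n),
    one = (\<lambda>n. \<one>\<^bsub>OC_mod_p\<^esub>),
    zero = (\<lambda>n. \<zero>\<^bsub>OC_mod_p\<^esub>),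
    add = (\<lambda>x y n. x n \<oplus>\<^bsub>OC_mod_p\<^esub> y n)\<rparr>"

text \<open>
  An element of the Galois group of \<open>Kbar\<close> over \<open>L\<close> is represented by its unique continuous
  extension to \<open>C\<close>, so that it acts on \<open>C\<close> by application.
\<close>

definition Gal :: "'c set \<Rightarrow> ('c \<Rightarrow> 'c) set"
  where "Gal L = {\<sigma>. bij_betw \<sigma> Kbar Kbar \<and>
    (\<forall>x\<in>Kbar. \<forall>y\<in>Kbar. \<sigma> (x + y) = \<sigma> x + \<sigma> y \<and> \<sigma> (x * y) = \<sigma> x * \<sigma> y) \<and>
    (\<forall>x\<in>L. \<sigma> x = x) \<and>
    (\<forall>x. \<forall>e>0. \<exists>d>0. \<forall>y. nrm (y - x) < d \<longrightarrow> nrm (\<sigma> y - \<sigma> x) < e)}"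

end


section \<open>The tilt\<close>

text \<open>
  The type \<open>'d\<close> is the fraction field of the inverse limit ring, via \<open>\<iota>\<close>; \<open>vb\<close> is its
  normalised valuation, whose value at \<open>0\<close> is irrelevant. The element \<open>pw n\<close> is the chosen
  \<open>p^n\<close>-th root of the uniformiser \<open>pw 0\<close>.
\<close>

locale tilted_field = unramified_field p nrm K Kbar
  for p :: nat and nrm :: "'c::field_char_0 \<Rightarrow> real" and K Kbar :: "'c set" +
  fixes pw :: "nat \<Rightarrow> 'c"
    and \<iota> :: "(nat \<Rightarrow> 'c set) \<Rightarrow> 'd::field"
    and vb :: "'d \<Rightarrow> real"
  assumes uniformiser: "pw 0 \<in> K" "pw 0 \<noteq> 0" "nrm (pw 0) < 1"
      "\<forall>x\<in>K. nrm x < 1 \<longrightarrow> nrm x \<le> nrm (pw 0)"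
    and roots: "pw n \<in> Kbar" "pw (Suc n) ^ p = pw n"
    and \<iota>_hom: "\<iota> \<in> ring_hom (tilt_ring :: (nat \<Rightarrow> 'c set) ring) ring_of_type_algebra"
    and \<iota>_inj: "inj_on \<iota> (carrier tilt_ring)"
    and \<iota>_frac: "\<exists>a\<in>carrier tilt_ring. \<exists>b\<in>carrier tilt_ring. \<iota> b \<noteq> 0 \<and> z = \<iota> a / \<iota> b"
    and vb_mult: "x \<noteq> 0 \<Longrightarrow> y \<noteq> 0 \<Longrightarrow> vb (x * y) = vb x + vb y"
    and vb_add: "x \<noteq> 0 \<Longrightarrow> y \<noteq> 0 \<Longrightarrow> x + y \<noteq> 0 \<Longrightarrow> vb (x + y) \<ge> min (vb x) (vb y)"
    and vb_ring: "\<iota> ` carrier tilt_ring = {z. z = 0 \<or> vb z \<ge> 0}"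
    and vb_norm: "vb (\<iota> (\<lambda>n. pOC +>\<^bsub>OC\<^esub> pw n)) = 1"
begin

definition Kinf :: "'c set"
  where "Kinf = (\<Union>n. generate_field ring_of_type_algebra (K \<union> {pw n}))"

definition GK :: "('c \<Rightarrow> 'c) set"
  where "GK = Gal K"

definition GKinf :: "('c \<Rightarrow> 'c) set"
  where "GKinf = Gal Kinf"

definition u :: 'd
  where "u = \<iota> (\<lambda>n. pOC +>\<^bsub>OC\<^esub> pw n)"

definition u_pow_O :: "real \<Rightarrow> 'd set"
  where "u_pow_O r = {z. z = 0 \<or> vb z \<ge> r}"

text \<open>The action of \<open>\<sigma>\<close> on fractions, induced by its action on each coset of \<open>pOC\<close>.\<close>

definition tilt_act :: "('c \<Rightarrow> 'c) \<Rightarrow> 'd \<Rightarrow> 'd"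
  where "tilt_act \<sigma> z = (THE w. \<exists>a\<in>carrier tilt_ring. \<exists>b\<in>carrier tilt_ring.
    \<iota> b \<noteq> 0 \<and> z = \<iota> a / \<iota> b \<and> w = \<iota> (\<lambda>n. \<sigma> ` a n) / \<iota> (\<lambda>n. \<sigma> ` b n))"

text \<open>
  The copy of the residue field \<open>k\<close> in the tilt: since \<open>K\<close> is unramified, \<open>k\<close> is the image of
  the integers of \<open>K\<close> in \<open>OC_mod_p\<close>, and since \<open>k\<close> is perfect each element of \<open>k\<close> has a unique
  compatible system of \<open>p\<close>-power roots in \<open>k\<close>.
\<close>

definition kres :: "'d set"
  where "kres = \<iota> ` {x \<in> carrier tilt_ring. \<forall>n. \<exists>a\<in>K. nrm a \<le> 1 \<and> x n = pOC +>\<^bsub>OC\<^esub> a}"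

text \<open>
  For \<open>t\<close> of positive valuation, \<open>power_series t\<close> is the image of \<open>k[[t]]\<close>: sums of convergent
  series \<open>\<Sum>i. a i * t ^ i\<close> with coefficients in \<open>k\<close>.
\<close>

definition power_series :: "'d \<Rightarrow> 'd set"
  where "power_series t = {z. \<exists>a :: nat \<Rightarrow> 'd. (\<forall>i. a i \<in> kres) \<and>
    (\<forall>n. \<exists>y\<in>u_pow_O 0. z - (\<Sum>i<n. a i * t ^ i) = t ^ n * y)}"

definition kuu :: "'d set"
  where "kuu = power_series u"

definition ku :: "'d set"
  where "ku = {z. \<exists>n::nat. u ^ n * z \<in> kuu}"

text \<open>
  \<open>k[[u]] \<otimes> \<bbbF>\<close> as a subset of \<open>\<bbbF> \<otimes> C\<^sup>\<flat>\<close>, and the free modules over it. A module over it is an abelian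
  group with commuting actions of \<open>k[[u]]\<close> and \<open>\<bbbF>\<close>.
\<close>

definition SF :: "('f::field, 'd) tensor set"
  where "SF = span_over kuu (range (\<lambda>a. tens a 1))"

definition SF_free :: "nat \<Rightarrow> (nat \<Rightarrow> ('f::field, 'd) tensor) set"
  where "SF_free n = {x. (\<forall>i<n. x i \<in> SF) \<and> (\<forall>i\<ge>n. x i = 0)}"

definition cscale_free :: "'d \<Rightarrow> (nat \<Rightarrow> ('f::field, 'd) tensor) \<Rightarrow> nat \<Rightarrow> ('f, 'd) tensor"
  where "cscale_free c x = (\<lambda>i. cscale c (x i))"

definition fscale_free :: "'f::field \<Rightarrow> (nat \<Rightarrow> ('f, 'd) tensor) \<Rightarrow> nat \<Rightarrow> ('f, 'd) tensor"
  where "fscale_free a x = (\<lambda>i. tensor_map ((*) a) id (x i))"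

definition SF_linear_on :: "'a::ab_group_add set \<Rightarrow>
    ('d \<Rightarrow> 'a \<Rightarrow> 'a) \<Rightarrow> ('f::field \<Rightarrow> 'a \<Rightarrow> 'a) \<Rightarrow>
    ('d \<Rightarrow> 'b::ab_group_add \<Rightarrow> 'b) \<Rightarrow> ('f \<Rightarrow> 'b \<Rightarrow> 'b) \<Rightarrow> ('a \<Rightarrow> 'b) \<Rightarrow> bool"
  where "SF_linear_on N c1 f1 c2 f2 g \<longleftrightarrow>
    (\<forall>x\<in>N. \<forall>y\<in>N. g (x + y) = g x + g y) \<and>
    (\<forall>z\<in>kuu. \<forall>x\<in>N. g (c1 z x) = c2 z (g x)) \<and>
    (\<forall>a. \<forall>x\<in>N. g (f1 a x) = f2 a (g x))"

end


section \<open>Representations and lattices\<close>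

locale galois_rep = tilted_field p nrm K Kbar pw \<iota> vb
  for p :: nat and nrm :: "'c::field_char_0 \<Rightarrow> real" and K Kbar :: "'c set"
    and pw :: "nat \<Rightarrow> 'c" and \<iota> :: "(nat \<Rightarrow> 'c set) \<Rightarrow> 'd::field" and vb :: "'d \<Rightarrow> real" +
  fixes scaleV :: "'f::{field, finite} \<Rightarrow> 'v::ab_group_add \<Rightarrow> 'v"
    and \<rho> :: "('c \<Rightarrow> 'c) \<Rightarrow> 'v \<Rightarrow> 'v"
  assumes char_F: "CHAR('f) = p"
    and V_space: "vector_space scaleV"
    and V_fin_dim: "\<exists>B. finite B \<and> module.span scaleV B = UNIV"
    and \<rho>_linear: "\<sigma> \<in> GK \<Longrightarrow> Vector_Spaces.linear scaleV scaleV (\<rho> \<sigma>)"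
    and \<rho>_id: "\<rho> id v = v"
    and \<rho>_comp: "\<sigma> \<in> GK \<Longrightarrow> \<tau> \<in> GK \<Longrightarrow> \<rho> (\<sigma> \<circ> \<tau>) v = \<rho> \<sigma> (\<rho> \<tau> v)"
    \<comment> \<open>continuity of the action for the Krull topology and the discrete topology on \<open>V\<close>\<close>
    and \<rho>_cont: "\<sigma> \<in> GK \<Longrightarrow> \<exists>S. finite S \<and> S \<subseteq> Kbar \<and>
      (\<forall>\<tau>\<in>GK. (\<forall>x\<in>S. \<tau> x = \<sigma> x) \<longrightarrow> \<rho> \<tau> v = \<rho> \<sigma> v)"
begin

definition fscale :: "'f \<Rightarrow> ('v, 'd) tensor \<Rightarrow> ('v, 'd) tensor"
  where "fscale a = tensor_map (scaleV a) id"

definition gact :: "('c \<Rightarrow> 'c) \<Rightarrow> ('v, 'd) tensor \<Rightarrow> ('v, 'd) tensor"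
  where "gact \<sigma> = tensor_map (\<rho> \<sigma>) (tilt_act \<sigma>)"

definition frob :: "('v, 'd) tensor \<Rightarrow> ('v, 'd) tensor"
  where "frob = tensor_map id (\<lambda>z. z ^ p)"

text \<open>
  If \<open>b\<close> is a \<open>k((u))\<close>-basis of \<open>M\<close>, the linearised Frobenius from \<open>\<phi>\<^sup>* M\<close> to \<open>M\<close> is the map
  taking the basis \<open>1 \<otimes> b i\<close> to \<open>frob (b i)\<close>, and the base change of \<open>M\<close> to the tilt is the
  whole space iff \<open>b\<close> is also a basis of the latter.
\<close>

definition etale_phi_module :: "('v, 'd) tensor set \<Rightarrow> bool"
  where "etale_phi_module M \<longleftrightarrow>
    (\<forall>\<sigma>\<in>GKinf. \<forall>m\<in>M. gact \<sigma> m = m) \<and>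
    (\<exists>n b. is_basis ku M n b \<and> is_basis UNIV UNIV n b \<and> is_basis ku M n (\<lambda>i. frob (b i)))"

definition SF_submodule :: "('v, 'd) tensor set \<Rightarrow> bool"
  where "SF_submodule N \<longleftrightarrow> 0 \<in> N \<and> (\<forall>x\<in>N. \<forall>y\<in>N. x + y \<in> N) \<and>
    (\<forall>z\<in>kuu. \<forall>x\<in>N. cscale z x \<in> N) \<and> (\<forall>a. \<forall>x\<in>N. fscale a x \<in> N)"

text \<open>Finite projective: a direct summand of a finite free module.\<close>

definition SF_finite_projective :: "('v, 'd) tensor set \<Rightarrow> bool"
  where "SF_finite_projective N \<longleftrightarrow>
    (\<exists>n (j :: ('v, 'd) tensor \<Rightarrow> nat \<Rightarrow> ('f, 'd) tensor) s.
      SF_linear_on N cscale fscale cscale_free fscale_free j \<and> j ` N \<subseteq> SF_free n \<and>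
      SF_linear_on (SF_free n) cscale_free fscale_free cscale fscale s \<and> s ` SF_free n \<subseteq> N \<and>
      (\<forall>x\<in>N. s (j x) = x))"

text \<open>\<open>M\<close> is the etale \<open>\<phi>\<close>-module of the representation.\<close>

definition L_le :: "('v, 'd) tensor set \<Rightarrow> nat \<Rightarrow> ('v, 'd) tensor set set"
  where "L_le M h = {N. N \<subseteq> M \<and> SF_submodule N \<and> SF_finite_projective N \<and>
    {x. \<exists>n::nat. cscale (u ^ n) x \<in> N} = M \<and>
    cscale (u ^ h) ` N \<subseteq> span_over kuu (frob ` N) \<and>
    span_over kuu (frob ` N) \<subseteq> N}"

definition L_crys :: "('v, 'd) tensor set \<Rightarrow> nat \<Rightarrow> ('v, 'd) tensor set set"
  where "L_crys M h = {N \<in> L_le M h. \<forall>\<sigma>\<in>GK. \<forall>m\<in>N.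
    gact \<sigma> m - m \<in> span_over (u_pow_O (real p / (real p - 1))) N}"

definition L_SD :: "('v, 'd) tensor set \<Rightarrow> ('v, 'd) tensor set set"
  where "L_SD M = {N \<in> L_le M p. \<exists>n m (r :: nat \<Rightarrow> int).
    is_basis kuu N n m \<and>
    is_basis (power_series (u ^ p)) (frob ` N) n (\<lambda>i. cscale (u powi r i) (m i))}"

end

end

theory Submission
  imports Defs
begin

text \<open>
  Let \<open>N\<close> be a crystalline lattice and \<open>\<phi>\<close> the Frobenius. The ring \<open>k[[u]]\<close> is the direct sum of the
  \<open>u ^ j k[[u ^ p]]\<close> for \<open>j < p\<close>, and \<open>k[[u ^ p]]\<close> is its image under \<open>\<phi>\<close>, as \<open>k\<close> is perfect. So every element of
  the span \<open>N'\<close> of \<open>\<phi> (N)\<close> over \<open>k[[u]]\<close> is a sum of pieces \<open>u ^ j \<phi> (x j)\<close> with \<open>x j \<in> N\<close> and \<open>j < p\<close>.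

  The Galois condition makes the submodule \<open>u ^ p N\<close> of \<open>N'\<close> homogeneous for this decomposition. Choose \<open>\<sigma>\<close> moving the
  \<open>p\<close>-th root of the uniformiser (\<open>exists_Galois_element\<close>). Then \<open>\<sigma> u = \<epsilon> u\<close> where \<open>\<epsilon> - 1\<close> has
  valuation exactly \<open>c = p / (p - 1)\<close> (\<open>vb_epsilon_minus_1\<close>). On \<open>\<phi> (N)\<close> the operator \<open>\<sigma> - 1\<close> takes values
  divisible by \<open>u ^ (p * c) = u ^ (p + c)\<close>, because \<open>\<phi>\<close> multiplies valuations by \<open>p\<close>. So for \<open>i \<le> p\<close>,
  modulo \<open>u ^ i\<close> and as long as the individual pieces are divisible by \<open>u ^ (i - 1)\<close>, the operator
  \<open>(\<sigma> - 1) / (\<epsilon> - 1)\<close> multiplies the piece of degree \<open>j\<close> by \<open>j\<close> (\<open>euler_step\<close>). It preserves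
  \<open>u ^ i N\<close>, and its eigenvalues \<open>j < p\<close> are distinct modulo \<open>p\<close>. Hence if a sum of pieces lies in \<open>u ^ i N\<close> with
  \<open>i \<le> p\<close>, then so does each piece (\<open>pieces_divisible\<close>). As \<open>u ^ p N \<subseteq> N'\<close>, the lattice \<open>N\<close> is generated by
  elements \<open>h\<close> with \<open>u ^ r h \<in> \<phi> (N)\<close> for some \<open>r \<le> p\<close> (\<open>exists_graded_generators\<close>).

  What remains is linear algebra over the discrete valuation ring \<open>k[[u]]\<close>. A family of such generators for which
  the sum of the numbers \<open>r + 1\<close> is minimal is a basis of \<open>N\<close>, and its multiples \<open>u ^ r h\<close> form a basis of
  \<open>\<phi> (N)\<close> over \<open>k[[u ^ p]]\<close> (\<open>exists_adapted_basis\<close>).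

  The foundations are built from the definition of the tilt as an inverse limit. Its elements are represented by sequences in
  \<open>C\<close>, and an element is divisible by \<open>u ^ (p ^ n)\<close> iff its component with index \<open>n\<close> vanishes
  (\<open>tilt_in_u_pow_O_iff\<close>), which determines the valuation. The automorphism \<open>\<sigma>\<close> is obtained by Zorn's lemma from the
  embedding of \<open>K (pw 1)\<close> that multiplies \<open>pw 1\<close> by a root of unity; it is an isometry because norms on
  finite-dimensional spaces over the \<open>p\<close>-adic numbers are equivalent, and so it extends to \<open>C\<close>.
\<close>

section \<open>Linear algebra over subsets of a field\<close>

definition lincomb :: "('a::field \<Rightarrow> 'b::ab_group_add \<Rightarrow> 'b) \<Rightarrow> 'a set \<Rightarrow> 'i set \<Rightarrow> ('i \<Rightarrow> 'b) \<Rightarrow> 'b set"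
  where "lincomb scale A I m = {(\<Sum>i\<in>I. scale (c i) (m i)) | c. \<forall>i\<in>I. c i \<in> A}"

definition indep_family :: "('a::field \<Rightarrow> 'b::ab_group_add \<Rightarrow> 'b) \<Rightarrow> 'a set \<Rightarrow> 'i set \<Rightarrow> ('i \<Rightarrow> 'b) \<Rightarrow> bool"
  where "indep_family scale A I m \<longleftrightarrow>
    (\<forall>c. (\<forall>i\<in>I. c i \<in> A) \<longrightarrow> (\<Sum>i\<in>I. scale (c i) (m i)) = 0 \<longrightarrow> (\<forall>i\<in>I. c i = 0))"

definition is_subring :: "'a::field set \<Rightarrow> bool"
  where "is_subring A \<longleftrightarrow> 0 \<in> A \<and> 1 \<in> A \<and> (\<forall>x\<in>A. \<forall>y\<in>A. x + y \<in> A) \<and>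
    (\<forall>x\<in>A. \<forall>y\<in>A. x * y \<in> A) \<and> (\<forall>x\<in>A. - x \<in> A)"

text \<open>
  Of two elements, not both zero, one divides the other. Both subfields and valuation rings have this property, so
  the selection of bases below applies to the \<open>p\<close>-adic numbers and to \<open>k[[u]]\<close> alike.
\<close>

definition has_division :: "'a::field set \<Rightarrow> bool"
  where "has_division A \<longleftrightarrow> (\<forall>x\<in>A. \<forall>y\<in>A. x \<noteq> 0 \<or> y \<noteq> 0 \<longrightarrow> (y \<noteq> 0 \<and> x / y \<in> A) \<or> (x \<noteq> 0 \<and> y / x \<in> A))"

lemma is_subringD:
  assumes "is_subring A"
  shows "0 \<in> A" "1 \<in> A" "x \<in> A \<Longrightarrow> y \<in> A \<Longrightarrow> x + y \<in> A" "x \<in> A \<Longrightarrow> y \<in> A \<Longrightarrow> x * y \<in> A"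
    "x \<in> A \<Longrightarrow> - x \<in> A" "x \<in> A \<Longrightarrow> y \<in> A \<Longrightarrow> x - y \<in> A"
  using assms unfolding is_subring_def
  by (auto simp del: add_uminus_conv_diff simp add: add_uminus_conv_diff[symmetric])

lemma is_subring_sum:
  assumes "is_subring A" "\<And>i. i \<in> I \<Longrightarrow> f i \<in> A"
  shows "(\<Sum>i\<in>I. f i) \<in> A"
  using assms(2) by (induction I rule: infinite_finite_induct) (auto simp: is_subringD[OF assms(1)])

lemma is_subring_power: "is_subring A \<Longrightarrow> x \<in> A \<Longrightarrow> x ^ n \<in> A"
  by (induction n) (auto simp: is_subringD)

lemma is_subring_of_nat: "is_subring A \<Longrightarrow> of_nat n \<in> A"
  by (induction n) (auto simp: is_subringD)

lemma is_subring_of_int: "is_subring A \<Longrightarrow> of_int n \<in> A"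
  by (cases n rule: int_cases2) (auto simp: is_subringD is_subring_of_nat)

lemma lincombI: "(\<And>i. i \<in> I \<Longrightarrow> c i \<in> A) \<Longrightarrow> x = (\<Sum>i\<in>I. scale (c i) (m i)) \<Longrightarrow> x \<in> lincomb scale A I m"
  by (auto simp: lincomb_def)

lemma lincombE:
  assumes "x \<in> lincomb scale A I m"
  obtains c where "\<forall>i\<in>I. c i \<in> A" "x = (\<Sum>i\<in>I. scale (c i) (m i))"
  using assms by (auto simp: lincomb_def)

lemma indep_familyD:
  "indep_family scale A I m \<Longrightarrow> (\<And>i. i \<in> I \<Longrightarrow> c i \<in> A) \<Longrightarrow> (\<Sum>i\<in>I. scale (c i) (m i)) = 0 \<Longrightarrow> i \<in> I \<Longrightarrow> c i = 0"
  unfolding indep_family_def by blast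

context vector_space
begin

lemma lincomb_add:
  assumes A: "is_subring A" and "x \<in> lincomb scale A I m" "y \<in> lincomb scale A I m"
  shows "x + y \<in> lincomb scale A I m"
proof -
  obtain c where c: "\<forall>i\<in>I. c i \<in> A" "x = (\<Sum>i\<in>I. scale (c i) (m i))"
    using assms(2) by (rule lincombE)
  obtain d where d: "\<forall>i\<in>I. d i \<in> A" "y = (\<Sum>i\<in>I. scale (d i) (m i))"
    using assms(3) by (rule lincombE)
  show ?thesis
    by (rule lincombI[where c = "\<lambda>i. c i + d i"])
      (auto simp: c d scale_left_distrib sum.distrib is_subringD[OF A])
qed

lemma lincomb_scale:
  assumes A: "is_subring A" and "a \<in> A" "x \<in> lincomb scale A I m"
  shows "scale a x \<in> lincomb scale A I m"
proof -
  obtain c where c: "\<forall>i\<in>I. c i \<in> A" "x = (\<Sum>i\<in>I. scale (c i) (m i))"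
    using assms(3) by (rule lincombE)
  show ?thesis
    by (rule lincombI[where c = "\<lambda>i. a * c i"])
      (auto simp: c scale_sum_right is_subringD[OF A] assms(2))
qed

lemma lincomb_zero: "is_subring A \<Longrightarrow> 0 \<in> lincomb scale A I m"
  by (rule lincombI[where c = "\<lambda>_. 0"]) (auto simp: is_subringD)

lemma lincomb_sum:
  assumes A: "is_subring A" and "\<And>j. j \<in> J \<Longrightarrow> f j \<in> lincomb scale A I m"
  shows "(\<Sum>j\<in>J. f j) \<in> lincomb scale A I m"
  using assms(2)
  by (induction J rule: infinite_finite_induct) (auto simp: lincomb_zero lincomb_add A)

lemma lincomb_member:
  assumes "is_subring A" "finite I" "i \<in> I"
  shows "m i \<in> lincomb scale A I m"
proof (rule lincombI[where c = "\<lambda>j. if j = i then 1 else 0"])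
  show "m i = (\<Sum>j\<in>I. scale (if j = i then 1 else 0) (m j))"
    using assms by (simp add: if_distrib[of "\<lambda>c. scale c _"] if_distribR cong: if_cong)
qed (auto simp: is_subringD assms)

lemma lincomb_subset:
  assumes "is_subring A" "\<And>i. i \<in> I \<Longrightarrow> m i \<in> lincomb scale A J k"
  shows "lincomb scale A I m \<subseteq> lincomb scale A J k"
proof
  fix x assume "x \<in> lincomb scale A I m"
  then obtain c where c: "\<forall>i\<in>I. c i \<in> A" "x = (\<Sum>i\<in>I. scale (c i) (m i))"
    by (rule lincombE)
  show "x \<in> lincomb scale A J k"
    unfolding c by (intro lincomb_sum lincomb_scale assms c(1)[rule_format])
qed

lemma lincomb_remove:
  assumes A: "is_subring A" and I: "finite I" and l: "m l \<in> lincomb scale A (I - {l}) m"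
  shows "lincomb scale A (I - {l}) m = lincomb scale A I m"
proof
  show "lincomb scale A I m \<subseteq> lincomb scale A (I - {l}) m"
  proof (rule lincomb_subset[OF A])
    fix i assume "i \<in> I"
    then show "m i \<in> lincomb scale A (I - {l}) m"
      using l lincomb_member[OF A, of "I - {l}" i m] I by (cases "i = l") auto
  qed
  show "lincomb scale A (I - {l}) m \<subseteq> lincomb scale A I m"
    by (rule lincomb_subset[OF A]) (auto intro!: lincomb_member A I)
qed

lemma lincomb_isolate:
  assumes A: "is_subring A" and I: "finite I" "l \<in> I" and x: "x = (\<Sum>i\<in>I. scale (c i) (m i))"
    and l: "c l \<noteq> 0" and q: "\<And>i. i \<in> I \<Longrightarrow> c i / c l \<in> A"
    and y: "scale (1 / c l) x \<in> lincomb scale A J k"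
    and J: "\<And>i. i \<in> I - {l} \<Longrightarrow> m i \<in> lincomb scale A J k"
  shows "m l \<in> lincomb scale A J k"
proof -
  have "scale (1 / c l) x = (\<Sum>i\<in>I. scale (c i / c l) (m i))"
    by (simp add: x scale_sum_right)
  also have "\<dots> = m l + (\<Sum>i\<in>I-{l}. scale (c i / c l) (m i))"
    using I l by (simp add: sum.remove)
  finally have "m l = scale (1 / c l) x + (\<Sum>i\<in>I-{l}. scale (- (c i / c l)) (m i))"
    by (simp add: sum_negf)
  then show ?thesis
    using y by (auto intro!: lincomb_add[OF A] lincomb_sum[OF A] lincomb_scale[OF A] J is_subringD(5)[OF A] q
        simp del: scale_minus_left)
qed

text \<open>In a vanishing combination divide by a coefficient that divides all others.\<close>

lemma irredundant_imp_indep: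
  assumes A: "is_subring A" "has_division A" and I: "finite I"
    and irr: "\<And>l. l \<in> I \<Longrightarrow> m l \<notin> lincomb scale A (I - {l}) m"
  shows "indep_family scale A I m"
  unfolding indep_family_def
proof (intro allI impI ballI, rule ccontr)
  fix c i assume c: "\<forall>i\<in>I. c i \<in> A" "(\<Sum>i\<in>I. scale (c i) (m i)) = 0" and i: "i \<in> I" "c i \<noteq> 0"
  have "\<exists>l\<in>J. c l \<noteq> 0 \<and> (\<forall>i\<in>J. c i / c l \<in> A)" if "finite J" "J \<subseteq> I" "\<exists>i\<in>J. c i \<noteq> 0" for J
    using that
  proof (induction J)
    case (insert j J)
    show ?case
    proof (cases "\<exists>i\<in>J. c i \<noteq> 0")
      case True
      then obtain l where l: "l \<in> J" "c l \<noteq> 0" "\<forall>i\<in>J. c i / c l \<in> A"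
        using insert by blast
      show ?thesis
      proof (cases "c j / c l \<in> A")
        case True
        then show ?thesis using l by auto
      next
        case False
        then have j: "c j \<noteq> 0" "c l / c j \<in> A"
          using A(2)[unfolded has_division_def, rule_format, of "c l" "c j"] c(1) l insert(4) by auto
        have "c i / c j \<in> A" if "i \<in> J" for i
        proof -
          have "c i / c j = (c i / c l) * (c l / c j)" using l by simp
          then show ?thesis using that l j is_subringD(4)[OF A(1)] by metis
        qed
        then show ?thesis using j is_subringD(2)[OF A(1)] by auto
      qed
    next
      case False
      then have "c j \<noteq> 0" using insert by auto
      then show ?thesis using False is_subringD(1,2)[OF A(1)] by auto
    qed
  qed simp
  then obtain l where l: "l \<in> I" "c l \<noteq> 0" "\<forall>i\<in>I. c i / c l \<in> A"
    using I i by blast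
  have "m l \<in> lincomb scale A (I - {l}) m"
    by (rule lincomb_isolate[OF A(1) I l(1) c(2)[symmetric] l(2)])
      (use l I in \<open>auto simp: lincomb_zero[OF A(1)] intro!: lincomb_member[OF A(1)]\<close>)
  with irr l(1) show False by blast
qed

lemma exists_indep_subfamily:
  assumes A: "is_subring A" "has_division A" and I: "finite I"
  shows "\<exists>J\<subseteq>I. lincomb scale A J m = lincomb scale A I m \<and> indep_family scale A J m"
  using I
proof (induction "card I" arbitrary: I rule: less_induct)
  case less
  show ?case
  proof (cases "\<exists>l\<in>I. m l \<in> lincomb scale A (I - {l}) m")
    case False
    then show ?thesis
      using irredundant_imp_indep[OF A less(2)] by blast
  next
    case True
    then obtain l where l: "l \<in> I" "m l \<in> lincomb scale A (I - {l}) m" by blast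
    have "card (I - {l}) < card I"
      using l less(2) by (metis card_Diff1_less)
    then obtain J where J: "J \<subseteq> I - {l}" "lincomb scale A J m = lincomb scale A (I - {l}) m"
        "indep_family scale A J m"
      using less(1)[of "I - {l}"] less(2) by auto
    then show ?thesis using lincomb_remove[OF A(1) less(2) l(2)] by auto
  qed
qed

end

section \<open>Tensors\<close>

lemma tensor_induct [case_names zero tens diff]:
  fixes t :: "('a::ab_group_add, 'b::ab_group_add) tensor"
  assumes "P 0" "\<And>a b. P (tens a b)" "\<And>s t. P s \<Longrightarrow> P t \<Longrightarrow> P (s - t)"
  shows "P t"
proof -
  obtain x where x: "t = abs_tensor x"
    using Quotient3_abs_rep[OF Quotient3_tensor, symmetric] by blast
  have "P (abs_tensor x)"
  proof (induction x rule: frag_induction[OF subset_UNIV])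
    case 1
    then show ?case using assms(1) by (simp add: zero_tensor.abs_eq)
  next
    case (2 x)
    then show ?case using assms(2)[of "fst x" "snd x"] by (simp add: tens.abs_eq)
  next
    case (3 a b)
    then show ?case using assms(3) by (simp add: minus_tensor.abs_eq[symmetric])
  qed
  then show ?thesis by (simp add: x)
qed

lemma additive_imp_diff:
  fixes f :: "'a::ab_group_add \<Rightarrow> 'b::ab_group_add"
  assumes "\<And>x y. f (x + y) = f x + f y"
  shows "f (x - y) = f x - f y"
  using assms[of "x - y" y] by (simp add: algebra_simps)

lemma additive_imp_zero:
  fixes f :: "'a::ab_group_add \<Rightarrow> 'b::ab_group_add"
  assumes "\<And>x y. f (x + y) = f x + f y"
  shows "f 0 = 0"
  using assms[of 0 0] by simp

lemma additive_imp_sum: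
  fixes f :: "'a::ab_group_add \<Rightarrow> 'b::ab_group_add"
  assumes "\<And>x y. f (x + y) = f x + f y"
  shows "f (\<Sum>i\<in>I. g i) = (\<Sum>i\<in>I. f (g i))"
  by (induction I rule: infinite_finite_induct) (auto simp: assms additive_imp_zero[of f, OF assms])

lemma tensor_ext:
  fixes f g :: "('a::ab_group_add, 'b::ab_group_add) tensor \<Rightarrow> 'c::ab_group_add"
  assumes f: "\<And>x y. f (x + y) = f x + f y" and g: "\<And>x y. g (x + y) = g x + g y"
    and fg: "\<And>a b. f (tens a b) = g (tens a b)"
  shows "f t = g t"
  by (induction t rule: tensor_induct)
    (simp_all add: fg additive_imp_zero[of f, OF f] additive_imp_zero[of g, OF g]
      additive_imp_diff[of f, OF f] additive_imp_diff[of g, OF g])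

lemma tens_add_right: "tens a (b + b') = tens a b + tens a b'"
proof -
  have "tensor_eq (frag_of (a, b + b')) (frag_of (a, b) + frag_of (a, b'))"
    using tensor_rel.right[of a b b'] by (simp add: tensor_eq_def algebra_simps)
  then show ?thesis
    by (simp add: tens.abs_eq plus_tensor.abs_eq tensor.abs_eq_iff)
qed

lemma cscale_tens: "cscale c (tens a b) = tens a (c * b)"
  by (simp add: cscale_def tensor_map_tens algebra_simps)

lemma cscale_add: "cscale c (x + y) = cscale c x + cscale c y"
  by (simp add: cscale_def tensor_map_add algebra_simps)

interpretation cs: vector_space "cscale :: 'd::field \<Rightarrow> ('a::ab_group_add, 'd) tensor \<Rightarrow> _"
proof
  fix a b :: 'd and x y :: "('a, 'd) tensor"
  show "cscale a (x + y) = cscale a x + cscale a y" by (rule cscale_add)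
  show "cscale (a + b) x = cscale a x + cscale b x"
    by (rule tensor_ext) (auto simp: cscale_add cscale_tens algebra_simps tens_add_right)
  show "cscale a (cscale b x) = cscale (a * b) x"
    by (rule tensor_ext) (auto simp: cscale_add cscale_tens algebra_simps)
  show "cscale 1 x = x"
    by (rule tensor_ext) (auto simp: cscale_add cscale_tens)
qed

text \<open>
  Semilinearity is checked on pure tensors; it applies to the Frobenius and to the Galois action.
\<close>

lemma tensor_map_cscale:
  assumes f: "\<And>x y. f (x + y) = f x + f y" and g: "\<And>x y. g (x + y) = g x + g y"
    and mult: "\<And>x. g (c * x) = \<tau> c * g x"
  shows "tensor_map f g (cscale c t) = cscale (\<tau> c) (tensor_map f g t)"
  by (rule tensor_ext[where f = "\<lambda>t. tensor_map f g (cscale c t)" and g = "\<lambda>t. cscale (\<tau> c) (tensor_map f g t)"])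
    (simp_all add: cscale_add cscale_tens tensor_map_tens[of f g, OF f g] tensor_map_add[of f g, OF f g] mult)

lemma span_overI:
  fixes n :: nat
  shows "x = (\<Sum>i<n. cscale (c i) (s i)) \<Longrightarrow> (\<And>i. i < n \<Longrightarrow> c i \<in> A) \<Longrightarrow> (\<And>i. i < n \<Longrightarrow> s i \<in> S) \<Longrightarrow>
    x \<in> span_over A S"
  unfolding span_over_def mem_Collect_eq
  by (rule exI[where x = n], rule exI[where x = c], rule exI[where x = s]) simp

lemma span_over_member: "1 \<in> A \<Longrightarrow> x \<in> S \<Longrightarrow> x \<in> span_over A S"
  by (rule span_overI[where n = "Suc 0" and c = "\<lambda>_. 1" and s = "\<lambda>_. x"]) simp_all

lemma span_over_add:
  assumes "x \<in> span_over A S" "y \<in> span_over A S"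
  shows "x + y \<in> span_over A S"
proof -
  obtain n c s where x: "x = (\<Sum>i<n. cscale (c i) (s i))" "\<forall>i<(n::nat). c i \<in> A" "\<forall>i<n. s i \<in> S"
    using assms(1) by (auto simp: span_over_def)
  obtain k d t where y: "y = (\<Sum>i<k. cscale (d i) (t i))" "\<forall>i<(k::nat). d i \<in> A" "\<forall>i<k. t i \<in> S"
    using assms(2) by (auto simp: span_over_def)
  let ?c = "\<lambda>i. if i < n then c i else d (i - n)" and ?s = "\<lambda>i. if i < n then s i else t (i - n)"
  have "(\<Sum>i<n + k. cscale (?c i) (?s i)) = (\<Sum>i<n. cscale (?c i) (?s i)) + (\<Sum>i<k. cscale (?c (n + i)) (?s (n + i)))"
    by (induction k) (simp_all add: add.assoc)
  then have "x + y = (\<Sum>i<n + k. cscale (?c i) (?s i))"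
    by (simp add: x y)
  then show ?thesis
    by (rule span_overI) (use x y in auto)
qed

lemma span_over_sum:
  "0 \<in> A \<Longrightarrow> (\<And>i. i \<in> I \<Longrightarrow> f i \<in> span_over A S) \<Longrightarrow> (\<Sum>i\<in>I. f i) \<in> span_over A S"
  by (induction I rule: infinite_finite_induct)
    (auto intro: span_over_add span_overI[where n = 0 and c = "\<lambda>_. 0" and s = "\<lambda>_. 0"])

lemma span_over_scale:
  assumes "\<And>y. y \<in> A \<Longrightarrow> a * y \<in> B" "x \<in> span_over A S"
  shows "cscale a x \<in> span_over B S"
proof -
  obtain n c s where x: "x = (\<Sum>i<n. cscale (c i) (s i))" "\<forall>i<(n::nat). c i \<in> A" "\<forall>i<n. s i \<in> S"
    using assms(2) by (auto simp: span_over_def)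
  show ?thesis
    by (rule span_overI[where n = n and c = "\<lambda>i. a * c i" and s = s])
      (use x assms(1) in \<open>auto simp: cs.scale_sum_right\<close>)
qed

section \<open>The absolute value\<close>

lemma subfield_typeD:
  fixes L :: "'a::field set"
  assumes "subfield L ring_of_type_algebra"
  shows "0 \<in> L" "1 \<in> L" "x \<in> L \<Longrightarrow> y \<in> L \<Longrightarrow> x + y \<in> L" "x \<in> L \<Longrightarrow> y \<in> L \<Longrightarrow> x * y \<in> L"
    "x \<in> L \<Longrightarrow> - x \<in> L" "x \<in> L \<Longrightarrow> inverse x \<in> L"
proof -
  interpret R: field "ring_of_type_algebra :: 'a ring" by (rule field_from_type_algebra)
  let ?R = "ring_of_type_algebra :: 'a ring"
  have ops [simp]: "x \<otimes>\<^bsub>?R\<^esub> y = x * y" "x \<oplus>\<^bsub>?R\<^esub> y = x + y" "\<zero>\<^bsub>?R\<^esub> = 0" "\<one>\<^bsub>?R\<^esub> = 1"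
    "carrier ?R = UNIV" for x y
    by (auto simp: ring_of_type_algebra_def)
  have sr: "subring L ?R" using subfieldE(1)[OF assms] by (simp add: subcring_def)
  show zero: "0 \<in> L" using subringE(2)[OF sr] by simp
  show "1 \<in> L" using subringE(3)[OF sr] by simp
  show "x \<in> L \<Longrightarrow> y \<in> L \<Longrightarrow> x + y \<in> L" for x y using subringE(7)[OF sr, of x y] by simp
  show "x \<in> L \<Longrightarrow> y \<in> L \<Longrightarrow> x * y \<in> L" for x y using subringE(6)[OF sr, of x y] by simp
  show "- x \<in> L" if "x \<in> L" for x
  proof -
    have "\<ominus>\<^bsub>?R\<^esub> x = - x"
      by (rule R.minus_equality[of "- x" x]) auto
    then show ?thesis using subringE(5)[OF sr that] by simp
  qed
  show "inverse x \<in> L" if "x \<in> L" for x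
  proof (cases "x = 0")
    case False
    have "inv\<^bsub>?R\<^esub> x = inverse x"
      using R.inv_char[of x "inverse x"] False by simp
    then show ?thesis using R.subfield_m_inv(1)[OF assms, of x] that False by simp
  qed (simp add: zero)
qed

lemma subfield_is_subring: "subfield L ring_of_type_algebra \<Longrightarrow> is_subring L"
  unfolding is_subring_def by (auto dest: subfield_typeD)

lemma subfield_divide:
  fixes L :: "'a::field set"
  shows "subfield L ring_of_type_algebra \<Longrightarrow> x \<in> L \<Longrightarrow> y \<in> L \<Longrightarrow> x / y \<in> L"
  unfolding divide_inverse by (rule subfield_typeD(4)) (auto intro: subfield_typeD(6))

context unramified_field
begin

lemma p_ge_2: "p \<ge> 2" using prime_p by (rule prime_ge_2_nat)

lemma p_pos [simp]: "p > 0" "0 < real p" "p \<noteq> 0" using p_ge_2 by auto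

lemma inv_p_less_1: "1 / real p < 1" using p_ge_2 by simp

lemma nrm_0 [simp]: "nrm 0 = 0" by (simp add: nrm_eq_0)

lemma nrm_pos: "x \<noteq> 0 \<Longrightarrow> nrm x > 0"
  using nrm_nonneg[of x] nrm_eq_0[of x] by linarith

lemma nrm_1 [simp]: "nrm 1 = 1"
  using nrm_mult[of 1 1] nrm_pos[of 1] by simp

lemma nrm_minus [simp]: "nrm (- x) = nrm x"
proof -
  have "nrm (- 1) ^ 2 = 1" using nrm_mult[of "- 1" "- 1"] by (simp add: power2_eq_square)
  then have "nrm (- 1) = 1" using nrm_nonneg[of "- 1"] by (auto simp: power2_eq_1_iff)
  then show ?thesis using nrm_mult[of "- 1" x] by simp
qed

lemma nrm_diff: "nrm (x - y) \<le> max (nrm x) (nrm y)"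
  using nrm_add[of x "- y"] by simp

lemma nrm_minus_commute: "nrm (x - y) = nrm (y - x)"
  using nrm_minus[of "x - y"] by simp

lemma nrm_power [simp]: "nrm (x ^ n) = nrm x ^ n"
  by (induction n) (auto simp: nrm_mult)

lemma nrm_inverse: "nrm (inverse x) = inverse (nrm x)"
proof (cases "x = 0")
  case False
  then have "nrm x * nrm (inverse x) = 1" by (simp add: nrm_mult[symmetric])
  then show ?thesis by (simp add: inverse_unique)
qed simp

lemma nrm_divide: "nrm (x / y) = nrm x / nrm y"
  by (simp add: divide_inverse nrm_mult nrm_inverse)

lemma nrm_add_le: "nrm x \<le> B \<Longrightarrow> nrm y \<le> B \<Longrightarrow> nrm (x + y) \<le> B"
  using nrm_add[of x y] by simp

lemma nrm_diff_le: "nrm x \<le> B \<Longrightarrow> nrm y \<le> B \<Longrightarrow> nrm (x - y) \<le> B"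
  using nrm_diff[of x y] by simp

lemma nrm_trans: "nrm (x - y) \<le> B \<Longrightarrow> nrm (y - z) \<le> B \<Longrightarrow> nrm (x - z) \<le> B"
  using nrm_add_le[of "x - y" B "y - z"] by simp

lemma nrm_sum_le: "0 \<le> B \<Longrightarrow> (\<And>i. i \<in> I \<Longrightarrow> nrm (f i) \<le> B) \<Longrightarrow> nrm (\<Sum>i\<in>I. f i) \<le> B"
  by (induction I rule: infinite_finite_induct) (auto intro: nrm_add_le)

lemma nrm_sum_less: "finite I \<Longrightarrow> 0 < B \<Longrightarrow> (\<And>i. i \<in> I \<Longrightarrow> nrm (f i) < B) \<Longrightarrow> nrm (\<Sum>i\<in>I. f i) < B"
  by (induction I rule: finite_induct) (auto intro: le_less_trans[OF nrm_add])

lemma nrm_eqI: "nrm (x - y) < nrm x \<Longrightarrow> nrm y = nrm x"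
  using nrm_add[of "x - y" y] nrm_diff[of x "x - y"] by auto

lemma nrm_of_nat_le: "nrm (of_nat n) \<le> 1"
  by (induction n) (auto intro: nrm_add_le)

lemma nrm_of_int_le: "nrm (of_int n) \<le> 1"
  by (cases n rule: int_cases2) (auto simp: nrm_of_nat_le)

lemma nrm_of_int_mult_p: "int p dvd n \<Longrightarrow> nrm (of_int n) \<le> 1 / p"
  using nrm_of_int_le by (auto simp: nrm_mult nrm_p mult_le_cancel_right1 divide_simps)

lemma nrm_of_nat_mult_p:
  assumes "p dvd n" shows "nrm (of_nat n) \<le> 1 / p"
  using nrm_of_int_mult_p[of "int n"] assms by simp

lemma nrm_of_int_coprime:
  assumes "\<not> int p dvd n" shows "nrm (of_int n) = 1"
proof -
  have "coprime (int p) n"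
    using assms prime_p by (simp add: prime_imp_coprime)
  then obtain a b where ab: "a * int p + b * n = 1"
    using bezout_int[of "int p" n] by auto
  have "of_int (a * int p + b * n) = (1::'c)" by (simp only: ab of_int_1)
  then have "nrm (1 - of_int b * of_int n) = nrm (of_int a * of_nat p)"
    by (metis add_diff_cancel_right' of_int_add of_int_mult of_int_of_nat_eq)
  also have "\<dots> \<le> 1 / p"
    using nrm_of_int_le[of a] by (simp add: nrm_mult nrm_p divide_right_mono)
  also have "\<dots> < 1" by (rule inv_p_less_1)
  finally have "nrm (of_int b * of_int n) = 1"
    using nrm_eqI[of 1 "of_int b * of_int n"] by simp
  then have *: "nrm (of_int b) * nrm (of_int n) = 1" by (simp add: nrm_mult)
  have "1 \<le> nrm (of_int n)"
    using mult_right_mono[OF nrm_of_int_le[of b] nrm_nonneg[of "of_int n"]] * by simp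
  with nrm_of_int_le[of n] show ?thesis by simp
qed

lemma nrm_rat:
  assumes "q \<in> \<rat>" "q \<noteq> 0"
  shows "\<exists>k. nrm q = real p powi k"
proof -
  have int: "\<exists>k. nrm (of_int n) = real p powi k" if n0: "n \<noteq> 0" for n
  proof -
    obtain m where m: "n = int p ^ multiplicity (int p) n * m" "\<not> int p dvd m"
      by (rule multiplicity_decompose'[OF n0, of "int p"]) (use p_ge_2 in auto)
    have "nrm (of_int n) = (1 / p) ^ multiplicity (int p) n"
      by (subst m(1)) (simp add: nrm_mult nrm_p nrm_of_int_coprime[OF m(2)])
    also have "\<dots> = real p powi (- int (multiplicity (int p) n))"
      by (simp add: power_int_minus divide_inverse power_inverse)
    finally show ?thesis by blast
  qed
  obtain a b where ab: "q = of_int a / of_int b" "b \<noteq> 0"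
    using assms(1) by (auto elim!: Rats_cases')
  then have "a \<noteq> 0" using assms(2) by auto
  then obtain k l where "nrm (of_int a) = real p powi k" "nrm (of_int b) = real p powi l"
    using int ab(2) by meson
  then have "nrm q = real p powi (k - l)"
    by (simp add: ab nrm_divide power_int_diff)
  then show ?thesis by blast
qed

text \<open>
  The value group of the rational numbers is generated by \<open>p\<close>, and neither completion nor the unramified extension changes it.
\<close>

lemma nrm_K:
  assumes "x \<in> K" "x \<noteq> 0"
  shows "\<exists>k. nrm x = real p powi k"
proof -
  obtain y where y: "y \<in> Qp_in nrm" "nrm x = nrm y"
    using K_unramified assms(1) by (metis imageE imageI)
  have "nrm y > 0" using nrm_pos[OF assms(2)] y by simp
  then obtain q where q: "q \<in> \<rat>" "nrm (y - q) < nrm y"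
    using y(1) by (auto simp: Qp_in_def)
  then have "nrm q = nrm y" using nrm_eqI by blast
  moreover have "q \<noteq> 0" using calculation \<open>nrm y > 0\<close> by auto
  ultimately show ?thesis using nrm_rat[OF q(1)] y by auto
qed

lemma powi_less_1_imp: "real p powi k < 1 \<Longrightarrow> real p powi k \<le> 1 / p"
proof -
  assume "real p powi k < 1"
  then have "k < 0"
    using p_ge_2 by (metis linorder_not_le of_nat_1 of_nat_le_iff one_le_power_int prime_ge_1_nat prime_p)
  then have "real p powi k \<le> real p powi (- 1)"
    using p_ge_2 by (intro power_int_increasing) auto
  then show ?thesis by (simp add: power_int_minus divide_inverse)
qed

lemma nrm_K_less_1: "x \<in> K \<Longrightarrow> nrm x < 1 \<Longrightarrow> nrm x \<le> 1 / p"
  using nrm_K[of x] powi_less_1_imp by (cases "x = 0") auto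

text \<open>
  The mixed binomial coefficients are divisible by \<open>p\<close>, and each mixed term contains a factor \<open>x\<close>.
\<close>

lemma nrm_power_p_add_le:
  assumes "nrm x \<le> 1" "nrm y \<le> 1"
  shows "nrm ((x + y) ^ p - (x ^ p + y ^ p)) \<le> nrm x / p"
proof -
  have "(x + y) ^ p = (\<Sum>k\<le>p. of_nat (p choose k) * x ^ k * y ^ (p - k))"
    by (rule binomial_ring)
  also have "\<dots> = y ^ p + (\<Sum>k=1..p. of_nat (p choose k) * x ^ k * y ^ (p - k))"
    by (simp add: atMost_atLeast0 sum.atLeast_Suc_atMost)
  also have "{1..p} = insert p {1..<p}" using p_ge_2 by auto
  finally have eq: "(x + y) ^ p - (x ^ p + y ^ p) = (\<Sum>k=1..<p. of_nat (p choose k) * x ^ k * y ^ (p - k))"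
    by simp
  show ?thesis unfolding eq
  proof (rule nrm_sum_le)
    fix k assume k: "k \<in> {1..<p}"
    then have "p dvd (p choose k)"
      using prime_p by (intro dvd_choose_prime) auto
    then have "nrm (of_nat (p choose k)) \<le> 1 / p" by (rule nrm_of_nat_mult_p)
    moreover have "nrm x ^ k \<le> nrm x ^ 1"
      using k assms nrm_nonneg by (intro power_decreasing) auto
    ultimately have "nrm (of_nat (p choose k)) * nrm x ^ k * nrm y ^ (p - k) \<le> 1 / p * nrm x ^ 1 * 1"
      using assms nrm_nonneg by (intro mult_mono power_le_one) auto
    then show "nrm (of_nat (p choose k) * x ^ k * y ^ (p - k)) \<le> nrm x / p"
      by (simp add: nrm_mult)
  qed (simp add: nrm_nonneg)
qed

lemma nrm_power_p_add:
  assumes "nrm x \<le> 1" "nrm y \<le> 1"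
  shows "nrm ((x + y) ^ p - (x ^ p + y ^ p)) \<le> 1 / p"
  using nrm_power_p_add_le[OF assms] divide_right_mono[OF assms(1), of "real p"] by simp

lemma nrm_power_p_diff:
  assumes "nrm x \<le> 1" "nrm y \<le> 1"
  shows "nrm (x ^ p - y ^ p) \<le> max (nrm (x - y) / p) (nrm (x - y) ^ p)"
proof -
  have "nrm (x ^ p - ((x - y) ^ p + y ^ p)) \<le> nrm (x - y) / p"
    using nrm_power_p_add_le[of "x - y" y] assms nrm_diff_le[OF assms] by simp
  then show ?thesis
    using nrm_add[of "x ^ p - ((x - y) ^ p + y ^ p)" "(x - y) ^ p"] by auto
qed

text \<open>
  Keeping the linear term leaves an error quadratic in \<open>b\<close>; this is what locates the absolute value of \<open>s - 1\<close> for a root of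
  unity \<open>s\<close>, also for \<open>p = 2\<close>.
\<close>

lemma nrm_power_p_one_plus:
  assumes "nrm b \<le> 1"
  shows "nrm ((1 + b) ^ p - (1 + b ^ p + of_nat p * b)) \<le> nrm b ^ 2 / p"
proof -
  have "(1 + b) ^ p = (\<Sum>k\<le>p. of_nat (p choose k) * b ^ k)"
    using binomial_ring[of b 1 p] by (simp add: add.commute)
  also have "{..p} = {0, 1, p} \<union> {2..<p}" using p_ge_2 by auto
  also have "(\<Sum>k\<in>\<dots>. of_nat (p choose k) * b ^ k) =
      (\<Sum>k\<in>{0, 1, p}. of_nat (p choose k) * b ^ k) + (\<Sum>k\<in>{2..<p}. of_nat (p choose k) * b ^ k)"
    by (rule sum.union_disjoint) auto
  also have "(\<Sum>k\<in>{0, 1, p}. of_nat (p choose k) * b ^ k) = 1 + b ^ p + of_nat p * b"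
    using p_ge_2 by (simp add: algebra_simps)
  finally have eq: "(1 + b) ^ p - (1 + b ^ p + of_nat p * b) = (\<Sum>k\<in>{2..<p}. of_nat (p choose k) * b ^ k)"
    by simp
  show ?thesis unfolding eq
  proof (rule nrm_sum_le)
    fix k assume k: "k \<in> {2..<p}"
    then have "p dvd (p choose k)"
      using prime_p by (intro dvd_choose_prime) auto
    then have "nrm (of_nat (p choose k)) \<le> 1 / p" by (rule nrm_of_nat_mult_p)
    moreover have "nrm b ^ k \<le> nrm b ^ 2"
      using k assms nrm_nonneg by (intro power_decreasing) auto
    ultimately have "nrm (of_nat (p choose k)) * nrm b ^ k \<le> 1 / p * nrm b ^ 2"
      using nrm_nonneg by (intro mult_mono) auto
    then show "nrm (of_nat (p choose k) * b ^ k) \<le> nrm b ^ 2 / p"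
      by (simp add: nrm_mult)
  qed simp
qed

section \<open>Integers of \<open>C\<close> modulo \<open>p\<close> and compatible sequences\<close>

abbreviation coset :: "'c \<Rightarrow> 'c set"
  where "coset a \<equiv> pOC +>\<^bsub>OC\<^esub> a"

lemma OC_simps [simp]:
  "carrier OC = {x. nrm x \<le> 1}" "x \<otimes>\<^bsub>OC\<^esub> y = x * y" "x \<oplus>\<^bsub>OC\<^esub> y = x + y" "\<zero>\<^bsub>OC\<^esub> = 0" "\<one>\<^bsub>OC\<^esub> = 1"
  by (auto simp: OC_def ring_of_type_algebra_def)

lemma cring_OC: "cring OC"
proof -
  let ?R = "ring_of_type_algebra :: 'c ring"
  interpret R: field ?R by (rule field_from_type_algebra)
  have ops [simp]: "x \<otimes>\<^bsub>?R\<^esub> y = x * y" "x \<oplus>\<^bsub>?R\<^esub> y = x + y" "\<zero>\<^bsub>?R\<^esub> = 0" "\<one>\<^bsub>?R\<^esub> = 1"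
    "carrier ?R = UNIV" for x y
    by (auto simp: ring_of_type_algebra_def)
  have minus [simp]: "\<ominus>\<^bsub>?R\<^esub> x = - x" for x
    by (rule R.minus_equality[of "- x" x]) auto
  have "subring {x. nrm x \<le> 1} ?R"
    by (rule R.subringI) (auto simp: nrm_add_le nrm_mult nrm_nonneg intro: mult_le_one)
  then have "subcring {x. nrm x \<le> 1} ?R" by (rule R.subcringI')
  then show ?thesis
    unfolding OC_def by (rule R.subcring_iff[THEN iffD1, rotated]) auto
qed

lemma pOC_eq: "pOC = {z. nrm z \<le> 1 / p}"
proof (intro Set.set_eqI iffI)
  fix z assume "z \<in> pOC"
  then obtain x where "nrm x \<le> 1" "z = x * of_nat p"
    by (auto simp: pOC_def cgenideal_def)
  then show "z \<in> {z. nrm z \<le> 1 / p}"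
    by (simp add: nrm_mult nrm_p divide_right_mono)
next
  fix z assume "z \<in> {z. nrm z \<le> 1 / p}"
  then have "nrm (z / of_nat p) \<le> 1" "z = z / of_nat p * of_nat p"
    by (auto simp: nrm_divide nrm_p divide_simps mult.commute)
  then show "z \<in> pOC"
    unfolding pOC_def cgenideal_def using p_ge_2 by (auto intro!: exI[of _ "z / of_nat p"])
qed

lemma ideal_pOC: "ideal pOC OC"
proof -
  interpret cring OC by (rule cring_OC)
  show ?thesis
    unfolding pOC_def by (rule cgenideal_ideal) (simp add: nrm_of_nat_le)
qed

lemma coset_eq_ball: "coset a = {z. nrm (z - a) \<le> 1 / p}"
proof (intro Set.set_eqI iffI)
  fix z assume "z \<in> {z. nrm (z - a) \<le> 1 / p}"
  then show "z \<in> coset a"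
    unfolding a_r_coset_def' pOC_eq by (auto intro!: bexI[of _ "z - a"])
qed (auto simp: a_r_coset_def' pOC_eq)

lemma coset_eq_iff: "coset a = coset b \<longleftrightarrow> nrm (a - b) \<le> 1 / p"
proof
  assume "coset a = coset b"
  moreover have "a \<in> coset a" by (simp add: coset_eq_ball)
  ultimately show "nrm (a - b) \<le> 1 / p" by (simp add: coset_eq_ball)
next
  assume ab: "nrm (a - b) \<le> 1 / p"
  show "coset a = coset b"
    unfolding coset_eq_ball
    using nrm_trans[OF _ ab] nrm_trans[OF _ ab[unfolded nrm_minus_commute[of a]]] by blast
qed

lemma OC_mod_p_simps:
  "carrier OC_mod_p = coset ` {x. nrm x \<le> 1}"
  "\<one>\<^bsub>OC_mod_p\<^esub> = coset 1"
  "nrm a \<le> 1 \<Longrightarrow> nrm b \<le> 1 \<Longrightarrow> coset a \<otimes>\<^bsub>OC_mod_p\<^esub> coset b = coset (a * b)"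
  "nrm a \<le> 1 \<Longrightarrow> nrm b \<le> 1 \<Longrightarrow> coset a \<oplus>\<^bsub>OC_mod_p\<^esub> coset b = coset (a + b)"
proof -
  interpret ideal pOC OC by (rule ideal_pOC)
  note hom = rcos_ring_hom
  show "carrier OC_mod_p = coset ` {x. nrm x \<le> 1}"
    by (auto simp: OC_mod_p_def FactRing_def A_RCOSETS_def')
  show "\<one>\<^bsub>OC_mod_p\<^esub> = coset 1"
    using ring_hom_one[OF hom] by (simp add: OC_mod_p_def)
  show "nrm a \<le> 1 \<Longrightarrow> nrm b \<le> 1 \<Longrightarrow> coset a \<otimes>\<^bsub>OC_mod_p\<^esub> coset b = coset (a * b)"
    using ring_hom_mult[OF hom, of a b] by (simp add: OC_mod_p_def)
  show "nrm a \<le> 1 \<Longrightarrow> nrm b \<le> 1 \<Longrightarrow> coset a \<oplus>\<^bsub>OC_mod_p\<^esub> coset b = coset (a + b)"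
    using ring_hom_add[OF hom, of a b] by (simp add: OC_mod_p_def)
qed

lemma OC_mod_p_power: "nrm a \<le> 1 \<Longrightarrow> coset a [^]\<^bsub>OC_mod_p\<^esub> (n::nat) = coset (a ^ n)"
proof (induction n)
  case (Suc n)
  have "nrm (a ^ n) \<le> 1" using Suc by (simp add: nrm_nonneg power_le_one)
  then show ?case
    using Suc by (simp add: nat_pow_def OC_mod_p_simps mult.commute)
qed (simp add: nat_pow_def OC_mod_p_simps)

text \<open>
  Componentwise representatives of an element of the inverse limit defining the tilt, see \<open>tilt_ring_carrier\<close>.
\<close>

definition compatible_seq :: "(nat \<Rightarrow> 'c) \<Rightarrow> bool"
  where "compatible_seq a \<longleftrightarrow> (\<forall>n. nrm (a n) \<le> 1 \<and> nrm (a (Suc n) ^ p - a n) \<le> 1 / p)"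

lemma compatD: "compatible_seq a \<Longrightarrow> nrm (a n) \<le> 1" "compatible_seq a \<Longrightarrow> nrm (a (Suc n) ^ p - a n) \<le> 1 / p"
  by (auto simp: compatible_seq_def)

lemma tilt_ring_carrier: "carrier tilt_ring = {\<lambda>n. coset (a n) | a. compatible_seq a}"
proof (intro Set.set_eqI iffI)
  fix x :: "nat \<Rightarrow> 'c set" assume x: "x \<in> carrier tilt_ring"
  then have "\<forall>n. \<exists>a. nrm a \<le> 1 \<and> x n = coset a"
    by (fastforce simp: tilt_ring_def OC_mod_p_simps)
  then obtain a where a: "\<And>n. nrm (a n) \<le> 1" "\<And>n. x n = coset (a n)" by metis
  have "coset (a (Suc n) ^ p) = coset (a n)" for n
    using x a by (auto simp: tilt_ring_def OC_mod_p_power)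
  then have "compatible_seq a" using a by (auto simp: compatible_seq_def coset_eq_iff)
  then show "x \<in> {\<lambda>n. coset (a n) | a. compatible_seq a}" using a by blast
next
  fix x :: "nat \<Rightarrow> 'c set" assume "x \<in> {\<lambda>n. coset (a n) | a. compatible_seq a}"
  then obtain a where a: "compatible_seq a" "x = (\<lambda>n. coset (a n))" by blast
  then show "x \<in> carrier tilt_ring"
    by (auto simp: tilt_ring_def OC_mod_p_simps OC_mod_p_power compatD coset_eq_iff)
qed

lemma compat_mult:
  assumes "compatible_seq a" "compatible_seq b" shows "compatible_seq (\<lambda>n. a n * b n)"
  unfolding compatible_seq_def
proof (intro allI conjI)
  fix n
  have le: "nrm (a n) \<le> 1" "nrm (b n) \<le> 1" "nrm (b (Suc n) ^ p) \<le> 1" for n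
    using compatD[OF assms(1)] compatD[OF assms(2)] nrm_nonneg by (auto simp: power_le_one)
  show "nrm (a n * b n) \<le> 1"
    using le by (simp add: nrm_mult nrm_nonneg mult_le_one)
  have "(a (Suc n) * b (Suc n)) ^ p - a n * b n =
      (a (Suc n) ^ p - a n) * b (Suc n) ^ p + a n * (b (Suc n) ^ p - b n)"
    by (simp add: algebra_simps)
  moreover have "nrm ((a (Suc n) ^ p - a n) * b (Suc n) ^ p) \<le> 1 / p * 1"
    unfolding nrm_mult using compatD(2)[OF assms(1)] le nrm_nonneg by (intro mult_mono) auto
  moreover have "nrm (a n * (b (Suc n) ^ p - b n)) \<le> 1 * (1 / p)"
    unfolding nrm_mult using compatD(2)[OF assms(2)] le nrm_nonneg by (intro mult_mono) auto
  ultimately show "nrm ((a (Suc n) * b (Suc n)) ^ p - a n * b n) \<le> 1 / p"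
    by (simp add: nrm_add_le)
qed

lemma compat_add:
  assumes "compatible_seq a" "compatible_seq b" shows "compatible_seq (\<lambda>n. a n + b n)"
  unfolding compatible_seq_def
proof (intro allI conjI)
  fix n
  note le = compatD(1)[OF assms(1)] compatD(1)[OF assms(2)]
  show "nrm (a n + b n) \<le> 1" using le by (simp add: nrm_add_le)
  have "nrm ((a (Suc n) + b (Suc n)) ^ p - (a (Suc n) ^ p + b (Suc n) ^ p)) \<le> 1 / p"
    by (rule nrm_power_p_add) (rule le)+
  moreover have "nrm ((a (Suc n) ^ p + b (Suc n) ^ p) - (a n + b n)) \<le> 1 / p"
    using nrm_add_le[OF compatD(2)[OF assms(1), of n] compatD(2)[OF assms(2), of n]]
    by (simp add: algebra_simps)
  ultimately show "nrm ((a (Suc n) + b (Suc n)) ^ p - (a n + b n)) \<le> 1 / p"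
    by (rule nrm_trans)
qed

lemma compat_minus: "compatible_seq a \<Longrightarrow> compatible_seq (\<lambda>n. - a n)"
  unfolding compatible_seq_def
proof (intro allI conjI)
  fix n assume a: "\<forall>n. nrm (a n) \<le> 1 \<and> nrm (a (Suc n) ^ p - a n) \<le> 1 / p"
  show "nrm (- a n) \<le> 1" using a by simp
  have "nrm (0 - (a (Suc n) ^ p + (- a (Suc n)) ^ p)) \<le> 1 / p"
    using nrm_power_p_add[of "a (Suc n)" "- a (Suc n)"] a p_ge_2 by (simp add: power_0_left)
  then have "nrm (a (Suc n) ^ p + (- a (Suc n)) ^ p) \<le> 1 / p"
    by (metis diff_0 nrm_minus)
  from nrm_diff_le[OF this, of "a (Suc n) ^ p - a n"]
  show "nrm ((- a (Suc n)) ^ p - - a n) \<le> 1 / p" using a by simp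
qed

lemma compat_diff: "compatible_seq a \<Longrightarrow> compatible_seq b \<Longrightarrow> compatible_seq (\<lambda>n. a n - b n)"
  using compat_add[OF _ compat_minus, of a b] by simp

lemma compat_iterate:
  assumes "compatible_seq a"
  shows "nrm (a (n + k) ^ (p ^ k) - a n) \<le> 1 / p"
proof (induction k)
  case (Suc k)
  have le: "nrm (a (Suc (n + k)) ^ p) \<le> 1" "nrm (a (n + k)) \<le> 1"
    using compatD(1)[OF assms] nrm_nonneg by (auto simp: power_le_one)
  have step: "nrm (x ^ (p ^ j) - y ^ (p ^ j)) \<le> 1 / p"
    if "nrm (x - y) \<le> 1 / p" "nrm x \<le> 1" "nrm y \<le> 1" for x y j
  proof (induction j)
    case (Suc j)
    have "nrm (x ^ p ^ j) \<le> 1" "nrm (y ^ p ^ j) \<le> 1"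
      using that nrm_nonneg by (auto simp: power_le_one)
    from nrm_power_p_diff[OF this]
    have "nrm ((x ^ p ^ j) ^ p - (y ^ p ^ j) ^ p) \<le>
        max (nrm (x ^ p ^ j - y ^ p ^ j) / p) (nrm (x ^ p ^ j - y ^ p ^ j) ^ p)" .
    also have "\<dots> \<le> 1 / p"
    proof -
      let ?h = "nrm (x ^ p ^ j - y ^ p ^ j)"
      have h: "?h \<le> 1 / p" "0 \<le> ?h" "?h \<le> 1"
        using Suc nrm_nonneg order.trans[OF Suc less_imp_le[OF inv_p_less_1]] by auto
      have "?h ^ p \<le> ?h ^ 1" using h by (intro power_decreasing) (use p_ge_2 in auto)
      moreover have "?h / p \<le> 1 / p" using h by (intro divide_right_mono) auto
      ultimately show ?thesis using h by simp
    qed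
    finally show ?case by (simp add: power_mult[symmetric] mult.commute)
  qed (use that in simp)
  have "nrm ((a (Suc (n + k)) ^ p) ^ (p ^ k) - a (n + k) ^ (p ^ k)) \<le> 1 / p"
    by (rule step[OF compatD(2)[OF assms] le])
  from nrm_trans[OF this Suc] show ?case by (simp add: power_mult)
qed simp

lemma compat_shift: "compatible_seq a \<Longrightarrow> compatible_seq (\<lambda>n. a (n + k))"
  by (auto simp: compatible_seq_def)

lemma compat_const: "compatible_seq (\<lambda>_. 0)" "compatible_seq (\<lambda>_. 1)"
  using p_ge_2 by (auto simp: compatible_seq_def power_0_left)

lemma compat_power: "compatible_seq a \<Longrightarrow> compatible_seq (\<lambda>n. a n ^ k)"
proof (induction k)
  case 0
  show ?case using compat_const(2) by simp
next
  case (Suc k)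
  show ?case using compat_mult[OF Suc(2) Suc(1)[OF Suc(2)]] by simp
qed

end

section \<open>Elements of the tilt as compatible sequences\<close>

context tilted_field
begin

definition tilt :: "(nat \<Rightarrow> 'c) \<Rightarrow> 'd"
  where "tilt a = \<iota> (\<lambda>n. coset (a n))"

lemma tilt_carrier: "compatible_seq a \<Longrightarrow> (\<lambda>n. coset (a n)) \<in> carrier tilt_ring"
  unfolding tilt_ring_carrier mem_Collect_eq by (rule exI[of _ a]) simp

lemma tilt_eq_iff:
  assumes "compatible_seq a" "compatible_seq b"
  shows "tilt a = tilt b \<longleftrightarrow> (\<forall>n. nrm (a n - b n) \<le> 1 / p)"
  using inj_on_eq_iff[OF \<iota>_inj tilt_carrier[OF assms(1)] tilt_carrier[OF assms(2)]]
  by (simp add: tilt_def fun_eq_iff coset_eq_iff)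

lemma tilt_mult:
  assumes "compatible_seq a" "compatible_seq b" shows "tilt (\<lambda>n. a n * b n) = tilt a * tilt b"
proof -
  have "(\<lambda>n. coset (a n)) \<otimes>\<^bsub>tilt_ring\<^esub> (\<lambda>n. coset (b n)) = (\<lambda>n. coset (a n * b n))"
    using assms by (simp add: tilt_ring_def OC_mod_p_simps compatD)
  then show ?thesis
    using ring_hom_mult[OF \<iota>_hom tilt_carrier[OF assms(1)] tilt_carrier[OF assms(2)]]
    by (simp add: tilt_def ring_of_type_algebra_def)
qed

lemma tilt_add:
  assumes "compatible_seq a" "compatible_seq b" shows "tilt (\<lambda>n. a n + b n) = tilt a + tilt b"
proof -
  have "(\<lambda>n. coset (a n)) \<oplus>\<^bsub>tilt_ring\<^esub> (\<lambda>n. coset (b n)) = (\<lambda>n. coset (a n + b n))"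
    using assms by (simp add: tilt_ring_def OC_mod_p_simps compatD)
  then show ?thesis
    using ring_hom_add[OF \<iota>_hom tilt_carrier[OF assms(1)] tilt_carrier[OF assms(2)]]
    by (simp add: tilt_def ring_of_type_algebra_def)
qed

lemma tilt_1: "tilt (\<lambda>_. 1) = 1"
proof -
  have "\<one>\<^bsub>tilt_ring\<^esub> = (\<lambda>n. coset 1)"
    by (simp add: tilt_ring_def OC_mod_p_simps)
  then show ?thesis
    using ring_hom_one[OF \<iota>_hom] by (simp add: tilt_def ring_of_type_algebra_def)
qed

lemma tilt_0: "tilt (\<lambda>_. 0) = 0"
  using tilt_add[OF compat_const(1) compat_const(1)] by (metis add_0 add_cancel_left_left)

lemma tilt_eq_0_iff: "compatible_seq a \<Longrightarrow> tilt a = 0 \<longleftrightarrow> (\<forall>n. nrm (a n) \<le> 1 / p)"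
  using tilt_eq_iff[OF _ compat_const(1)] by (simp add: tilt_0)

lemma tilt_power: "compatible_seq a \<Longrightarrow> tilt (\<lambda>n. a n ^ k) = tilt a ^ k"
proof (induction k)
  case (Suc k)
  show ?case using tilt_mult[OF Suc(2) compat_power[OF Suc(2), of k]] Suc by simp
qed (simp add: tilt_1)

lemma tilt_sum:
  "(\<And>i. i \<in> I \<Longrightarrow> compatible_seq (f i)) \<Longrightarrow> compatible_seq (\<lambda>n. \<Sum>i\<in>I. f i n) \<and> tilt (\<lambda>n. \<Sum>i\<in>I. f i n) = (\<Sum>i\<in>I. tilt (f i))"
  by (induction I rule: infinite_finite_induct) (auto simp: compat_add tilt_add compat_const tilt_0)

lemma CHAR_tilt: "of_nat p = (0::'d)"
proof -
  have "of_nat n = tilt (\<lambda>_. of_nat n) \<and> compatible_seq (\<lambda>_. of_nat n)" for n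
  proof (induction n)
    case (Suc n)
    then show ?case
      using tilt_add[OF compat_const(2), of "\<lambda>_. of_nat n"] compat_add[OF compat_const(2), of "\<lambda>_. of_nat n"]
      by (simp add: tilt_1)
  qed (auto simp: tilt_0 compat_const)
  note this[of p]
  moreover have "nrm (of_nat p) \<le> 1 / p" by (simp add: nrm_p)
  ultimately show ?thesis by (auto simp: tilt_eq_0_iff)
qed

lemma of_int_prime_to_p: "\<not> int p dvd n \<Longrightarrow> of_int n \<noteq> (0::'d)"
proof
  assume n: "\<not> int p dvd n" "of_int n = (0::'d)"
  then have "coprime (int p) n" using prime_p by (simp add: prime_imp_coprime)
  then obtain a b where "a * int p + b * n = 1" using bezout_int[of "int p" n] by auto
  then have "of_int (a * int p + b * n) = (1::'d)" by simp
  then show False using n CHAR_tilt by simp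
qed

lemma frobenius_add: "(x + y) ^ p = x ^ p + (y :: 'd) ^ p"
proof -
  have "(x + y) ^ p = (\<Sum>k\<le>p. of_nat (p choose k) * x ^ k * y ^ (p - k))"
    by (rule binomial_ring)
  also have "\<dots> = (\<Sum>k\<in>{0, p}. of_nat (p choose k) * x ^ k * y ^ (p - k))"
  proof (rule sum.mono_neutral_right)
    show "\<forall>k\<in>{..p} - {0, p}. of_nat (p choose k) * x ^ k * y ^ (p - k) = 0"
    proof
      fix k assume "k \<in> {..p} - {0, p}"
      then have "p dvd (p choose k)" using prime_p by (intro dvd_choose_prime) auto
      then show "of_nat (p choose k) * x ^ k * y ^ (p - k) = 0"
        using CHAR_tilt by auto
    qed
  qed auto
  finally show ?thesis using p_ge_2 by simp
qed

lemma frobenius_sum: "(\<Sum>i\<in>I. f i) ^ p = (\<Sum>i\<in>I. f i ^ p :: 'd)"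
  by (rule additive_imp_sum[of "\<lambda>x. x ^ p", OF frobenius_add])

lemma frobenius_diff: "(x - y) ^ p = x ^ p - (y :: 'd) ^ p"
  by (rule additive_imp_diff[of "\<lambda>x. x ^ p", OF frobenius_add])

lemma frobenius_of_int: "(of_int n :: 'd) ^ p = of_int n"
proof -
  have "(of_nat k :: 'd) ^ p = of_nat k" for k
    by (induction k) (auto simp: frobenius_add)
  then show ?thesis
    by (cases n rule: int_cases2) (use frobenius_diff[of 0] in auto)
qed

text \<open>Shifting a compatible sequence takes \<open>p\<close>-th roots in the tilt.\<close>

lemma tilt_shift: "compatible_seq a \<Longrightarrow> tilt (\<lambda>n. a (n + k)) ^ (p ^ k) = tilt a"
proof (induction k)
  case (Suc k)
  have "tilt (\<lambda>n. a (n + Suc k)) ^ p = tilt (\<lambda>n. a (n + Suc k) ^ p)"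
    by (rule tilt_power[OF compat_shift[OF Suc(2)], symmetric])
  also have "\<dots> = tilt (\<lambda>n. a (n + k))"
    using compatD(2)[OF Suc(2)] compat_power[OF compat_shift[OF Suc(2), of "Suc k"], of p] compat_shift[OF Suc(2), of k]
    by (subst tilt_eq_iff) auto
  finally have "tilt (\<lambda>n. a (n + Suc k)) ^ (p * p ^ k) = tilt (\<lambda>n. a (n + k)) ^ (p ^ k)"
    by (simp add: power_mult)
  then show ?case using Suc by simp
qed simp

lemma integral_iff_tilt: "z = 0 \<or> vb z \<ge> 0 \<longleftrightarrow> (\<exists>a. compatible_seq a \<and> z = tilt a)"
  using vb_ring unfolding tilt_ring_carrier tilt_def image_def by auto

end

section \<open>The valuation of the tilt\<close>

context tilted_field
begin

lemma vb_1 [simp]: "vb 1 = 0"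
  using vb_mult[of 1 1] by simp

lemma vb_minus [simp]: "vb (- x) = vb x"
proof (cases "x = 0")
  case False
  have "vb (- 1) + vb (- 1) = 0" using vb_mult[of "- 1" "- 1"] by simp
  then show ?thesis using vb_mult[of "- 1" x] False by simp
qed simp

lemma vb_power: "x \<noteq> 0 \<Longrightarrow> vb (x ^ n) = n * vb x"
  by (induction n) (auto simp: vb_mult algebra_simps)

lemma vb_divide: "x \<noteq> 0 \<Longrightarrow> y \<noteq> 0 \<Longrightarrow> vb (x / y) = vb x - vb y"
  using vb_mult[of "x / y" y] by simp

lemma u_pow_O_0 [simp]: "0 \<in> u_pow_O r"
  by (simp add: u_pow_O_def)

lemma u_pow_O_add:
  assumes "x \<in> u_pow_O r" "y \<in> u_pow_O r"
  shows "x + y \<in> u_pow_O r"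
proof (cases "x = 0 \<or> y = 0 \<or> x + y = 0")
  case False
  then have "vb (x + y) \<ge> min (vb x) (vb y)" using vb_add[of x y] by blast
  moreover have "vb x \<ge> r" "vb y \<ge> r" using False assms by (auto simp: u_pow_O_def)
  ultimately have "vb (x + y) \<ge> r" by linarith
  then show ?thesis by (simp add: u_pow_O_def)
qed (use assms in auto)

lemma u_pow_O_minus: "x \<in> u_pow_O r \<Longrightarrow> - x \<in> u_pow_O r"
  by (auto simp: u_pow_O_def)

lemma u_pow_O_diff: "x \<in> u_pow_O r \<Longrightarrow> y \<in> u_pow_O r \<Longrightarrow> x - y \<in> u_pow_O r"
  using u_pow_O_add[OF _ u_pow_O_minus, of x r y] by simp

lemma u_pow_O_sum: "(\<And>i. i \<in> I \<Longrightarrow> f i \<in> u_pow_O r) \<Longrightarrow> (\<Sum>i\<in>I. f i) \<in> u_pow_O r"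
  by (induction I rule: infinite_finite_induct) (auto intro: u_pow_O_add)

lemma u_pow_O_mult: "x \<in> u_pow_O r \<Longrightarrow> y \<in> u_pow_O s \<Longrightarrow> x * y \<in> u_pow_O (r + s)"
  by (cases "x = 0"; cases "y = 0") (auto simp: u_pow_O_def vb_mult)

lemma u_pow_O_mono: "x \<in> u_pow_O r \<Longrightarrow> s \<le> r \<Longrightarrow> x \<in> u_pow_O s"
  by (auto simp: u_pow_O_def)

lemma u_pow_O_mult_left: "x \<in> u_pow_O 0 \<Longrightarrow> y \<in> u_pow_O s \<Longrightarrow> x * y \<in> u_pow_O s"
  using u_pow_O_mult[of x 0 y s] by simp

lemma u_pow_O_power: "x \<in> u_pow_O r \<Longrightarrow> x ^ n \<in> u_pow_O (n * r)"
  by (cases "x = 0"; cases "n = 0") (auto simp: u_pow_O_def vb_power mult_left_mono power_0_left)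

lemma is_subring_O: "is_subring (u_pow_O 0)"
  unfolding is_subring_def
  by (auto intro: u_pow_O_add u_pow_O_mult_left u_pow_O_minus) (simp add: u_pow_O_def)

lemma O_iff_tilt: "z \<in> u_pow_O 0 \<longleftrightarrow> (\<exists>a. compatible_seq a \<and> z = tilt a)"
  unfolding integral_iff_tilt[symmetric] by (simp add: u_pow_O_def)

text \<open>A sum of nonzero elements of pairwise distinct valuations does not vanish.\<close>

lemma sum_distinct_vb_eq_0:
  assumes "finite I" "(\<Sum>i\<in>I. f i) = 0"
    and distinct: "\<And>i j. i \<in> I \<Longrightarrow> j \<in> I \<Longrightarrow> f i \<noteq> 0 \<Longrightarrow> f j \<noteq> 0 \<Longrightarrow> vb (f i) = vb (f j) \<Longrightarrow> i = j"
  shows "\<forall>i\<in>I. f i = 0"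
proof (rule ccontr)
  assume "\<not> (\<forall>i\<in>I. f i = 0)"
  then have J: "{i\<in>I. f i \<noteq> 0} \<noteq> {}" (is "?J \<noteq> {}") by blast
  have fin: "finite ?J" using assms(1) by simp
  define i0 where "i0 = arg_min_on (\<lambda>i. vb (f i)) ?J"
  have i0: "i0 \<in> ?J" "\<And>i. i \<in> ?J \<Longrightarrow> vb (f i0) \<le> vb (f i)"
    unfolding i0_def by (rule arg_min_if_finite(1)[OF fin J]) (rule arg_min_least[OF fin J])
  have sum0: "(\<Sum>i\<in>?J. f i) = 0"
  proof -
    have "(\<Sum>i\<in>I. f i) = (\<Sum>i\<in>?J. f i)"
      by (rule sum.mono_neutral_right[OF assms(1)]) auto
    then show ?thesis using assms(2) by simp
  qed
  have *: "x = 0 \<or> vb x > r" if "finite K" "\<And>i. i \<in> K \<Longrightarrow> f i \<noteq> 0 \<Longrightarrow> vb (f i) > r" "x = (\<Sum>i\<in>K. f i)" for K x r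
    using that
  proof (induction K arbitrary: x)
    case (insert k K)
    have x: "x = f k + (\<Sum>i\<in>K. f i)" using insert(1,2,5) by simp
    have IH: "(\<Sum>i\<in>K. f i) = 0 \<or> vb (\<Sum>i\<in>K. f i) > r"
      by (rule insert(3)[OF _ refl]) (rule insert(4), simp_all)
    have k: "f k = 0 \<or> vb (f k) > r" using insert(4) by auto
    show ?case
    proof (cases "f k = 0 \<or> (\<Sum>i\<in>K. f i) = 0 \<or> x = 0")
      case True
      then show ?thesis using IH k x by auto
    next
      case False
      then have "min (vb (f k)) (vb (\<Sum>i\<in>K. f i)) \<le> vb x"
        using vb_add[of "f k" "\<Sum>i\<in>K. f i"] x by blast
      moreover have "vb (f k) > r" "vb (\<Sum>i\<in>K. f i) > r" using IH k False by auto
      ultimately show ?thesis by linarith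
    qed
  qed simp
  have "(\<Sum>i\<in>?J. f i) = f i0 + (\<Sum>i\<in>?J - {i0}. f i)"
    by (rule sum.remove[OF fin i0(1)])
  then have eq: "f i0 = - (\<Sum>i\<in>?J - {i0}. f i)"
    unfolding sum0 by (metis eq_neg_iff_add_eq_0)
  have vb: "vb (f i0) = vb (\<Sum>i\<in>?J - {i0}. f i)"
    unfolding eq by (rule vb_minus)
  have "(\<Sum>i\<in>?J - {i0}. f i) = 0 \<or> vb (\<Sum>i\<in>?J - {i0}. f i) > vb (f i0)"
  proof (rule *[OF _ _ refl])
    fix i assume i: "i \<in> ?J - {i0}"
    then have "vb (f i) \<noteq> vb (f i0)"
      using i0(1) distinct[of i i0] by blast
    moreover have "vb (f i0) \<le> vb (f i)" using i i0(2) by blast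
    ultimately show "vb (f i) > vb (f i0)" by simp
  qed (use fin in simp)
  then have "f i0 = 0"
    using eq vb by (metis less_irrefl neg_0_equal_iff_equal)
  then show False using i0(1) by simp
qed

subsection \<open>Comparison with the absolute value\<close>

lemma nrm_pw_0: "nrm (pw 0) = 1 / p"
proof (rule antisym)
  show "nrm (pw 0) \<le> 1 / p"
    using uniformiser by (intro nrm_K_less_1)
  have "of_nat p \<in> K"
    by (rule is_subring_of_nat[OF subfield_is_subring[OF K_subfield]])
  then show "1 / p \<le> nrm (pw 0)"
    using uniformiser(4) inv_p_less_1 by (auto simp: nrm_p[symmetric])
qed

lemma pw_iterate: "pw (n + k) ^ (p ^ k) = pw n"
proof (induction k)
  case (Suc k)
  have "pw (n + Suc k) ^ (p ^ Suc k) = (pw (Suc (n + k)) ^ p) ^ (p ^ k)"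
    by (simp add: power_mult)
  then show ?case using Suc roots by simp
qed simp

lemma nrm_pw: "nrm (pw n) ^ (p ^ n) = 1 / p"
  using arg_cong[OF pw_iterate[of 0 n], of nrm] by (simp add: nrm_pw_0)

lemma nrm_pw_less_1: "nrm (pw n) < 1"
proof (rule ccontr)
  assume "\<not> nrm (pw n) < 1"
  then have "1 \<le> nrm (pw n) ^ (p ^ n)" by (intro one_le_power) auto
  then show False using nrm_pw inv_p_less_1 by simp
qed

lemma nrm_pw_ge: "1 / p \<le> nrm (pw n)"
proof -
  have "nrm (pw n) ^ (p ^ n) \<le> nrm (pw n) ^ 1"
    using nrm_pw_less_1[of n] nrm_nonneg by (intro power_decreasing) (auto simp: Suc_le_eq)
  then show ?thesis by (simp add: nrm_pw)
qed

lemma pw_nonzero: "pw n \<noteq> 0"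
  using nrm_pw_ge[of n] nrm_eq_0[of "pw n"] by (auto simp: divide_simps)

lemma compatible_pw: "compatible_seq pw"
  using nrm_pw_less_1 roots(2) by (auto simp: compatible_seq_def less_imp_le)

lemma u_eq_tilt: "u = tilt pw"
  by (simp add: u_def tilt_def)

lemma u_nonzero: "u \<noteq> 0"
proof
  assume "u = 0"
  then have "nrm (pw 1) \<le> 1 / p"
    using tilt_eq_0_iff[OF compatible_pw] by (simp add: u_eq_tilt)
  then have "nrm (pw 1) ^ p \<le> (1 / p) ^ p" using nrm_nonneg by (intro power_mono) auto
  also have "\<dots> < (1 / p) ^ 1" using p_ge_2 by (intro power_strict_decreasing) auto
  finally show False using nrm_pw[of 1] by simp
qed

lemma vb_u [simp]: "vb u = 1"
  using vb_norm by (simp add: u_def)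

lemma vb_u_power [simp]: "vb (u ^ n) = n"
  by (simp add: vb_power u_nonzero)

lemma u_in_O: "u ^ n \<in> u_pow_O n"
  by (simp add: u_pow_O_def)

lemma u_pow_O_u: "u ^ n * z \<in> u_pow_O (real n + r) \<longleftrightarrow> z \<in> u_pow_O r"
  using u_nonzero by (cases "z = 0") (auto simp: u_pow_O_def vb_mult)

lemma u_pow_O_nat_iff: "z \<in> u_pow_O (real n) \<longleftrightarrow> (\<exists>y\<in>u_pow_O 0. z = u ^ n * y)"
proof
  assume "z \<in> u_pow_O (real n)"
  moreover have z: "z = u ^ n * (z / u ^ n)" using u_nonzero by simp
  ultimately have "z / u ^ n \<in> u_pow_O 0"
    using u_pow_O_u[of n "z / u ^ n" 0] by (simp del: times_divide_eq_right)
  then show "\<exists>y\<in>u_pow_O 0. z = u ^ n * y" using z by blast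
qed (use u_pow_O_u[of n _ 0] in auto)

text \<open>
  If the zeroth component \<open>a 0\<close> is divisible by \<open>p\<close>, the quotients \<open>b n = a n / pw n\<close> are integral
  and compatible up to a loss of precision \<open>pw n\<close>, and replacing them by the sequence of the
  \<open>b (n + 1) ^ p\<close> makes up for this loss.
\<close>

lemma tilt_in_u_O_iff:
  assumes a: "compatible_seq a"
  shows "tilt a \<in> u_pow_O 1 \<longleftrightarrow> nrm (a 0) \<le> 1 / p"
proof
  assume "tilt a \<in> u_pow_O 1"
  then obtain y where y: "y \<in> u_pow_O 0" "tilt a = u * y"
    using u_pow_O_nat_iff[of _ 1] by auto
  then obtain b where b: "compatible_seq b" "y = tilt b" using O_iff_tilt by blast
  have "tilt a = tilt (\<lambda>n. pw n * b n)"
    using y b compatible_pw by (simp add: u_eq_tilt tilt_mult)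
  then have "nrm (a 0 - pw 0 * b 0) \<le> 1 / p"
    using tilt_eq_iff[OF a compat_mult[OF compatible_pw b(1)]] by simp
  moreover have "nrm (pw 0 * b 0) \<le> 1 / p"
    using compatD(1)[OF b(1), of 0] by (simp add: nrm_mult nrm_pw_0 divide_right_mono)
  ultimately show "nrm (a 0) \<le> 1 / p"
    using nrm_add_le[of "a 0 - pw 0 * b 0" "1 / p" "pw 0 * b 0"] by simp
next
  assume a0: "nrm (a 0) \<le> 1 / p"
  define b where "b n = a n / pw n" for n
  have "nrm (a n) \<le> nrm (pw n)" for n
  proof -
    have "nrm (a n ^ (p ^ n)) \<le> 1 / p"
      using nrm_add_le[OF compat_iterate[OF a, of 0 n] a0] by simp
    then have "nrm (a n) ^ (p ^ n) \<le> nrm (pw n) ^ (p ^ n)" by (simp add: nrm_pw)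
    then show ?thesis using nrm_nonneg by (metis p_pos(1) power_mono_iff zero_less_power)
  qed
  then have b_le: "nrm (b n) \<le> 1" for n
    using nrm_pos[OF pw_nonzero] by (simp add: b_def nrm_divide)
  define \<delta> where "\<delta> n = (1 / p) / nrm (pw n)" for n
  have b_step: "nrm (b (Suc n) ^ p - b n) \<le> \<delta> n" for n
  proof -
    have "b (Suc n) ^ p - b n = (a (Suc n) ^ p - a n) / pw n"
      by (simp add: b_def power_divide roots diff_divide_distrib)
    then show ?thesis
      using divide_right_mono[OF compatD(2)[OF a, of n] nrm_nonneg[of "pw n"]] by (simp add: nrm_divide \<delta>_def)
  qed
  have \<delta>_le: "\<delta> n \<le> 1" "0 \<le> \<delta> n" "\<delta> (Suc n) ^ p \<le> 1 / p" for n
  proof -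
    show "\<delta> n \<le> 1" "0 \<le> \<delta> n"
      using nrm_pw_ge[of n] nrm_pos[OF pw_nonzero, of n] by (auto simp: \<delta>_def field_simps)
    have "\<delta> (Suc n) ^ p = (1 / p) ^ p / nrm (pw n)"
      using arg_cong[OF roots(2)[of n], of nrm] by (simp add: \<delta>_def power_divide power_mult_distrib)
    also have "\<dots> \<le> (1 / p) ^ p / (1 / p)"
      using nrm_pw_ge[of n] by (intro divide_left_mono mult_pos_pos nrm_pos pw_nonzero) auto
    also have "\<dots> = (1 / p) ^ (p - 1)"
      using p_ge_2 by (simp add: power_diff)
    also have "\<dots> \<le> (1 / p) ^ 1"
      using p_ge_2 by (intro power_decreasing) auto
    finally show "\<delta> (Suc n) ^ p \<le> 1 / p" by simp
  qed
  define y where "y n = b (Suc n) ^ p" for n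
  have y_le: "nrm (y n) \<le> 1" for n using b_le nrm_nonneg by (simp add: y_def power_le_one)
  have y: "compatible_seq y"
    unfolding compatible_seq_def
  proof (intro allI conjI)
    fix n
    show "nrm (y n) \<le> 1" by (rule y_le)
    let ?h = "nrm (y (Suc n) - b (Suc n))"
    have h: "?h \<le> \<delta> (Suc n)" "0 \<le> ?h" using b_step[of "Suc n"] nrm_nonneg by (auto simp: y_def)
    have "nrm (y (Suc n) ^ p - b (Suc n) ^ p) \<le> max (?h / p) (?h ^ p)"
      by (rule nrm_power_p_diff) (rule y_le b_le)+
    also have "\<dots> \<le> 1 / p"
    proof -
      have "?h ^ p \<le> 1 / p"
        using order.trans[OF power_mono[OF h(1) h(2), of p] \<delta>_le(3)[of n]] .
      moreover have "?h / p \<le> 1 / p"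
        using \<delta>_le(1)[of "Suc n"] h by (intro divide_right_mono) auto
      ultimately show ?thesis by simp
    qed
    finally show "nrm (y (Suc n) ^ p - y n) \<le> 1 / p" by (simp add: y_def)
  qed
  have "tilt a = tilt (\<lambda>n. pw n * y n)"
  proof (subst tilt_eq_iff[OF a compat_mult[OF compatible_pw y]], rule allI)
    fix n
    have "a n - pw n * y n = - (pw n * (b (Suc n) ^ p - b n))"
      using pw_nonzero by (simp add: y_def b_def algebra_simps)
    moreover have "nrm (pw n * (b (Suc n) ^ p - b n)) \<le> nrm (pw n) * \<delta> n"
      using b_step nrm_nonneg by (auto simp: nrm_mult intro: mult_left_mono)
    moreover have "nrm (pw n) * \<delta> n = 1 / p"
      using nrm_pos[OF pw_nonzero, of n] by (simp add: \<delta>_def)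
    ultimately show "nrm (a n - pw n * y n) \<le> 1 / p" by (metis nrm_minus)
  qed
  then have "tilt a = u * tilt y"
    using tilt_mult[OF compatible_pw y] by (simp add: u_eq_tilt)
  moreover have "tilt y \<in> u_pow_O 0" using O_iff_tilt y by blast
  ultimately show "tilt a \<in> u_pow_O 1"
    using u_pow_O_mult[OF u_in_O[of 1], of "tilt y" 0] by simp
qed

text \<open>
  Taking \<open>p ^ n\<close>-th roots in the tilt moves the component with index \<open>n\<close> to index \<open>0\<close>.
\<close>

lemma tilt_in_u_pow_O_iff:
  assumes a: "compatible_seq a"
  shows "tilt a \<in> u_pow_O (p ^ n) \<longleftrightarrow> nrm (a n) \<le> 1 / p"
proof -
  let ?b = "\<lambda>m. a (m + n)"
  have eq: "tilt ?b ^ (p ^ n) = tilt a" by (rule tilt_shift[OF a])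
  have "tilt a \<in> u_pow_O (p ^ n) \<longleftrightarrow> tilt ?b \<in> u_pow_O 1"
    unfolding eq[symmetric] by (cases "tilt ?b = 0") (auto simp: u_pow_O_def vb_power power_0_left)
  then show ?thesis using tilt_in_u_O_iff[OF compat_shift[OF a, of n]] by simp
qed

subsection \<open>The valuation of \<open>\<epsilon> - 1\<close>\<close>

text \<open>
  The component \<open>s n\<close> is a primitive \<open>p ^ n\<close>-th root of unity, so \<open>(nrm (s n - 1)) ^ (p ^ (n - 1) * (p - 1)) = 1 / p\<close> for
  \<open>n > 0\<close>. Hence the power of \<open>tilt s - 1\<close> with exponent \<open>m = p ^ (n - 1) * (p - 1)\<close> is divisible by \<open>u ^ (p ^ n)\<close>, and the one with
  exponent \<open>m - 1\<close> is not. As \<open>n\<close> grows, this squeezes the valuation to \<open>p ^ n / m = p / (p - 1)\<close>.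
\<close>

lemma vb_epsilon_minus_1:
  assumes s0: "s 0 = 1" and s1: "s 1 \<noteq> 1" and s: "\<And>n. s (Suc n) ^ p = s n"
  shows "compatible_seq s" "tilt s \<noteq> 1" "vb (tilt s - 1) = real p / (real p - 1)"
proof -
  have nrm_s: "nrm (s n) = 1" for n
  proof (induction n)
    case (Suc n)
    have "nrm (s (Suc n)) ^ p = 1" using arg_cong[OF s[of n], of nrm] Suc by simp
    then show ?case
      using power_eq_imp_eq_base[of "nrm (s (Suc n))" p 1] nrm_nonneg by simp
  qed (simp add: s0)
  show cs: "compatible_seq s"
    using s nrm_s by (simp add: compatible_seq_def)
  define e where "e n = s n - 1" for n
  have ce: "compatible_seq e" unfolding e_def by (rule compat_diff[OF cs compat_const(2)])
  have te: "tilt e = tilt s - 1"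
    using tilt_add[OF ce compat_const(2)] by (simp add: e_def tilt_1)
  have sum: "nrm (e n - (e (Suc n) ^ p + of_nat p * e (Suc n))) \<le> nrm (e (Suc n)) ^ 2 / p" for n
    using nrm_power_p_one_plus[OF compatD(1)[OF ce], of "Suc n"] s[of n] by (simp add: e_def algebra_simps)
  have less1: "nrm (e n) < 1" for n
  proof (induction n)
    case (Suc n)
    have "nrm (e (Suc n) ^ p - e n) < 1"
      using compatD(2)[OF ce, of n] inv_p_less_1 by linarith
    then have "nrm (e (Suc n) ^ p) < 1"
      using Suc nrm_add[of "e (Suc n) ^ p - e n" "e n"] by auto
    then show ?case using nrm_nonneg by (simp add: power_less_one_iff)
  qed (simp add: e_def s0)
  have e1: "nrm (e 1) ^ (p - 1) = 1 / p"
  proof -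
    have pos: "nrm (e 1) > 0" using s1 by (intro nrm_pos) (simp add: e_def)
    have "nrm (e 1 ^ p + of_nat p * e 1) \<le> nrm (e 1) ^ 2 / p"
    proof -
      have "e 0 = 0" by (simp add: e_def s0)
      then show ?thesis
        using sum[of 0] nrm_minus[of "e 1 ^ p + of_nat p * e 1"]
        by (simp del: minus_add_distrib nrm_minus add_uminus_conv_diff)
    qed
    also have "\<dots> < nrm (of_nat p * e 1)"
      using less1[of 1] pos by (simp add: nrm_mult nrm_p power2_eq_square divide_strict_right_mono)
    finally have "nrm (- (of_nat p * e 1) - e 1 ^ p) < nrm (- (of_nat p * e 1))"
      by (metis add.commute minus_add_distrib nrm_minus add_uminus_conv_diff)
    then have "nrm (e 1 ^ p) = nrm (of_nat p * e 1)" using nrm_eqI nrm_minus by metis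
    moreover have "nrm (e 1) ^ p = nrm (e 1) ^ (p - 1) * nrm (e 1)"
      using power_minus_mult[of p "nrm (e 1)"] p_pos by simp
    ultimately have "nrm (e 1) ^ (p - 1) * nrm (e 1) = 1 / p * nrm (e 1)"
      by (simp add: nrm_mult nrm_p)
    then show ?thesis using pos by (metis mult_right_cancel less_irrefl)
  qed
  define m where "m n = p ^ n * (p - 1)" for n :: nat
  have m_pos: "m n > 0" for n using p_ge_2 by (simp add: m_def)
  have en: "nrm (e (Suc n)) ^ m n = 1 / p" for n
  proof (induction n)
    case (Suc n)
    let ?a = "e (Suc n)" and ?b = "e (Suc (Suc n))"
    have "nrm ?a ^ m n \<le> nrm ?a ^ 1"
      using less1[of "Suc n"] m_pos[of n] nrm_nonneg by (intro power_decreasing) auto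
    then have a: "1 / p \<le> nrm ?a" using Suc by simp
    have b: "nrm ?b < 1" by (rule less1)
    have "nrm (?a - ?b ^ p) \<le> nrm ?b / p"
    proof -
      have "nrm ?b ^ 2 / p \<le> nrm ?b / p"
        using b nrm_nonneg[of ?b] by (intro divide_right_mono) (auto simp: power2_eq_square mult_left_le)
      then have "nrm (?a - (?b ^ p + of_nat p * ?b)) \<le> nrm ?b / p" using sum[of "Suc n"] by simp
      moreover have "nrm (of_nat p * ?b) \<le> nrm ?b / p" by (simp add: nrm_mult nrm_p)
      ultimately show ?thesis using nrm_add_le[of "?a - (?b ^ p + of_nat p * ?b)" _ "of_nat p * ?b"] by (simp add: algebra_simps)
    qed
    also have "\<dots> < 1 / p" using b by (simp add: divide_strict_right_mono)
    finally have "nrm (?b ^ p) = nrm ?a" using a nrm_eqI[of ?a "?b ^ p"] by simp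
    then show ?case using Suc by (simp add: m_def power_mult)
  qed (simp add: m_def e1[simplified])
  have iff: "tilt e ^ k \<in> u_pow_O (p ^ Suc n) \<longleftrightarrow> nrm (e (Suc n)) ^ k \<le> 1 / p" for k n
    using tilt_in_u_pow_O_iff[OF compat_power[OF ce], of k "Suc n"] tilt_power[OF ce, of k] by simp
  show "tilt s \<noteq> 1"
  proof
    assume "tilt s = 1"
    then have "nrm (e 2) \<le> 1 / p" using te tilt_eq_0_iff[OF ce] by auto
    then have "nrm (e 2) ^ m 1 \<le> (1 / p) ^ m 1" using nrm_nonneg by (intro power_mono) auto
    moreover have "m 1 \<ge> 2"
      using p_ge_2 mult_mono[of 2 p 1 "p - 1"] by (simp add: m_def)
    then have "(1 / real p) ^ m 1 < (1 / p) ^ 1" using p_ge_2 by (intro power_strict_decreasing) auto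
    ultimately show False using en[of 1] by (simp add: numeral_2_eq_2)
  qed
  then have te0: "tilt e \<noteq> 0" using te by simp
  define v where "v = vb (tilt e)"
  define c where "c = real p / (real p - 1)"
  have pn: "real (p ^ Suc n) = m n * c" for n
    using p_ge_2 by (simp add: m_def c_def field_simps)
  have ge: "m n * v \<ge> m n * c" for n
    using iff[of "m n" n] en[of n] te0 by (simp add: u_pow_O_def vb_power v_def flip: pn)
  have "v \<ge> c" using ge[of 0] m_pos[of 0] by simp
  moreover have "v \<le> c"
  proof (rule ccontr)
    assume "\<not> v \<le> c"
    then obtain k :: nat where k: "v < k * (v - c)" using reals_Archimedean3[of "v - c"] by auto
    have "k < 2 ^ k" by (rule less_exp)
    also have "2 ^ k \<le> p ^ k" using p_ge_2 by (intro power_mono) auto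
    also have "p ^ k \<le> m k" using p_ge_2 by (simp add: m_def)
    finally have "real k \<le> m k" by simp
    then have "k * (v - c) \<le> m k * (v - c)" using \<open>\<not> v \<le> c\<close> by (intro mult_right_mono) auto
    with k have "v < m k * (v - c)" by simp
    moreover have "real (m k - 1) = real (m k) - 1" using m_pos[of k] by simp
    ultimately have "real (m k - 1) * v \<ge> real (p ^ Suc k)"
      unfolding pn by (simp add: algebra_simps)
    then have "nrm (e (Suc k)) ^ (m k - 1) \<le> 1 / p"
      using iff[of "m k - 1" k] te0 by (simp add: u_pow_O_def vb_power v_def)
    then have "nrm (e (Suc k)) ^ (m k - 1) * nrm (e (Suc k)) \<le> 1 / p * nrm (e (Suc k))"
      using nrm_nonneg by (rule mult_right_mono)
    moreover have "nrm (e (Suc k)) ^ (m k - 1) * nrm (e (Suc k)) = 1 / p"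
      using en[of k] power_minus_mult[OF m_pos[of k], of "nrm (e (Suc k))"] by simp
    ultimately show False using less1[of "Suc k"] by (simp add: field_simps)
  qed
  ultimately show "vb (tilt s - 1) = real p / (real p - 1)"
    by (simp add: v_def c_def te)
qed

end

section \<open>Automorphisms of the algebraic closure are isometries\<close>

lemma vector_space_mult: "vector_space ((*) :: 'a::field \<Rightarrow> 'a \<Rightarrow> 'a)"
  by unfold_locales (auto simp: algebra_simps)

context unramified_field
begin

lemma nrm_sum_distinct_eq_0:
  assumes "finite I" "(\<Sum>i\<in>I. f i) = 0"
    and distinct: "\<And>i j. i \<in> I \<Longrightarrow> j \<in> I \<Longrightarrow> f i \<noteq> 0 \<Longrightarrow> nrm (f i) = nrm (f j) \<Longrightarrow> i = j"
  shows "\<forall>i\<in>I. f i = 0"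
proof (rule ccontr)
  assume "\<not> (\<forall>i\<in>I. f i = 0)"
  then obtain k where k: "k \<in> I" "f k \<noteq> 0" by blast
  then have ne: "I \<noteq> {}" by blast
  define i0 where "i0 = arg_min_on (\<lambda>i. - nrm (f i)) I"
  have i0: "i0 \<in> I" "\<And>i. i \<in> I \<Longrightarrow> - nrm (f i0) \<le> - nrm (f i)"
    unfolding i0_def by (rule arg_min_if_finite(1)[OF assms(1) ne]) (rule arg_min_least[OF assms(1) ne])
  have pos: "nrm (f i0) > 0"
    using i0(2)[OF k(1)] nrm_pos[OF k(2)] by linarith
  have fi0: "f i0 \<noteq> 0" using pos by auto
  have "nrm (\<Sum>i\<in>I - {i0}. f i) < nrm (f i0)"
  proof (rule nrm_sum_less)
    fix i assume i: "i \<in> I - {i0}"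
    then have "nrm (f i0) \<noteq> nrm (f i)" using distinct[OF i0(1) _ fi0, of i] by blast
    moreover have "nrm (f i) \<le> nrm (f i0)" using i0(2)[of i] i by simp
    ultimately show "nrm (f i) < nrm (f i0)" by simp
  qed (use assms(1) pos in simp_all)
  moreover have "0 = f i0 + (\<Sum>i\<in>I - {i0}. f i)"
    using sum.remove[OF assms(1) i0(1), of f] assms(2) by simp
  then have "nrm (\<Sum>i\<in>I - {i0}. f i) = nrm (f i0)"
    by (metis minus_unique nrm_minus)
  ultimately show False by simp
qed

lemma Kbar_subfield: "subfield Kbar ring_of_type_algebra"
  and K_subset_Kbar: "K \<subseteq> Kbar"
  and Kbar_algebraic: "x \<in> Kbar \<Longrightarrow> \<exists>f\<in>poly_over K. f \<noteq> 0 \<and> poly f x = 0"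
  and Kbar_closed: "f \<in> poly_over Kbar \<Longrightarrow> degree f > 0 \<Longrightarrow> \<exists>x\<in>Kbar. poly f x = 0"
  using Kbar_closure by (auto simp: is_algebraic_closure_def)

lemmas K_subring = subfield_is_subring[OF K_subfield]
lemmas Kbar_subring = subfield_is_subring[OF Kbar_subfield]

abbreviation Qp :: "'c set"
  where "Qp \<equiv> Qp_in nrm"

lemma Rats_Qp: "q \<in> \<rat> \<Longrightarrow> q \<in> Qp"
  by (auto simp: Qp_in_def intro!: bexI[of _ q])

lemma Qp_closed: "(\<And>e. e > 0 \<Longrightarrow> \<exists>y\<in>Qp. nrm (x - y) < e) \<Longrightarrow> x \<in> Qp"
  unfolding Qp_in_def mem_Collect_eq
proof (intro allI impI)
  fix e :: real assume e: "e > 0" and x: "\<And>e. e > 0 \<Longrightarrow> \<exists>y\<in>{x. \<forall>e>0. \<exists>q\<in>\<rat>. nrm (x - q) < e}. nrm (x - y) < e"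
  obtain y where y: "\<forall>e>0. \<exists>q\<in>\<rat>. nrm (y - q) < e" "nrm (x - y) < e" using x[OF e] by auto
  obtain q where q: "q \<in> \<rat>" "nrm (y - q) < e" using y(1) e by blast
  have "nrm (x - q) < e" using nrm_add[of "x - y" "y - q"] y q by simp
  then show "\<exists>q\<in>\<rat>. nrm (x - q) < e" using q by blast
qed

lemma Qp_subring: "is_subring Qp"
  unfolding is_subring_def
proof (intro conjI ballI)
  fix x y assume x: "x \<in> Qp" and y: "y \<in> Qp"
  show "x + y \<in> Qp"
    unfolding Qp_in_def mem_Collect_eq
  proof (intro allI impI)
    fix e :: real assume e: "e > 0"
    obtain q where q: "q \<in> \<rat>" "nrm (x - q) < e" using x e by (auto simp: Qp_in_def)
    obtain r where r: "r \<in> \<rat>" "nrm (y - r) < e" using y e by (auto simp: Qp_in_def)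
    have eq: "x + y - (q + r) = (x - q) + (y - r)" by simp
    have "nrm (x + y - (q + r)) < e" unfolding eq using nrm_add[of "x - q" "y - r"] q r by linarith
    then show "\<exists>q\<in>\<rat>. nrm (x + y - q) < e" using q r by (meson Rats_add)
  qed
  show "x * y \<in> Qp"
    unfolding Qp_in_def mem_Collect_eq
  proof (intro allI impI)
    fix e :: real assume e: "e > 0"
    have "e / (nrm y + 1) > 0" using e nrm_nonneg[of y] by simp
    then obtain q where q: "q \<in> \<rat>" "nrm (x - q) < e / (nrm y + 1)" using x by (auto simp: Qp_in_def)
    have "e / (nrm q + 1) > 0" using e nrm_nonneg[of q] by simp
    then obtain r where r: "r \<in> \<rat>" "nrm (y - r) < e / (nrm q + 1)" using y by (auto simp: Qp_in_def)
    have "nrm (x - q) * nrm y \<le> nrm (x - q) * (nrm y + 1)"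
      using nrm_nonneg by (intro mult_left_mono) auto
    also have "\<dots> < e" using q nrm_nonneg[of y] by (simp add: pos_less_divide_eq)
    finally have 1: "nrm ((x - q) * y) < e" by (simp add: nrm_mult)
    have "nrm q * nrm (y - r) \<le> (nrm q + 1) * nrm (y - r)"
      using nrm_nonneg by (intro mult_right_mono) auto
    also have "\<dots> < e" using r nrm_nonneg[of q] by (simp add: pos_less_divide_eq mult.commute)
    finally have 2: "nrm (q * (y - r)) < e" by (simp add: nrm_mult)
    have "x * y - q * r = (x - q) * y + q * (y - r)" by (simp add: algebra_simps)
    then have "nrm (x * y - q * r) < e" using nrm_add[of "(x - q) * y" "q * (y - r)"] 1 2 by simp
    then show "\<exists>q\<in>\<rat>. nrm (x * y - q) < e" using q r by (meson Rats_mult)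
  qed
  show "- x \<in> Qp"
    unfolding Qp_in_def mem_Collect_eq
  proof (intro allI impI)
    fix e :: real assume e: "e > 0"
    obtain q where q: "q \<in> \<rat>" "nrm (x - q) < e" using x e by (auto simp: Qp_in_def)
    have "nrm (- x - - q) < e" using q nrm_minus_commute[of q x] by simp
    then show "\<exists>q\<in>\<rat>. nrm (- x - q) < e" using q by (meson Rats_minus_iff)
  qed
qed (auto intro: Rats_Qp)

lemma Qp_inverse:
  assumes y: "y \<in> Qp" shows "inverse y \<in> Qp"
proof (cases "y = 0")
  case False
  then have pos: "nrm y > 0" by (rule nrm_pos)
  show ?thesis
    unfolding Qp_in_def mem_Collect_eq
  proof (intro allI impI)
    fix e :: real assume e: "e > 0"
    have "min (nrm y) (e * nrm y ^ 2) > 0" using pos e by simp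
    then obtain q where q: "q \<in> \<rat>" "nrm (y - q) < min (nrm y) (e * nrm y ^ 2)"
      using y unfolding Qp_in_def by blast
    then have nq: "nrm q = nrm y" by (intro nrm_eqI) simp
    then have "q \<noteq> 0" using pos by auto
    then have "inverse y - inverse q = (q - y) / (y * q)" using False by (simp add: field_simps)
    then have "nrm (inverse y - inverse q) = nrm (y - q) / nrm y ^ 2"
      by (simp add: nrm_divide nrm_mult nq power2_eq_square nrm_minus_commute)
    also have "\<dots> < e" using q pos by (simp add: pos_divide_less_eq)
    finally show "\<exists>q\<in>\<rat>. nrm (inverse y - q) < e" using q by (meson Rats_inverse)
  qed
qed (simp add: Rats_Qp)

lemma Qp_division: "has_division Qp"
  unfolding has_division_def divide_inverse
  by (auto intro: is_subringD(4)[OF Qp_subring] Qp_inverse)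

text \<open>
  By induction the span of all vectors but one is complete, so the remaining vector has positive distance from it, and
  this distance bounds its coordinate.
\<close>

lemma coordinates_bounded:
  assumes "finite I" "indep_family (*) Qp I (e :: 'i \<Rightarrow> 'c)"
  shows "\<exists>B>0. \<forall>c. (\<forall>i\<in>I. c i \<in> Qp) \<longrightarrow> (\<forall>i\<in>I. nrm (c i) \<le> B * nrm (\<Sum>i\<in>I. c i * e i))"
  using assms
proof (induction I rule: finite_induct)
  case (insert k I)
  have "indep_family (*) Qp I e"
    unfolding indep_family_def
  proof (intro allI impI ballI)
    fix c i assume c: "\<forall>i\<in>I. c i \<in> Qp" "(\<Sum>i\<in>I. c i * e i) = 0" and i: "i \<in> I"
    define d where "d j = (if j = k then 0 else c j)" for j
    have "(\<Sum>j\<in>insert k I. d j * e j) = (\<Sum>j\<in>I. d j * e j)"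
      using insert(1,2) by (simp add: d_def)
    also have "\<dots> = (\<Sum>j\<in>I. c j * e j)"
      using insert(2) by (intro sum.cong) (auto simp: d_def)
    finally have "(\<Sum>j\<in>insert k I. d j * e j) = 0" using c(2) by simp
    moreover have "\<And>j. j \<in> insert k I \<Longrightarrow> d j \<in> Qp"
      using c(1) is_subringD(1)[OF Qp_subring] by (auto simp: d_def)
    ultimately have "d i = 0"
      using indep_familyD[OF insert(4), of d i] i by blast
    then show "c i = 0" using i insert(2) by (auto simp: d_def split: if_splits)
  qed
  then obtain B where B: "B > 0" "\<And>c i. (\<forall>i\<in>I. c i \<in> Qp) \<Longrightarrow> i \<in> I \<Longrightarrow> nrm (c i) \<le> B * nrm (\<Sum>i\<in>I. c i * e i)"
    using insert(3) by blast
  have "\<exists>D>0. \<forall>c. (\<forall>i\<in>I. c i \<in> Qp) \<longrightarrow> D \<le> nrm (e k - (\<Sum>i\<in>I. c i * e i))"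
  proof (rule ccontr)
    assume neg: "\<not> ?thesis"
    have "\<exists>c. (\<forall>i\<in>I. c i \<in> Qp) \<and> nrm (e k - (\<Sum>i\<in>I. c i * e i)) < 1 / real (Suc n)" for n
    proof -
      have "1 / real (Suc n) > 0" by simp
      then show ?thesis using neg by (meson not_le)
    qed
    then obtain c where c: "\<And>n i. i \<in> I \<Longrightarrow> c n i \<in> Qp"
        "\<And>n. nrm (e k - (\<Sum>i\<in>I. c n i * e i)) < 1 / real (Suc n)"
      by metis
    have small: "\<exists>N. \<forall>n\<ge>N. 1 / real (Suc n) < \<epsilon>" if "\<epsilon> > 0" for \<epsilon> :: real
    proof -
      obtain N where N: "1 / real (Suc N) < \<epsilon>" using nat_approx_posE[OF \<open>\<epsilon> > 0\<close>] by blast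
      have "1 / real (Suc n) < \<epsilon>" if "n \<ge> N" for n
      proof -
        have "1 / real (Suc n) \<le> 1 / real (Suc N)" using that by (intro divide_left_mono) auto
        then show ?thesis using N by linarith
      qed
      then show ?thesis by blast
    qed
    have "\<exists>x\<in>Qp. (\<lambda>n. nrm (c n i - x)) \<longlonglongrightarrow> 0" if i: "i \<in> I" for i
    proof -
      have diff: "nrm (c m i - c n i) \<le> B * max (1 / real (Suc m)) (1 / real (Suc n))" for m n
      proof -
        have "nrm (c m i - c n i) \<le> B * nrm (\<Sum>i\<in>I. (c m i - c n i) * e i)"
          using B(2)[of "\<lambda>i. c m i - c n i" i] c(1) i is_subringD(6)[OF Qp_subring] by blast
        also have "(\<Sum>i\<in>I. (c m i - c n i) * e i) =
            (e k - (\<Sum>i\<in>I. c n i * e i)) - (e k - (\<Sum>i\<in>I. c m i * e i))"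
          by (simp add: left_diff_distrib sum_subtractf)
        also have "B * nrm \<dots> \<le> B * max (1 / real (Suc m)) (1 / real (Suc n))"
          using nrm_diff[of "e k - (\<Sum>i\<in>I. c n i * e i)" "e k - (\<Sum>i\<in>I. c m i * e i)"] c(2)[of m] c(2)[of n] B(1)
          by (intro mult_left_mono) linarith+
        finally show ?thesis .
      qed
      have "\<exists>x. (\<lambda>n. nrm (c n i - x)) \<longlonglongrightarrow> 0"
      proof (rule complete, intro allI impI)
        fix \<epsilon> :: real assume "\<epsilon> > 0"
        then obtain N where N: "\<forall>n\<ge>N. 1 / real (Suc n) < \<epsilon> / B" using small[of "\<epsilon> / B"] B(1) by auto
        have "nrm (c m i - c n i) < \<epsilon>" if "m \<ge> N" "n \<ge> N" for m n
        proof -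
          have "max (1 / real (Suc m)) (1 / real (Suc n)) < \<epsilon> / B" using N that by simp
          then have "B * max (1 / real (Suc m)) (1 / real (Suc n)) < \<epsilon>"
            using B(1) by (simp only: pos_less_divide_eq mult.commute)
          then show ?thesis using diff[of m n] by linarith
        qed
        then show "\<exists>N. \<forall>m\<ge>N. \<forall>n\<ge>N. nrm (c m i - c n i) < \<epsilon>" by blast
      qed
      then obtain x where x: "(\<lambda>n. nrm (c n i - x)) \<longlonglongrightarrow> 0" by blast
      have "x \<in> Qp"
      proof (rule Qp_closed)
        fix \<epsilon> :: real assume "\<epsilon> > 0"
        then obtain n where "nrm (c n i - x) < \<epsilon>"
          using order_tendstoD(2)[OF x] by (meson eventually_sequentially order_refl)
        then show "\<exists>y\<in>Qp. nrm (x - y) < \<epsilon>" using c(1)[OF i] nrm_minus_commute by metis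
      qed
      then show ?thesis using x by blast
    qed
    then obtain x where x: "\<And>i. i \<in> I \<Longrightarrow> x i \<in> Qp" "\<And>i. i \<in> I \<Longrightarrow> (\<lambda>n. nrm (c n i - x i)) \<longlonglongrightarrow> 0"
      by metis
    have lim0: "(\<lambda>n. 1 / real (Suc n)) \<longlonglongrightarrow> 0"
      using LIMSEQ_inverse_real_of_nat by (simp add: inverse_eq_divide)
    have lim: "(\<lambda>n. 1 / real (Suc n) + (\<Sum>i\<in>I. nrm (c n i - x i) * nrm (e i))) \<longlonglongrightarrow> 0 + (\<Sum>i\<in>I. 0 * nrm (e i))"
      by (intro tendsto_add tendsto_sum tendsto_mult x tendsto_const lim0)
    have "nrm (e k - (\<Sum>i\<in>I. x i * e i)) \<le> 0 + (\<Sum>i\<in>I. 0 * nrm (e i))"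
    proof (rule LIMSEQ_le_const[OF lim], intro exI[of _ 0] allI impI)
      fix n
      have tri: "nrm (\<Sum>i\<in>I. (c n i - x i) * e i) \<le> (\<Sum>i\<in>I. nrm (c n i - x i) * nrm (e i))"
      proof (rule nrm_sum_le)
        show "0 \<le> (\<Sum>i\<in>I. nrm (c n i - x i) * nrm (e i))"
          by (intro sum_nonneg mult_nonneg_nonneg nrm_nonneg)
        fix i assume "i \<in> I"
        then show "nrm ((c n i - x i) * e i) \<le> (\<Sum>i\<in>I. nrm (c n i - x i) * nrm (e i))"
          unfolding nrm_mult using insert(1)
          by (intro member_le_sum[of i I "\<lambda>i. nrm (c n i - x i) * nrm (e i)"] mult_nonneg_nonneg nrm_nonneg)
      qed
      have "e k - (\<Sum>i\<in>I. x i * e i) = (e k - (\<Sum>i\<in>I. c n i * e i)) + (\<Sum>i\<in>I. (c n i - x i) * e i)"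
        by (simp add: left_diff_distrib sum_subtractf)
      then have "nrm (e k - (\<Sum>i\<in>I. x i * e i)) \<le>
          max (nrm (e k - (\<Sum>i\<in>I. c n i * e i))) (nrm (\<Sum>i\<in>I. (c n i - x i) * e i))"
        using nrm_add by metis
      then show "nrm (e k - (\<Sum>i\<in>I. x i * e i)) \<le> 1 / real (Suc n) + (\<Sum>i\<in>I. nrm (c n i - x i) * nrm (e i))"
        using c(2)[of n] tri nrm_nonneg[of "\<Sum>i\<in>I. (c n i - x i) * e i"]
          nrm_nonneg[of "e k - (\<Sum>i\<in>I. c n i * e i)"] by linarith
    qed
    then have "nrm (e k - (\<Sum>i\<in>I. x i * e i)) \<le> 0" by simp
    then have ek: "e k - (\<Sum>i\<in>I. x i * e i) = 0"
      using nrm_nonneg nrm_eq_0 by (metis order_antisym)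
    define d where "d j = (if j = k then 1 else - x j)" for j
    have "(\<Sum>j\<in>I. d j * e j) = (\<Sum>j\<in>I. - (x j * e j))"
      using insert(2) by (intro sum.cong) (auto simp: d_def)
    then have "(\<Sum>j\<in>insert k I. d j * e j) = 0"
      using insert(1,2) ek by (simp add: d_def sum_negf)
    moreover have "\<And>j. j \<in> insert k I \<Longrightarrow> d j \<in> Qp"
      using x(1) is_subringD(2,5)[OF Qp_subring] by (auto simp: d_def)
    ultimately have "d k = 0"
      using indep_familyD[OF insert(4), of d k] by blast
    then show False by (simp add: d_def)
  qed
  then obtain D where D: "D > 0" "\<And>c. (\<forall>i\<in>I. c i \<in> Qp) \<Longrightarrow> D \<le> nrm (e k - (\<Sum>i\<in>I. c i * e i))" by blast
  define B' where "B' = 1 / D + B * (1 + nrm (e k) / D)"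
  have nn: "0 \<le> nrm (e k) / D" using D(1) nrm_nonneg by simp
  have B'_pos: "B' > 0" unfolding B'_def using D(1) B(1) nn by (intro add_pos_nonneg) auto
  have "nrm (c i) \<le> B' * nrm (\<Sum>i\<in>insert k I. c i * e i)"
    if c: "\<forall>i\<in>insert k I. c i \<in> Qp" and i: "i \<in> insert k I" for c i
  proof -
    define S where "S = (\<Sum>i\<in>insert k I. c i * e i)"
    have S: "S = c k * e k + (\<Sum>i\<in>I. c i * e i)" using insert(1,2) by (simp add: S_def)
    have Sn: "0 \<le> nrm S" by (rule nrm_nonneg)
    have ck: "nrm (c k) \<le> 1 / D * nrm S"
    proof (cases "c k = 0")
      case False
      have "\<forall>i\<in>I. - (c i / c k) \<in> Qp"
        using c is_subringD(4,5)[OF Qp_subring] Qp_inverse by (simp add: divide_inverse)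
      then have "D \<le> nrm (e k - (\<Sum>i\<in>I. - (c i / c k) * e i))" by (rule D(2))
      also have "e k - (\<Sum>i\<in>I. - (c i / c k) * e i) = S / c k"
        using False by (simp add: S sum_negf add_divide_distrib sum_divide_distrib)
      finally have "D * nrm (c k) \<le> nrm S"
        using nrm_pos[OF False] by (simp add: nrm_divide pos_le_divide_eq)
      then show ?thesis using D(1) by (simp add: field_simps)
    qed (use Sn D(1) in simp)
    show ?thesis
    proof (cases "i = k")
      case True
      have "nrm (c k) \<le> 1 / D * nrm S" by (rule ck)
      also have "\<dots> \<le> B' * nrm S"
        unfolding B'_def using Sn B(1) nn by (intro mult_right_mono) auto
      finally show ?thesis by (simp add: True S_def)
    next
      case False
      then have "nrm (c i) \<le> B * nrm (\<Sum>i\<in>I. c i * e i)" using B(2)[of c i] c i by auto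
      also have "(\<Sum>i\<in>I. c i * e i) = S - c k * e k" by (simp add: S)
      also have "nrm (S - c k * e k) \<le> nrm S + nrm (c k) * nrm (e k)"
        using nrm_diff[of S "c k * e k"] Sn mult_nonneg_nonneg[OF nrm_nonneg[of "c k"] nrm_nonneg[of "e k"]]
        by (simp add: nrm_mult)
      also have "\<dots> \<le> nrm S + 1 / D * nrm S * nrm (e k)"
        using ck nrm_nonneg[of "e k"] by (intro add_left_mono mult_right_mono)
      also have "\<dots> = (1 + nrm (e k) / D) * nrm S" by (simp add: algebra_simps)
      finally have "nrm (c i) \<le> B * ((1 + nrm (e k) / D) * nrm S)" using B(1) by (simp add: mult_left_mono)
      also have "\<dots> \<le> B' * nrm S"
        unfolding B'_def mult.assoc[symmetric] using Sn D(1) by (intro mult_right_mono) simp_all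
      finally show ?thesis by (simp add: S_def)
    qed
  qed
  then show ?case using B'_pos by blast
qed (auto intro: exI[of _ 1])

lemma hom_on_Kbar:
  assumes add: "\<And>x y. x \<in> Kbar \<Longrightarrow> y \<in> Kbar \<Longrightarrow> f (x + y) = f x + f y"
    and mult: "\<And>x y. x \<in> Kbar \<Longrightarrow> y \<in> Kbar \<Longrightarrow> f (x * y) = f x * f y"
    and K: "\<And>x. x \<in> K \<Longrightarrow> f x = (x :: 'c)"
  shows hom_on_Kbar_sum: "finite I \<Longrightarrow> (\<And>i. i \<in> I \<Longrightarrow> g i \<in> Kbar) \<Longrightarrow> f (\<Sum>i\<in>I. g i) = (\<Sum>i\<in>I. f (g i))"
    and hom_on_Kbar_power: "x \<in> Kbar \<Longrightarrow> f (x ^ n) = f x ^ n"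
proof -
  show "finite I \<Longrightarrow> (\<And>i. i \<in> I \<Longrightarrow> g i \<in> Kbar) \<Longrightarrow> f (\<Sum>i\<in>I. g i) = (\<Sum>i\<in>I. f (g i))"
  proof (induction I rule: finite_induct)
    case empty
    show ?case using K[OF is_subringD(1)[OF K_subring]] by simp
  next
    case (insert i I)
    have "f (\<Sum>i\<in>insert i I. g i) = f (g i + (\<Sum>i\<in>I. g i))" using insert(1,2) by simp
    also have "\<dots> = f (g i) + f (\<Sum>i\<in>I. g i)"
      by (intro add is_subring_sum[OF Kbar_subring] insert(4)) auto
    also have "f (\<Sum>i\<in>I. g i) = (\<Sum>i\<in>I. f (g i))" by (intro insert(3) insert(4)) auto
    finally show ?case using insert(1,2) by simp
  qed
  show "x \<in> Kbar \<Longrightarrow> f (x ^ n) = f x ^ n"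
    by (induction n) (auto simp: K is_subringD(2)[OF K_subring] mult is_subring_power[OF Kbar_subring])
qed

text \<open>
  \<open>x\<close> is algebraic over \<open>K\<close>, so its powers are \<open>K\<close>-combinations of finitely many of them; the coefficients are in turn
  combinations of the finitely many generators of \<open>K\<close>.
\<close>

lemma powers_in_finite_Qp_span:
  assumes x: "x \<in> Kbar"
  shows "\<exists>(I :: (nat \<times> nat) set) e. finite I \<and> e ` I \<subseteq> Kbar \<and> (\<forall>m. x ^ m \<in> lincomb (*) Qp I e)"
proof -
  obtain n b where b: "K = {(\<Sum>i<n. c i * b i) | c. \<forall>i<(n::nat). c i \<in> Qp}" using K_finite by blast
  have bK: "b i \<in> K" if "i < n" for i
  proof -
    have "(\<Sum>j<n. (if j = i then 1 else 0) * b j) = b i"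
      using that by (simp add: if_distrib[of "\<lambda>c. c * _"] cong: if_cong)
    then show ?thesis unfolding b mem_Collect_eq
      by (intro exI[of _ "\<lambda>j. if j = i then 1 else 0"]) (auto simp: is_subringD[OF Qp_subring])
  qed
  obtain f where f: "f \<in> poly_over K" "f \<noteq> 0" "poly f x = 0" using Kbar_algebraic[OF x] by blast
  define d where "d = degree f"
  define c where "c i = - (coeff f i / coeff f d)" for i
  have fK: "coeff f i \<in> K" for i using f(1) by (auto simp: poly_over_def)
  have c: "c i \<in> K" for i
    unfolding c_def by (intro is_subringD(5)[OF K_subring] subfield_divide[OF K_subfield] fK)
  have lc: "coeff f d \<noteq> 0" using f(2) by (simp add: d_def)
  have "0 = (\<Sum>i\<le>d. coeff f i * x ^ i)" using f(3) by (simp add: poly_altdef d_def)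
  also have "\<dots> = (\<Sum>i<d. coeff f i * x ^ i) + coeff f d * x ^ d"
    by (simp add: lessThan_Suc_atMost[symmetric])
  finally have "x ^ d = - ((\<Sum>i<d. coeff f i * x ^ i) / coeff f d)"
    using lc by (simp add: field_simps eq_neg_iff_add_eq_0)
  then have xd: "x ^ d = (\<Sum>i<d. c i * x ^ i)"
    by (simp add: c_def sum_divide_distrib sum_negf)
  have pow: "x ^ m \<in> lincomb (*) K {..<d} (\<lambda>i. x ^ i)" for m
  proof (induction m)
    case 0
    show ?case
    proof (cases "d = 0")
      case True
      then show ?thesis using xd by simp
    next
      case False
      then show ?thesis
        using vector_space.lincomb_member[OF vector_space_mult K_subring, of "{..<d}" 0 "\<lambda>i. x ^ i"] by simp
    qed
  next
    case (Suc m)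
    then obtain k where k: "\<forall>i\<in>{..<d}. k i \<in> K" "x ^ m = (\<Sum>i<d. k i * x ^ i)"
      by (rule lincombE)
    have "x ^ Suc m = (\<Sum>i<d. k i * x ^ Suc i)"
      unfolding power_Suc k(2) sum_distrib_left by (intro sum.cong refl) (simp only: mult_ac)
    also have "\<dots> \<in> lincomb (*) K {..<d} (\<lambda>i. x ^ i)"
    proof (intro vector_space.lincomb_sum[OF vector_space_mult K_subring] vector_space.lincomb_scale[OF vector_space_mult K_subring])
      fix i assume i: "i \<in> {..<d}"
      show "k i \<in> K" using k(1) i by blast
      show "x ^ Suc i \<in> lincomb (*) K {..<d} (\<lambda>i. x ^ i)"
      proof (cases "Suc i < d")
        case True
        then show ?thesis using vector_space.lincomb_member[OF vector_space_mult K_subring, of "{..<d}" "Suc i" "\<lambda>i. x ^ i"] by simp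
      next
        case False
        then have "Suc i = d" using i by simp
        then show ?thesis using xd c by (intro lincombI[of _ c]) auto
      qed
    qed
    finally show ?case .
  qed
  define e where "e = (\<lambda>(i, j). b j * x ^ i)"
  let ?I = "{..<d} \<times> {..<n}"
  have "e ` ?I \<subseteq> Kbar"
    using bK K_subset_Kbar x
    by (auto simp: e_def intro!: is_subringD(4)[OF Kbar_subring] is_subring_power[OF Kbar_subring])
  moreover have "x ^ m \<in> lincomb (*) Qp ?I e" for m
  proof -
    obtain k where k: "\<forall>i\<in>{..<d}. k i \<in> K" "x ^ m = (\<Sum>i<d. k i * x ^ i)"
      using lincombE[OF pow[of m]] by metis
    have "\<forall>i\<in>{..<d}. \<exists>q. (\<forall>j<n. q j \<in> Qp) \<and> k i = (\<Sum>j<n. q j * b j)"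
      using k(1) unfolding b by blast
    then obtain q where q: "\<And>i j. i < d \<Longrightarrow> j < n \<Longrightarrow> q i j \<in> Qp" "\<And>i. i < d \<Longrightarrow> k i = (\<Sum>j<n. q i j * b j)"
      by (metis lessThan_iff)
    have "x ^ m = (\<Sum>i<d. \<Sum>j<n. q i j * e (i, j))"
      unfolding k(2)
    proof (rule sum.cong[OF refl])
      fix i assume "i \<in> {..<d}"
      then have "k i = (\<Sum>j<n. q i j * b j)" by (intro q(2)) simp
      then show "k i * x ^ i = (\<Sum>j<n. q i j * e (i, j))"
        by (simp only: e_def prod.case mult.assoc sum_distrib_right)
    qed
    also have "\<dots> = (\<Sum>z\<in>?I. q (fst z) (snd z) * e z)"
      by (simp add: sum.cartesian_product case_prod_beta)
    finally show ?thesis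
      by (intro lincombI[of _ "\<lambda>z. q (fst z) (snd z)"]) (auto intro: q(1))
  qed
  ultimately show ?thesis by (intro exI[of _ ?I] exI[of _ e]) auto
qed

text \<open>
  All powers of \<open>x\<close> lie in one finite-dimensional space, on which \<open>f\<close> is bounded. So \<open>(nrm (f x)) ^ m\<close>
  is at most a constant times \<open>(nrm x) ^ m\<close>.
\<close>

lemma hom_on_Kbar_nrm_le:
  assumes add: "\<And>x y. x \<in> Kbar \<Longrightarrow> y \<in> Kbar \<Longrightarrow> f (x + y) = f x + f y"
    and mult: "\<And>x y. x \<in> Kbar \<Longrightarrow> y \<in> Kbar \<Longrightarrow> f (x * y) = f x * f y"
    and K: "\<And>x. x \<in> K \<Longrightarrow> f x = (x :: 'c)" and x: "x \<in> Kbar"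
  shows "nrm (f x) \<le> nrm x"
proof -
  obtain I0 :: "(nat \<times> nat) set" and e where I0: "finite I0" "e ` I0 \<subseteq> Kbar" "\<And>m. x ^ m \<in> lincomb (*) Qp I0 e"
    using powers_in_finite_Qp_span[OF x] by blast
  obtain I where I: "I \<subseteq> I0" "lincomb (*) Qp I e = lincomb (*) Qp I0 e" "indep_family (*) Qp I e"
    using vector_space.exists_indep_subfamily[OF vector_space_mult Qp_subring Qp_division I0(1)] by blast
  have fin: "finite I" using I(1) I0(1) by (rule finite_subset)
  obtain B where B: "B > 0" "\<And>c i. \<forall>i\<in>I. c i \<in> Qp \<Longrightarrow> i \<in> I \<Longrightarrow> nrm (c i) \<le> B * nrm (\<Sum>i\<in>I. c i * e i)"
    using coordinates_bounded[OF fin I(3)] by blast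
  define C where "C = B * (\<Sum>i\<in>I. nrm (f (e i)))"
  have eK: "e i \<in> Kbar" if "i \<in> I" for i using that I(1) I0(2) by blast
  have bound: "nrm (f x) ^ m \<le> C * nrm x ^ m" for m
  proof -
    obtain c where c: "\<forall>i\<in>I. c i \<in> Qp" "x ^ m = (\<Sum>i\<in>I. c i * e i)"
      using lincombE[OF I0(3)[of m, folded I(2)]] by metis
    have cK: "c i \<in> K" if "i \<in> I" for i using c(1) Qp_subset that by blast
    have "f x ^ m = f (x ^ m)" by (rule hom_on_Kbar_power[OF add mult K x, symmetric])
    also have "\<dots> = (\<Sum>i\<in>I. f (c i * e i))"
      unfolding c(2)
    proof (rule hom_on_Kbar_sum[OF add mult K fin])
      fix i assume i: "i \<in> I"
      show "c i * e i \<in> Kbar"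
        by (rule is_subringD(4)[OF Kbar_subring subsetD[OF K_subset_Kbar cK[OF i]] eK[OF i]])
    qed
    also have "\<dots> = (\<Sum>i\<in>I. c i * f (e i))"
    proof (rule sum.cong[OF refl])
      fix i assume i: "i \<in> I"
      then have "f (c i * e i) = f (c i) * f (e i)"
        by (intro mult subsetD[OF K_subset_Kbar] cK eK)
      then show "f (c i * e i) = c i * f (e i)" using K[OF cK[OF i]] by simp
    qed
    finally have eq: "f x ^ m = (\<Sum>i\<in>I. c i * f (e i))" .
    have "nrm (f x ^ m) \<le> C * nrm (x ^ m)"
      unfolding eq
    proof (rule nrm_sum_le)
      show "0 \<le> C * nrm (x ^ m)"
        unfolding C_def using B(1) by (intro mult_nonneg_nonneg sum_nonneg nrm_nonneg) auto
      fix i assume i: "i \<in> I"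
      have "nrm (f (e i)) \<le> (\<Sum>i\<in>I. nrm (f (e i)))"
        by (rule member_le_sum[OF i]) (use fin nrm_nonneg in auto)
      moreover have "nrm (c i) \<le> B * nrm (x ^ m)" unfolding c(2) by (rule B(2)[OF c(1) i])
      ultimately have "nrm (c i) * nrm (f (e i)) \<le> (B * nrm (x ^ m)) * (\<Sum>i\<in>I. nrm (f (e i)))"
        using B(1) by (intro mult_mono mult_nonneg_nonneg nrm_nonneg) auto
      then show "nrm (c i * f (e i)) \<le> C * nrm (x ^ m)" by (simp add: nrm_mult C_def mult_ac)
    qed
    then show ?thesis by simp
  qed
  show ?thesis
  proof (cases "x = 0")
    case True
    then show ?thesis using K[OF is_subringD(1)[OF K_subring]] by simp
  next
    case False
    then have pos: "nrm x > 0" by (rule nrm_pos)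
    show ?thesis
    proof (rule ccontr)
      assume "\<not> nrm (f x) \<le> nrm x"
      then have "nrm (f x) / nrm x > 1" using pos by simp
      then obtain m where m: "C < (nrm (f x) / nrm x) ^ m" using real_arch_pow by blast
      then have "C * nrm x ^ m < nrm (f x) ^ m" using pos by (simp add: power_divide pos_less_divide_eq)
      then show False using bound[of m] by simp
    qed
  qed
qed

lemma hom_on_Kbar_nrm:
  assumes add: "\<And>x y. x \<in> Kbar \<Longrightarrow> y \<in> Kbar \<Longrightarrow> f (x + y) = f x + f y"
    and mult: "\<And>x y. x \<in> Kbar \<Longrightarrow> y \<in> Kbar \<Longrightarrow> f (x * y) = f x * f y"
    and K: "\<And>x. x \<in> K \<Longrightarrow> f x = (x :: 'c)" and x: "x \<in> Kbar"
  shows "nrm (f x) = nrm x"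
proof (cases "x = 0")
  case True
  then show ?thesis using K[OF is_subringD(1)[OF K_subring]] by simp
next
  case False
  have inv: "inverse x \<in> Kbar" using subfield_typeD(6)[OF Kbar_subfield x] .
  have "f (inverse x) * f x = f (inverse x * x)" by (rule mult[OF inv x, symmetric])
  also have "\<dots> = 1" using False K[OF is_subringD(2)[OF K_subring]] by simp
  finally have one: "nrm (f (inverse x)) * nrm (f x) = 1" by (metis nrm_mult nrm_1)
  have "nrm (f (inverse x)) \<le> inverse (nrm x)"
    using hom_on_Kbar_nrm_le[OF add mult K inv] by (simp add: nrm_inverse)
  then have "1 \<le> inverse (nrm x) * nrm (f x)"
    using mult_right_mono[of "nrm (f (inverse x))" "inverse (nrm x)" "nrm (f x)"] one nrm_nonneg[of "f x"] by simp
  then have "nrm x \<le> nrm (f x)" using nrm_pos[OF False] by (simp add: field_simps)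
  then show ?thesis using hom_on_Kbar_nrm_le[OF add mult K x] by simp
qed

end

section \<open>Extending embeddings\<close>

context unramified_field
begin

text \<open>
  Graphs of embeddings over \<open>K\<close> of subrings of \<open>Kbar\<close> into \<open>Kbar\<close>. As graphs, they are ordered by inclusion. Closure under
  inverses follows from algebraicity, see \<open>partial_hom_inverse\<close>.
\<close>

definition partial_hom :: "('c \<times> 'c) set \<Rightarrow> bool"
  where "partial_hom G \<longleftrightarrow> G \<subseteq> Kbar \<times> Kbar \<and> (\<forall>x\<in>K. (x, x) \<in> G) \<and>
    (\<forall>x y x' y'. (x, y) \<in> G \<longrightarrow> (x', y') \<in> G \<longrightarrow> (x + x', y + y') \<in> G \<and> (x * x', y * y') \<in> G) \<and>
    (\<forall>y. (0, y) \<in> G \<longrightarrow> y = 0)"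

lemma partial_homD:
  assumes "partial_hom G"
  shows "(x, y) \<in> G \<Longrightarrow> x \<in> Kbar" "(x, y) \<in> G \<Longrightarrow> y \<in> Kbar" "x \<in> K \<Longrightarrow> (x, x) \<in> G"
    "(x, y) \<in> G \<Longrightarrow> (x', y') \<in> G \<Longrightarrow> (x + x', y + y') \<in> G"
    "(x, y) \<in> G \<Longrightarrow> (x', y') \<in> G \<Longrightarrow> (x * x', y * y') \<in> G"
    "(0, y) \<in> G \<Longrightarrow> y = 0"
  using assms unfolding partial_hom_def by blast+

lemma partial_hom_diff:
  assumes G: "partial_hom G" and "(x, y) \<in> G" "(x', y') \<in> G"
  shows "(x - x', y - y') \<in> G"
proof -
  have "(- 1, - 1) \<in> G"
    by (intro partial_homD(3)[OF G] is_subringD(2,5)[OF K_subring])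
  from partial_homD(4)[OF G assms(2) partial_homD(5)[OF G this assms(3)]]
  show ?thesis by simp
qed

lemma partial_hom_unique: "partial_hom G \<Longrightarrow> (x, y) \<in> G \<Longrightarrow> (x, y') \<in> G \<Longrightarrow> y = y'"
  using partial_hom_diff[of G x y x y'] partial_homD(6)[of G "y - y'"] by simp

lemma partial_hom_sum:
  assumes "partial_hom G" "\<And>i. i \<in> I \<Longrightarrow> (f i, g i) \<in> G"
  shows "(\<Sum>i\<in>I. f i, \<Sum>i\<in>I. g i) \<in> G"
  using assms(2)
  by (induction I rule: infinite_finite_induct)
    (auto intro: partial_homD(3,4)[OF assms(1)] is_subringD(1)[OF K_subring])

lemma partial_hom_power: "partial_hom G \<Longrightarrow> (x, y) \<in> G \<Longrightarrow> (x ^ n, y ^ n) \<in> G"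
  by (induction n) (auto intro: partial_homD(3,5) is_subringD(2)[OF K_subring])

text \<open>The inverse of a number algebraic over \<open>K\<close> is a polynomial in it with coefficients in \<open>K\<close>.\<close>

lemma partial_hom_inverse:
  assumes G: "partial_hom G" and x: "(x, y) \<in> G" "x \<noteq> 0"
  shows "\<exists>z. (inverse x, z) \<in> G"
proof -
  have "\<exists>f. f \<in> poly_over K \<and> f \<noteq> 0 \<and> poly f x = 0"
    using Kbar_algebraic partial_homD(1)[OF G x(1)] by blast
  then obtain f where f: "f \<in> poly_over K" "f \<noteq> 0" "poly f x = 0"
      and min: "\<And>g. g \<in> poly_over K \<Longrightarrow> g \<noteq> 0 \<Longrightarrow> poly g x = 0 \<Longrightarrow> degree f \<le> degree g"
    using ex_has_least_nat[of "\<lambda>f. f \<in> poly_over K \<and> f \<noteq> 0 \<and> poly f x = 0" _ degree] by metis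
  obtain a h where fh: "f = pCons a h" by (cases f)
  have hK: "coeff h n \<in> K" for n
    using f(1) coeff_pCons_Suc[of a h n] unfolding poly_over_def fh by (metis (mono_tags, lifting) mem_Collect_eq)
  have aK: "a \<in> K"
    using f(1) coeff_pCons_0[of a h] unfolding poly_over_def fh by (metis (mono_tags, lifting) mem_Collect_eq)
  have eq: "a + x * poly h x = 0" using f(3) by (simp add: fh)
  have a: "a \<noteq> 0"
  proof
    assume a: "a = 0"
    then have h: "h \<noteq> 0" "poly h x = 0" using f(2) eq x(2) by (auto simp: fh)
    then have "degree f \<le> degree h" using hK by (intro min) (auto simp: poly_over_def)
    then show False using h(1) by (simp add: fh)
  qed
  define k where "k = - inverse a"
  have "x * (poly h x * k) = 1"
  proof -
    have "x * poly h x = - a" using eq by (simp add: eq_neg_iff_add_eq_0 add.commute)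
    then have "x * poly h x * k = 1" using a by (simp add: k_def)
    then show ?thesis by (simp add: mult.assoc)
  qed
  then have inv: "inverse x = poly h x * k" by (rule inverse_unique)
  have "(poly h x, poly h y) \<in> G"
    unfolding poly_altdef
    by (intro partial_hom_sum[OF G] partial_homD(5)[OF G] partial_homD(3)[OF G] partial_hom_power[OF G] hK x(1))
  moreover have "(k, k) \<in> G"
    unfolding k_def by (intro partial_homD(3)[OF G] is_subringD(5)[OF K_subring] subfield_typeD(6)[OF K_subfield aK])
  ultimately show ?thesis using partial_homD(5)[OF G] inv by metis
qed

lemma partial_hom_inj:
  assumes G: "partial_hom G" and "(x, 0) \<in> G"
  shows "x = 0"
proof (rule ccontr)
  assume x: "x \<noteq> 0"
  then obtain z where "(inverse x, z) \<in> G" using partial_hom_inverse[OF assms] by blast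
  from partial_homD(5)[OF G assms(2) this] have "(1, 0) \<in> G" using x by simp
  moreover have "(1, 1) \<in> G" by (intro partial_homD(3)[OF G] is_subringD(2)[OF K_subring])
  ultimately show False using partial_hom_unique[OF G] zero_neq_one by metis
qed

text \<open>
  Polynomials over the domain of \<open>G\<close>, together with their images under the embedding.
\<close>

definition poly_pairs :: "('c \<times> 'c) set \<Rightarrow> ('c poly \<times> 'c poly) set"
  where "poly_pairs G = {(q, q'). \<forall>n. (coeff q n, coeff q' n) \<in> G}"

definition adjoin :: "('c \<times> 'c) set \<Rightarrow> 'c \<Rightarrow> 'c \<Rightarrow> ('c \<times> 'c) set"
  where "adjoin G x y = {(poly q x, poly q' y) | q q'. (q, q') \<in> poly_pairs G}"

lemma poly_pairs_degree:
  assumes G: "partial_hom G" and q: "(q, q') \<in> poly_pairs G"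
  shows "degree q' = degree q"
proof -
  have "coeff q n = 0 \<longleftrightarrow> coeff q' n = 0" for n
  proof -
    have "(coeff q n, coeff q' n) \<in> G" using q by (simp add: poly_pairs_def)
    then show ?thesis using partial_homD(6)[OF G] partial_hom_inj[OF G] by metis
  qed
  then have "\<forall>i>degree q. coeff q' i = 0" "\<forall>i>degree q'. coeff q i = 0"
    using coeff_eq_0 by blast+
  then show ?thesis by (intro antisym degree_le)
qed

lemma poly_pairs_diff:
  assumes G: "partial_hom G" and "(q, q') \<in> poly_pairs G" "(r, r') \<in> poly_pairs G"
  shows "(q - r, q' - r') \<in> poly_pairs G"
  using assms partial_hom_diff[OF G] by (simp add: poly_pairs_def)

lemma poly_pairs_add:
  assumes G: "partial_hom G" and "(q, q') \<in> poly_pairs G" "(r, r') \<in> poly_pairs G"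
  shows "(q + r, q' + r') \<in> poly_pairs G"
  using assms partial_homD(4)[OF G] by (simp add: poly_pairs_def)

lemma poly_pairs_mult:
  assumes G: "partial_hom G" and "(q, q') \<in> poly_pairs G" "(r, r') \<in> poly_pairs G"
  shows "(q * r, q' * r') \<in> poly_pairs G"
  using assms(2,3) by (auto simp: poly_pairs_def coeff_mult intro!: partial_hom_sum[OF G] partial_homD(5)[OF G])

lemma poly_pairs_monom:
  assumes G: "partial_hom G" and "(c, c') \<in> G"
  shows "(monom c n, monom c' n) \<in> poly_pairs G"
  using assms(2) partial_homD(3)[OF G is_subringD(1)[OF K_subring]] by (simp add: poly_pairs_def)

text \<open>
  The assignment \<open>q (x) \<mapsto> q' (y)\<close> is well defined: subtracting multiples of \<open>g\<close>, which is of minimal degree, reduces a polynomial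
  vanishing at \<open>x\<close> to \<open>0\<close>, and the same subtractions do not change the value of its image at \<open>y\<close>.
\<close>

lemma partial_hom_adjoin:
  assumes G: "partial_hom G" and xy: "x \<in> Kbar" "y \<in> Kbar" and g: "(g, g') \<in> poly_pairs G" "g \<noteq> 0"
    and root: "poly g x = 0" "poly g' y = 0"
    and min: "\<And>q q'. (q, q') \<in> poly_pairs G \<Longrightarrow> q \<noteq> 0 \<Longrightarrow> poly q x = 0 \<Longrightarrow> degree g \<le> degree q"
  shows "partial_hom (adjoin G x y)" "G \<subseteq> adjoin G x y" "(x, y) \<in> adjoin G x y"
proof -
  have "degree g \<noteq> 0"
  proof
    assume "degree g = 0"
    then obtain a where "g = [:a:]" by (rule degree_eq_zeroE)
    then show False using g(2) root(1) by simp
  qed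
  then have deg: "degree g > 0" by simp
  have well_defined: "poly q' y = 0" if "(q, q') \<in> poly_pairs G" "poly q x = 0" for q q'
    using that
  proof (induction "degree q" arbitrary: q q' rule: less_induct)
    case less
    note q = less(2,3)
    show ?case
    proof (cases "q = 0")
      case True
      have "coeff q' n = 0" for n
        using q(1) partial_homD(6)[OF G] unfolding True poly_pairs_def by simp
      then have "q' = 0" by (simp add: poly_eq_iff)
      then show ?thesis by simp
    next
      case False
      then have le: "degree g \<le> degree q" using min q by blast
      define k where "k = degree q - degree g"
      have lc: "lead_coeff g \<noteq> 0" using g(2) by simp
      have lcg: "(lead_coeff g, coeff g' (degree g)) \<in> G" using g(1) by (simp add: poly_pairs_def)
      obtain z where "(inverse (lead_coeff g), z) \<in> G"
        using partial_hom_inverse[OF G lcg lc] by blast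
      moreover have "(lead_coeff q, coeff q' (degree q)) \<in> G" using q(1) by (simp add: poly_pairs_def)
      ultimately obtain c' where c: "(lead_coeff q * inverse (lead_coeff g), c') \<in> G"
        using partial_homD(5)[OF G] by blast
      define c where "c = lead_coeff q * inverse (lead_coeff g)"
      define r where "r = q - monom c k * g"
      define r' where "r' = q' - monom c' k * g'"
      have r: "(r, r') \<in> poly_pairs G"
        unfolding r_def r'_def c_def
        by (intro poly_pairs_diff[OF G] poly_pairs_mult[OF G] poly_pairs_monom[OF G] q(1) g(1) c)
      have rx: "poly r x = 0" using q(2) root by (simp add: r_def)
      have "degree (monom c k * g) \<le> degree q"
        using degree_mult_le[of "monom c k" g] degree_monom_le[of c k] le by (simp add: k_def)
      then have "degree r \<le> degree q" unfolding r_def by (intro degree_diff_le) auto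
      moreover have "coeff r (degree q) = 0"
        using lc le by (simp add: r_def coeff_monom_mult k_def c_def)
      ultimately have "r = 0 \<or> degree r < degree q" by (rule eq_zero_or_degree_less)
      then have "degree r < degree q"
        using deg le by auto
      then have "poly r' y = 0" using less(1)[OF _ r rx] by blast
      then show ?thesis using root(2) by (simp add: r'_def)
    qed
  qed
  have const: "([:a:], [:b:]) \<in> poly_pairs G" if "(a, b) \<in> G" for a b
    using poly_pairs_monom[OF G that, of 0] by (simp add: monom_0)
  show sub: "G \<subseteq> adjoin G x y"
  proof (rule subrelI)
    fix a b assume "(a, b) \<in> G"
    then show "(a, b) \<in> adjoin G x y"
      unfolding adjoin_def using const[of a b] by force
  qed
  have "(monom 1 1, monom 1 1) \<in> poly_pairs G"
    by (intro poly_pairs_monom[OF G] partial_homD(3)[OF G] is_subringD(2)[OF K_subring])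
  then show "(x, y) \<in> adjoin G x y"
    unfolding adjoin_def using poly_monom[of 1 1 x] poly_monom[of 1 1 y] by force
  have Kbar_poly: "poly q a \<in> Kbar" if "\<And>n. coeff q n \<in> Kbar" "a \<in> Kbar" for q a
    unfolding poly_altdef
    by (intro is_subring_sum[OF Kbar_subring] is_subringD(4)[OF Kbar_subring] is_subring_power[OF Kbar_subring] that)
  show "partial_hom (adjoin G x y)"
    unfolding partial_hom_def
  proof (intro conjI allI impI ballI)
    show "adjoin G x y \<subseteq> Kbar \<times> Kbar"
    proof (rule subrelI)
      fix a b assume "(a, b) \<in> adjoin G x y"
      then obtain q q' where q: "(q, q') \<in> poly_pairs G" "a = poly q x" "b = poly q' y" by (auto simp: adjoin_def)
      then have "coeff q n \<in> Kbar" "coeff q' n \<in> Kbar" for n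
        using partial_homD(1,2)[OF G, of "coeff q n" "coeff q' n"] by (auto simp: poly_pairs_def)
      then show "(a, b) \<in> Kbar \<times> Kbar" unfolding q using xy Kbar_poly by blast
    qed
    show "(a, a) \<in> adjoin G x y" if "a \<in> K" for a using partial_homD(3)[OF G that] sub by blast
    fix a b a' b' assume "(a, b) \<in> adjoin G x y" "(a', b') \<in> adjoin G x y"
    then obtain q q' r r' where q: "(q, q') \<in> poly_pairs G" "a = poly q x" "b = poly q' y"
      and r: "(r, r') \<in> poly_pairs G" "a' = poly r x" "b' = poly r' y"
      by (auto simp: adjoin_def)
    show "(a + a', b + b') \<in> adjoin G x y"
      unfolding adjoin_def mem_Collect_eq using poly_pairs_add[OF G q(1) r(1)]
      by (intro exI[of _ "q + r"] exI[of _ "q' + r'"]) (simp add: q r)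
    show "(a * a', b * b') \<in> adjoin G x y"
      unfolding adjoin_def mem_Collect_eq using poly_pairs_mult[OF G q(1) r(1)]
      by (intro exI[of _ "q * r"] exI[of _ "q' * r'"]) (simp add: q r)
  next
    fix b assume "(0, b) \<in> adjoin G x y"
    then obtain q q' where "(q, q') \<in> poly_pairs G" "0 = poly q x" "b = poly q' y" by (auto simp: adjoin_def)
    then show "b = 0" using well_defined[of q q'] by simp
  qed
qed

lemma partial_hom_Union:
  assumes "C \<noteq> {}" "\<And>G. G \<in> C \<Longrightarrow> partial_hom G" "\<And>G H. G \<in> C \<Longrightarrow> H \<in> C \<Longrightarrow> G \<subseteq> H \<or> H \<subseteq> G"
  shows "partial_hom (\<Union>C)"
  unfolding partial_hom_def
proof (intro conjI allI impI ballI)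
  show "\<Union>C \<subseteq> Kbar \<times> Kbar" using assms(2) by (auto dest: partial_homD)
  show "(x, x) \<in> \<Union>C" if "x \<in> K" for x using assms(1,2) partial_homD(3)[OF _ that] by blast
  show "y = 0" if "(0, y) \<in> \<Union>C" for y using assms(2) partial_homD(6) that by blast
  fix x y x' y' assume "(x, y) \<in> \<Union>C" "(x', y') \<in> \<Union>C"
  then obtain G where "G \<in> C" "(x, y) \<in> G" "(x', y') \<in> G" using assms(3) by blast
  then show "(x + x', y + y') \<in> \<Union>C" "(x * x', y * y') \<in> \<Union>C"
    using partial_homD(4,5)[OF assms(2)] by blast+
qed

text \<open>
  A maximal graph has domain \<open>Kbar\<close>, as otherwise one more element could be adjoined. It is onto, because the embedding
  permutes the finitely many roots in \<open>Kbar\<close> of each polynomial over \<open>K\<close>.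
\<close>

lemma extend_partial_hom:
  assumes G: "partial_hom G0"
  shows "\<exists>G. partial_hom G \<and> G0 \<subseteq> G \<and> fst ` G = Kbar \<and> snd ` G = Kbar"
proof -
  have "\<exists>G\<in>{G. partial_hom G \<and> G0 \<subseteq> G}. \<forall>H\<in>{G. partial_hom G \<and> G0 \<subseteq> G}. G \<subseteq> H \<longrightarrow> H = G"
  proof (rule subset_Zorn_nonempty)
    show "{G. partial_hom G \<and> G0 \<subseteq> G} \<noteq> {}" using G by blast
    fix C assume C: "C \<noteq> {}" "subset.chain {G. partial_hom G \<and> G0 \<subseteq> G} C"
    then have sub: "\<And>G. G \<in> C \<Longrightarrow> partial_hom G \<and> G0 \<subseteq> G" and "\<And>G H. G \<in> C \<Longrightarrow> H \<in> C \<Longrightarrow> G \<subseteq> H \<or> H \<subseteq> G"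
      unfolding subset_chain_def by blast+
    then have "partial_hom (\<Union>C)" using C(1) by (intro partial_hom_Union) blast+
    then show "\<Union>C \<in> {G. partial_hom G \<and> G0 \<subseteq> G}" using sub C(1) by blast
  qed
  then obtain G where G: "partial_hom G" "G0 \<subseteq> G" and max: "\<And>H. partial_hom H \<Longrightarrow> G \<subseteq> H \<Longrightarrow> H = G"
    by (auto intro: subset_trans)
  have Kpair: "(f, f) \<in> poly_pairs G" if "f \<in> poly_over K" for f
    using that partial_homD(3)[OF G(1)] by (simp add: poly_pairs_def poly_over_def)
  have dom: "x \<in> fst ` G" if x: "x \<in> Kbar" for x
  proof -
    have "\<exists>q. (\<exists>q'. (q, q') \<in> poly_pairs G) \<and> q \<noteq> 0 \<and> poly q x = 0"
      using Kbar_algebraic[OF x] Kpair by blast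
    then obtain g where g: "(\<exists>g'. (g, g') \<in> poly_pairs G) \<and> g \<noteq> 0 \<and> poly g x = 0"
        and min: "\<And>q. (\<exists>q'. (q, q') \<in> poly_pairs G) \<and> q \<noteq> 0 \<and> poly q x = 0 \<Longrightarrow> degree g \<le> degree q"
      using ex_has_least_nat[of "\<lambda>q. (\<exists>q'. (q, q') \<in> poly_pairs G) \<and> q \<noteq> 0 \<and> poly q x = 0" _ degree] by metis
    obtain g' where g': "(g, g') \<in> poly_pairs G" using g by blast
    have "degree g \<noteq> 0"
    proof
      assume "degree g = 0"
      then obtain a where "g = [:a:]" by (rule degree_eq_zeroE)
      then show False using g by simp
    qed
    then have "degree g' > 0" using poly_pairs_degree[OF G(1) g'] by simp
    moreover have "coeff g' n \<in> Kbar" for n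
      using g' partial_homD(2)[OF G(1), of "coeff g n"] by (simp add: poly_pairs_def)
    ultimately obtain y where y: "y \<in> Kbar" "poly g' y = 0"
      using Kbar_closed[of g'] by (auto simp: poly_over_def)
    have "partial_hom (adjoin G x y)" "G \<subseteq> adjoin G x y" "(x, y) \<in> adjoin G x y"
      using partial_hom_adjoin[OF G(1) x y(1) g' _ _ y(2)] g min by blast+
    then have "(x, y) \<in> G" using max by metis
    then show ?thesis by force
  qed
  have ran: "y \<in> snd ` G" if y: "y \<in> Kbar" for y
  proof -
    obtain h where h: "h \<in> poly_over K" "h \<noteq> 0" "poly h y = 0" using Kbar_algebraic[OF y] by blast
    define R where "R = {z \<in> Kbar. poly h z = 0}"
    have fin: "finite R" using poly_roots_finite[OF h(2)] by (auto simp: R_def)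
    have "\<forall>z\<in>R. \<exists>w. (z, w) \<in> G" using dom by (force simp: R_def)
    then obtain f where f: "\<And>z. z \<in> R \<Longrightarrow> (z, f z) \<in> G" by metis
    have hK: "coeff h n \<in> K" for n using h(1) by (simp add: poly_over_def)
    have "f z \<in> R" if z: "z \<in> R" for z
    proof -
      have "(poly h z, poly h (f z)) \<in> G"
        unfolding poly_altdef
        by (intro partial_hom_sum[OF G(1)] partial_homD(5)[OF G(1)] partial_homD(3)[OF G(1)] partial_hom_power[OF G(1)] hK f[OF z])
      then have "poly h (f z) = 0" using z partial_homD(6)[OF G(1)] by (simp add: R_def)
      then show ?thesis using partial_homD(2)[OF G(1) f[OF z]] by (simp add: R_def)
    qed
    moreover have "inj_on f R"
    proof (rule inj_onI)
      fix z w assume "z \<in> R" "w \<in> R" "f z = f w"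
      then have "(z - w, 0) \<in> G" using partial_hom_diff[OF G(1) f f, of z w] by simp
      then have "z - w = 0" by (rule partial_hom_inj[OF G(1)])
      then show "z = w" by simp
    qed
    ultimately have "f ` R = R" using fin by (simp add: endo_inj_surj image_subset_iff)
    moreover have "y \<in> R" using y h(3) by (simp add: R_def)
    ultimately obtain z where "z \<in> R" "y = f z" by blast
    then show ?thesis using f by force
  qed
  have "fst ` G = Kbar" "snd ` G = Kbar"
    using dom ran partial_homD(1,2)[OF G(1)] by (auto simp: image_iff)
  then show ?thesis using G by blast
qed

end

section \<open>A Galois element moving the roots of the uniformiser\<close>

context unramified_field
begin

lemma exists_root_of_unity: "\<exists>\<zeta>\<in>Kbar. \<zeta> ^ p = 1 \<and> \<zeta> \<noteq> 1"
proof -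
  define f where "f = (\<Sum>i<p. monom (1::'c) i)"
  have c: "coeff f n = (if n < p then 1 else 0)" for n
    by (simp add: f_def coeff_sum)
  have "f \<in> poly_over Kbar"
    using is_subringD(1,2)[OF Kbar_subring] by (simp add: poly_over_def c)
  moreover have "degree f \<ge> 1"
    using p_ge_2 by (intro le_degree) (simp add: c)
  ultimately obtain \<zeta> where z: "\<zeta> \<in> Kbar" "poly f \<zeta> = 0" using Kbar_closed[of f] by auto
  have sum: "(\<Sum>i<p. \<zeta> ^ i) = 0" using z(2) by (simp add: f_def poly_sum poly_monom)
  have "\<zeta> ^ p - 1 = (\<zeta> - 1) * (\<Sum>i<p. \<zeta> ^ i)" by (rule power_diff_1_eq)
  then have "\<zeta> ^ p = 1" by (simp add: sum)
  moreover have "\<zeta> \<noteq> 1" using sum by auto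
  ultimately show ?thesis using z(1) by blast
qed

text \<open>The continuous extension to the completion of the automorphism with graph \<open>G\<close>.\<close>

definition limit_rel :: "('c \<times> 'c) set \<Rightarrow> 'c \<Rightarrow> 'c \<Rightarrow> bool"
  where "limit_rel G z w \<longleftrightarrow> (\<forall>e>0. \<exists>(x, y)\<in>G. nrm (z - x) < e \<and> nrm (w - y) < e)"

lemma limit_relI:
  "(\<And>e. e > 0 \<Longrightarrow> \<exists>x y. (x, y) \<in> G \<and> nrm (z - x) < e \<and> nrm (w - y) < e) \<Longrightarrow> limit_rel G z w"
  unfolding limit_rel_def by blast

lemma limit_relE:
  assumes "limit_rel G z w" "e > 0"
  obtains x y where "(x, y) \<in> G" "nrm (z - x) < e" "nrm (w - y) < e"
  using assms unfolding limit_rel_def by blast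

lemma limit_rel_converse: "limit_rel (G\<inverse>) w z \<longleftrightarrow> limit_rel G z w"
  unfolding limit_rel_def by blast

lemma limit_rel_exists:
  assumes iso: "\<And>x y x' y'. (x, y) \<in> G \<Longrightarrow> (x', y') \<in> G \<Longrightarrow> nrm (y - y') = nrm (x - x')"
    and dom: "fst ` G = Kbar"
  shows "\<exists>w. limit_rel G z w"
proof -
  have "\<exists>x y. (x, y) \<in> G \<and> nrm (z - x) < 1 / real (Suc n)" for n
  proof -
    have "1 / real (Suc n) > 0" by simp
    then obtain x where "x \<in> Kbar" "nrm (z - x) < 1 / real (Suc n)" using Kbar_dense by blast
    then show ?thesis using dom by force
  qed
  then obtain x y where xy: "\<And>n. (x n, y n) \<in> G" "\<And>n. nrm (z - x n) < 1 / real (Suc n)" by metis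
  have small: "\<exists>N. \<forall>n\<ge>N. nrm (z - x n) < e" if e: "e > 0" for e
  proof -
    obtain N where N: "1 / real (Suc N) < e" using nat_approx_posE[OF e] by blast
    have "nrm (z - x n) < e" if "n \<ge> N" for n
    proof -
      have "1 / real (Suc n) \<le> 1 / real (Suc N)" using that by (intro divide_left_mono) auto
      then show ?thesis using N xy(2)[of n] by linarith
    qed
    then show ?thesis by blast
  qed
  have "\<exists>w. (\<lambda>n. nrm (y n - w)) \<longlonglongrightarrow> 0"
  proof (rule complete, intro allI impI)
    fix e :: real assume "e > 0"
    then obtain N where N: "\<forall>n\<ge>N. nrm (z - x n) < e" using small by blast
    have "nrm (y m - y n) < e" if "m \<ge> N" "n \<ge> N" for m n
    proof -
      have "nrm (y m - y n) = nrm ((z - x n) - (z - x m))" using iso[OF xy(1) xy(1)] by simp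
      also have "\<dots> \<le> max (nrm (z - x n)) (nrm (z - x m))" by (rule nrm_diff)
      also have "\<dots> < e" using N that by simp
      finally show ?thesis .
    qed
    then show "\<exists>N. \<forall>m\<ge>N. \<forall>n\<ge>N. nrm (y m - y n) < e" by blast
  qed
  then obtain w where w: "(\<lambda>n. nrm (y n - w)) \<longlonglongrightarrow> 0" by blast
  have "limit_rel G z w"
  proof (rule limit_relI)
    fix e :: real assume e: "e > 0"
    obtain N where N: "\<forall>n\<ge>N. nrm (z - x n) < e" using small[OF e] by blast
    obtain M where M: "\<forall>n\<ge>M. nrm (y n - w) < e"
      using order_tendstoD(2)[OF w e] by (auto simp: eventually_sequentially)
    have "nrm (z - x (max M N)) < e" using N by simp
    moreover have "nrm (w - y (max M N)) < e" using M nrm_minus_commute[of w] by simp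
    ultimately show "\<exists>x y. (x, y) \<in> G \<and> nrm (z - x) < e \<and> nrm (w - y) < e" using xy(1) by blast
  qed
  then show ?thesis by blast
qed

lemma limit_rel_nrm_le:
  assumes iso: "\<And>x y x' y'. (x, y) \<in> G \<Longrightarrow> (x', y') \<in> G \<Longrightarrow> nrm (y - y') = nrm (x - x')"
    and "limit_rel G z w" "limit_rel G z' w'"
  shows "nrm (w - w') \<le> nrm (z - z')"
proof (rule field_le_epsilon)
  fix e :: real assume e: "e > 0"
  obtain x y where xy: "(x, y) \<in> G" "nrm (z - x) < e" "nrm (w - y) < e" by (rule limit_relE[OF assms(2) e])
  obtain x' y' where xy': "(x', y') \<in> G" "nrm (z' - x') < e" "nrm (w' - y') < e" by (rule limit_relE[OF assms(3) e])
  have xx: "x - x' = ((z - z') - (z - x)) + (z' - x')" by simp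
  have "nrm (x - x') \<le> max (max (nrm (z - z')) (nrm (z - x))) (nrm (z' - x'))"
    unfolding xx using nrm_add[of "(z - z') - (z - x)" "z' - x'"] nrm_diff[of "z - z'" "z - x"] by linarith
  moreover have ww: "w - w' = ((w - y) + (y - y')) - (w' - y')" by simp
  have "nrm (w - w') \<le> max (max (nrm (w - y)) (nrm (y - y'))) (nrm (w' - y'))"
    unfolding ww using nrm_diff[of "(w - y) + (y - y')" "w' - y'"] nrm_add[of "w - y" "y - y'"] by linarith
  ultimately show "nrm (w - w') \<le> nrm (z - z') + e"
    using iso[OF xy(1) xy'(1)] xy xy' e nrm_nonneg[of "z - z'"] by linarith
qed

lemma limit_rel_add:
  assumes G: "partial_hom G" and "limit_rel G z w" "limit_rel G z' w'"
  shows "limit_rel G (z + z') (w + w')"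
proof (rule limit_relI)
  fix e :: real assume e: "e > 0"
  obtain x y where xy: "(x, y) \<in> G" "nrm (z - x) < e" "nrm (w - y) < e" by (rule limit_relE[OF assms(2) e])
  obtain x' y' where xy': "(x', y') \<in> G" "nrm (z' - x') < e" "nrm (w' - y') < e" by (rule limit_relE[OF assms(3) e])
  have close: "nrm ((a + b) - (c + d)) < e" if "nrm (a - c) < e" "nrm (b - d) < e" for a b c d
    using nrm_add[of "a - c" "b - d"] that unfolding add_diff_add by linarith
  show "\<exists>x y. (x, y) \<in> G \<and> nrm (z + z' - x) < e \<and> nrm (w + w' - y) < e"
    using partial_homD(4)[OF G xy(1) xy'(1)] close[OF xy(2) xy'(2)] close[OF xy(3) xy'(3)] by blast
qed

lemma limit_rel_mult:
  assumes G: "partial_hom G" and "limit_rel G z w" "limit_rel G z' w'"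
  shows "limit_rel G (z * z') (w * w')"
proof (rule limit_relI)
  fix e :: real assume e: "e > 0"
  define S where "S = 1 + nrm z + nrm z' + nrm w + nrm w'"
  have S: "S \<ge> 1" "nrm z < S" "nrm z' < S" "nrm w < S" "nrm w' < S"
    using nrm_nonneg[of z] nrm_nonneg[of z'] nrm_nonneg[of w] nrm_nonneg[of w'] by (simp_all add: S_def)
  define d where "d = min 1 (e / S)"
  have d: "d > 0" "d \<le> 1" "d * S \<le> e"
  proof -
    show "d > 0" "d \<le> 1" using e S(1) by (auto simp: d_def)
    have "d * S \<le> e / S * S" using S(1) by (intro mult_right_mono) (auto simp: d_def)
    then show "d * S \<le> e" using S(1) by simp
  qed
  obtain x y where xy: "(x, y) \<in> G" "nrm (z - x) < d" "nrm (w - y) < d" by (rule limit_relE[OF assms(2) d(1)])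
  obtain x' y' where xy': "(x', y') \<in> G" "nrm (z' - x') < d" "nrm (w' - y') < d" by (rule limit_relE[OF assms(3) d(1)])
  have close: "nrm (a * b - a' * b') < e" if a: "nrm (a - a') < d" "nrm (b - b') < d" "nrm a < S" "nrm b < S" "nrm a + 1 \<le> S"
    for a b a' b'
  proof -
    have lt: "nrm h * nrm k < e" if "nrm h < d" "nrm k \<le> S" for h k
    proof -
      have "nrm h * nrm k \<le> nrm h * S" using that nrm_nonneg by (intro mult_left_mono) auto
      also have "\<dots> < d * S" using that S(1) by (intro mult_strict_right_mono) auto
      finally show ?thesis using d(3) by linarith
    qed
    have "a' = a - (a - a')" by simp
    then have "nrm a' \<le> max (nrm a) (nrm (a - a'))" using nrm_diff by metis
    then have "nrm a' \<le> S" using a d(2) nrm_nonneg[of a] by linarith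
    then have 1: "nrm (a' * (b - b')) < e" using lt[OF a(2)] by (simp add: nrm_mult mult.commute)
    have 2: "nrm ((a - a') * b) < e" using lt[OF a(1), of b] a(4) by (simp add: nrm_mult)
    have eq: "a * b - a' * b' = (a - a') * b + a' * (b - b')" by (simp add: algebra_simps)
    show ?thesis unfolding eq using nrm_add[of "(a - a') * b" "a' * (b - b')"] 1 2 by linarith
  qed
  have "nrm (z * z' - x * x') < e"
    using nrm_nonneg[of z'] nrm_nonneg[of w] nrm_nonneg[of w'] by (intro close xy xy' S) (simp add: S_def)
  moreover have "nrm (w * w' - y * y') < e"
    using nrm_nonneg[of z'] nrm_nonneg[of z] nrm_nonneg[of w'] by (intro close xy xy' S) (simp add: S_def)
  ultimately show "\<exists>x y. (x, y) \<in> G \<and> nrm (z * z' - x) < e \<and> nrm (w * w' - y) < e"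
    using partial_homD(5)[OF G xy(1) xy'(1)] by blast
qed

text \<open>
  An embedding of a subfield of \<open>Kbar\<close> is extended to \<open>Kbar\<close> by Zorn's lemma and then to \<open>C\<close> by continuity.
\<close>

lemma extend_to_Gal:
  assumes G0: "partial_hom G0"
  shows "\<exists>\<sigma>\<in>Gal K. (\<forall>(x, y)\<in>G0. \<sigma> x = y) \<and> (\<forall>x y. \<sigma> (x + y) = \<sigma> x + \<sigma> y) \<and>
    (\<forall>x y. \<sigma> (x * y) = \<sigma> x * \<sigma> y) \<and> (\<forall>x. nrm (\<sigma> x) = nrm x) \<and> surj \<sigma>"
proof -
  obtain G where G: "partial_hom G" "G0 \<subseteq> G" "fst ` G = Kbar" "snd ` G = Kbar"
    using extend_partial_hom[OF G0] by blast
  have "\<forall>x\<in>Kbar. \<exists>y. (x, y) \<in> G" using G(3) by force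
  then obtain f where f: "\<And>x. x \<in> Kbar \<Longrightarrow> (x, f x) \<in> G" by metis
  have f_eq: "f x = y" if "(x, y) \<in> G" for x y
    using partial_hom_unique[OF G(1) f that] partial_homD(1)[OF G(1) that] by blast
  have f_nrm: "nrm (f x) = nrm x" if "x \<in> Kbar" for x
  proof (rule hom_on_Kbar_nrm[of f])
    show "f (x + y) = f x + f y" "f (x * y) = f x * f y" if "x \<in> Kbar" "y \<in> Kbar" for x y
      using f_eq[OF partial_homD(4)[OF G(1) f[OF that(1)] f[OF that(2)]]]
        f_eq[OF partial_homD(5)[OF G(1) f[OF that(1)] f[OF that(2)]]] by simp_all
    show "f x = x" if "x \<in> K" for x by (rule f_eq[OF partial_homD(3)[OF G(1) that]])
  qed (rule that)
  have iso: "nrm (y - y') = nrm (x - x')" if "(x, y) \<in> G" "(x', y') \<in> G" for x y x' y'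
    using f_nrm[OF partial_homD(1)[OF G(1) partial_hom_diff[OF G(1) that]]]
      f_eq[OF partial_hom_diff[OF G(1) that]] by simp
  have conv_iso: "nrm (y - y') = nrm (x - x')" if "(x, y) \<in> G\<inverse>" "(x', y') \<in> G\<inverse>" for x y x' y'
    using iso[of y x y' x'] that by simp
  have conv_dom: "fst ` (G\<inverse>) = Kbar" using G(4) by force
  have unique: "w = w'" if "limit_rel G z w" "limit_rel G z w'" for z w w'
    using limit_rel_nrm_le[OF iso that] nrm_nonneg[of "w - w'"] nrm_eq_0[of "w - w'"] by simp
  define \<sigma> where "\<sigma> z = (THE w. limit_rel G z w)" for z
  have \<sigma>: "limit_rel G z (\<sigma> z)" for z
    unfolding \<sigma>_def using limit_rel_exists[OF iso G(3), of z] unique by (blast intro: theI)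
  have \<sigma>_eq: "\<sigma> z = w" if "limit_rel G z w" for z w using unique[OF \<sigma> that] .
  have \<sigma>_G: "\<sigma> x = y" if "(x, y) \<in> G" for x y
    by (rule \<sigma>_eq, rule limit_relI) (use that in force)
  have add: "\<sigma> (x + y) = \<sigma> x + \<sigma> y" for x y by (rule \<sigma>_eq[OF limit_rel_add[OF G(1) \<sigma> \<sigma>]])
  have mult: "\<sigma> (x * y) = \<sigma> x * \<sigma> y" for x y by (rule \<sigma>_eq[OF limit_rel_mult[OF G(1) \<sigma> \<sigma>]])
  have zero: "\<sigma> 0 = 0" by (rule \<sigma>_G[OF partial_homD(3)[OF G(1) is_subringD(1)[OF K_subring]]])
  have dist: "nrm (\<sigma> x - \<sigma> y) = nrm (x - y)" for x y
  proof (rule antisym)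
    show "nrm (\<sigma> x - \<sigma> y) \<le> nrm (x - y)" by (rule limit_rel_nrm_le[OF iso \<sigma> \<sigma>])
    show "nrm (x - y) \<le> nrm (\<sigma> x - \<sigma> y)"
      by (rule limit_rel_nrm_le[of "G\<inverse>", OF conv_iso]) (simp_all add: limit_rel_converse \<sigma>)
  qed
  have surj: "surj \<sigma>"
    unfolding surj_def
  proof
    fix w
    obtain z where "limit_rel (G\<inverse>) w z" using limit_rel_exists[OF conv_iso conv_dom] by blast
    then show "\<exists>z. w = \<sigma> z" using \<sigma>_eq[of z w] by (auto simp: limit_rel_converse)
  qed
  have "\<sigma> \<in> Gal K"
    unfolding Gal_def mem_Collect_eq
  proof (intro conjI ballI allI impI)
    show "bij_betw \<sigma> Kbar Kbar"
      unfolding bij_betw_def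
    proof
      show "inj_on \<sigma> Kbar"
        by (rule inj_onI) (use dist nrm_eq_0 in \<open>metis eq_iff_diff_eq_0\<close>)
      show "\<sigma> ` Kbar = Kbar"
      proof
        show "\<sigma> ` Kbar \<subseteq> Kbar" using \<sigma>_G f partial_homD(2)[OF G(1)] by (metis image_subsetI)
        show "Kbar \<subseteq> \<sigma> ` Kbar"
        proof
          fix y assume "y \<in> Kbar"
          then obtain x where "(x, y) \<in> G" using G(4) by force
          then show "y \<in> \<sigma> ` Kbar" using \<sigma>_G partial_homD(1)[OF G(1)] by blast
        qed
      qed
    qed
    show "\<sigma> x = x" if "x \<in> K" for x by (rule \<sigma>_G[OF partial_homD(3)[OF G(1) that]])
    show "\<exists>d>0. \<forall>y. nrm (y - x) < d \<longrightarrow> nrm (\<sigma> y - \<sigma> x) < e" if "e > 0" for x e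
      using that dist by auto
  qed (rule add mult)+
  moreover have "\<forall>(x, y)\<in>G0. \<sigma> x = y" using \<sigma>_G G(2) by blast
  moreover have "nrm (\<sigma> x) = nrm x" for x using dist[of x 0] zero by simp
  ultimately show ?thesis using add mult surj by blast
qed

end

context tilted_field
begin

text \<open>
  The absolute values of the powers \<open>(pw 1) ^ i\<close> for \<open>i < p\<close> are distinct modulo those of \<open>K\<close>.
\<close>

lemma degree_pw_1:
  assumes q: "q \<in> poly_over K" "q \<noteq> 0" "poly q (pw 1) = 0"
  shows "p \<le> degree q"
proof (rule ccontr)
  assume deg: "\<not> p \<le> degree q"
  have qK: "coeff q i \<in> K" for i using q(1) by (simp add: poly_over_def)
  have nz: "coeff q i * pw 1 ^ i \<noteq> 0 \<longleftrightarrow> coeff q i \<noteq> 0" for i using pw_nonzero by simp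
  have nrm_p: "\<exists>k. nrm (coeff q i * pw 1 ^ i) ^ p = real p powi (k * int p - int i)" if ci: "coeff q i \<noteq> 0" for i
  proof -
    obtain k where "nrm (coeff q i) = real p powi k" using nrm_K[OF qK ci] by blast
    moreover have "(nrm (pw 1) ^ i) ^ p = (nrm (pw 1) ^ p) ^ i" by (simp only: power_mult[symmetric] mult.commute)
    ultimately have "nrm (coeff q i * pw 1 ^ i) ^ p = (real p powi k) ^ p * (1 / p) ^ i"
      using nrm_pw[of 1] by (simp add: nrm_mult power_mult_distrib)
    also have "\<dots> = real p powi (k * int p - int i)"
      by (simp add: power_int_diff power_int_mult power_divide)
    finally show ?thesis by blast
  qed
  have "\<forall>i\<in>{..degree q}. coeff q i * pw 1 ^ i = 0"
  proof (rule nrm_sum_distinct_eq_0)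
    show "(\<Sum>i\<le>degree q. coeff q i * pw 1 ^ i) = 0" using q(3) by (simp add: poly_altdef)
    fix i j assume ij: "i \<in> {..degree q}" "j \<in> {..degree q}"
      and "coeff q i * pw 1 ^ i \<noteq> 0" and eq: "nrm (coeff q i * pw 1 ^ i) = nrm (coeff q j * pw 1 ^ j)"
    then have "coeff q i \<noteq> 0" using nz by blast
    have "coeff q j * pw 1 ^ j \<noteq> 0" using eq \<open>coeff q i * pw 1 ^ i \<noteq> 0\<close> nrm_eq_0 by metis
    then have "coeff q j \<noteq> 0" using nz by blast
    obtain k where k: "nrm (coeff q i * pw 1 ^ i) ^ p = real p powi (k * int p - int i)"
      using nrm_p[OF \<open>coeff q i \<noteq> 0\<close>] by blast
    obtain l where l: "nrm (coeff q j * pw 1 ^ j) ^ p = real p powi (l * int p - int j)"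
      using nrm_p[OF \<open>coeff q j \<noteq> 0\<close>] by blast
    have "real p powi (k * int p - int i) = real p powi (l * int p - int j)" using k l eq by simp
    then have "k * int p - int i = l * int p - int j"
      using power_int_strict_increasing[of _ _ "real p"] p_ge_2 by (metis linorder_neqE less_irrefl of_nat_1 of_nat_less_iff Suc_1 Suc_le_lessD One_nat_def)
    then have "int p dvd int i - int j" by (metis add_diff_cancel_left' diff_add_cancel diff_diff_eq2 dvd_triv_right left_diff_distrib' add.commute)
    moreover have "\<bar>int i - int j\<bar> < int p" using ij deg by auto
    ultimately show "i = j" using dvd_imp_le_int[of "int i - int j" "int p"] by fastforce
  qed simp
  then have "coeff q (degree q) = 0" using nz by blast
  then show False using q(2) by simp
qed

text \<open>
  By \<open>degree_pw_1\<close>, the polynomial \<open>X ^ p - pw 0\<close> has minimal degree among those vanishing at \<open>pw 1\<close>, so \<open>pw 1\<close> can be sent to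
  its root \<open>\<zeta> * pw 1\<close>.
\<close>

lemma exists_Galois_element:
  "\<exists>\<sigma>\<in>GK. \<sigma> (pw 1) \<noteq> pw 1 \<and> (\<forall>x y. \<sigma> (x + y) = \<sigma> x + \<sigma> y) \<and>
    (\<forall>x y. \<sigma> (x * y) = \<sigma> x * \<sigma> y) \<and> (\<forall>x. nrm (\<sigma> x) = nrm x) \<and> surj \<sigma>"
proof -
  obtain \<zeta> where \<zeta>: "\<zeta> \<in> Kbar" "\<zeta> ^ p = 1" "\<zeta> \<noteq> 1" using exists_root_of_unity by blast
  define G where "G = {(x, x) | x. x \<in> K}"
  have G: "partial_hom G"
    unfolding partial_hom_def G_def
    using K_subset_Kbar is_subringD(3,4)[OF K_subring] by auto
  have pairs: "(q, q') \<in> poly_pairs G \<longleftrightarrow> q' = q \<and> q \<in> poly_over K" for q q'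
    by (auto simp: poly_pairs_def G_def poly_over_def poly_eq_iff)
  define g where "g = monom 1 p - [:pw 0:]"
  have cg: "coeff g n = (if n = p then 1 else if n = 0 then - pw 0 else 0)" for n
    by (simp add: g_def coeff_pCons split: nat.split)
  have gK: "g \<in> poly_over K"
    using uniformiser(1) is_subringD(1,2,5)[OF K_subring] by (simp add: poly_over_def cg)
  have deg: "degree g \<le> p" by (rule degree_le) (simp add: cg)
  have g0: "g \<noteq> 0"
  proof
    assume "g = 0"
    then show False using cg[of p] by simp
  qed
  have root: "poly g (pw 1) = 0" using roots(2)[of 0] by (simp add: g_def poly_monom)
  have root': "poly g (\<zeta> * pw 1) = 0" using roots(2)[of 0] \<zeta>(2) by (simp add: g_def poly_monom power_mult_distrib)
  have gg: "(g, g) \<in> poly_pairs G" using gK pairs by blast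
  have min: "degree g \<le> degree q" if "(q, q') \<in> poly_pairs G" "q \<noteq> 0" "poly q (pw 1) = 0" for q q'
    using that pairs degree_pw_1[of q] deg by auto
  have zpw: "\<zeta> * pw 1 \<in> Kbar" by (rule is_subringD(4)[OF Kbar_subring \<zeta>(1) roots(1)])
  have "partial_hom (adjoin G (pw 1) (\<zeta> * pw 1))" "(pw 1, \<zeta> * pw 1) \<in> adjoin G (pw 1) (\<zeta> * pw 1)"
    by (rule partial_hom_adjoin(1)[OF G roots(1) zpw gg g0 root root'], erule (2) min)
      (rule partial_hom_adjoin(3)[OF G roots(1) zpw gg g0 root root'], erule (2) min)
  from extend_to_Gal[OF this(1)] this(2)
  obtain \<sigma> where "\<sigma> \<in> Gal K" "\<sigma> (pw 1) = \<zeta> * pw 1" "\<forall>x y. \<sigma> (x + y) = \<sigma> x + \<sigma> y"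
    "\<forall>x y. \<sigma> (x * y) = \<sigma> x * \<sigma> y" "\<forall>x. nrm (\<sigma> x) = nrm x" "surj \<sigma>"
    by fast
  then show ?thesis
    unfolding GK_def using \<zeta>(3) pw_nonzero[of 1] by (intro bexI[of _ \<sigma>]) auto
qed

end

section \<open>The Galois action on the tilt\<close>

context tilted_field
begin

lemma fraction_tilt:
  obtains a b where "compatible_seq a" "compatible_seq b" "tilt b \<noteq> 0" "z = tilt a / tilt b"
proof -
  obtain x y where xy: "x \<in> carrier tilt_ring" "y \<in> carrier tilt_ring" "\<iota> y \<noteq> 0" "z = \<iota> x / \<iota> y"
    using \<iota>_frac[of z] by blast
  obtain a where a: "compatible_seq a" "x = (\<lambda>n. coset (a n))" using xy(1) unfolding tilt_ring_carrier by blast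
  obtain b where b: "compatible_seq b" "y = (\<lambda>n. coset (b n))" using xy(2) unfolding tilt_ring_carrier by blast
  show ?thesis using that[OF a(1) b(1)] xy a b by (simp add: tilt_def)
qed

context
  fixes \<sigma> :: "'c \<Rightarrow> 'c"
  assumes \<sigma>_add: "\<And>x y. \<sigma> (x + y) = \<sigma> x + \<sigma> y" and \<sigma>_mult: "\<And>x y. \<sigma> (x * y) = \<sigma> x * \<sigma> y"
    and \<sigma>_nrm: "\<And>x. nrm (\<sigma> x) = nrm x" and \<sigma>_surj: "surj \<sigma>"
begin

lemma \<sigma>_diff: "\<sigma> (x - y) = \<sigma> x - \<sigma> y"
  by (rule additive_imp_diff[of \<sigma>, OF \<sigma>_add])

lemma \<sigma>_1: "\<sigma> 1 = 1"
proof -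
  have "\<sigma> 1 * \<sigma> 1 = \<sigma> 1 * 1" using \<sigma>_mult[of 1 1] by simp
  moreover have "\<sigma> 1 \<noteq> 0" using \<sigma>_nrm[of 1] by auto
  ultimately show ?thesis by (metis mult_left_cancel)
qed

lemma \<sigma>_power: "\<sigma> (x ^ n) = \<sigma> x ^ n"
  by (induction n) (auto simp: \<sigma>_1 \<sigma>_mult)

lemma compat_\<sigma>: "compatible_seq a \<Longrightarrow> compatible_seq (\<lambda>n. \<sigma> (a n))"
  using \<sigma>_nrm unfolding compatible_seq_def \<sigma>_power[symmetric] \<sigma>_diff[symmetric] by simp

lemma \<sigma>_coset: "\<sigma> ` coset a = coset (\<sigma> a)"
proof (intro Set.set_eqI iffI)
  fix z assume "z \<in> coset (\<sigma> a)"
  then have z: "nrm (z - \<sigma> a) \<le> 1 / p" by (simp add: coset_eq_ball)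
  obtain x where x: "z = \<sigma> x" using \<sigma>_surj by (auto simp: surj_def)
  have "nrm (x - a) \<le> 1 / p" using z \<sigma>_nrm[of "x - a"] by (simp add: x \<sigma>_diff)
  then show "z \<in> \<sigma> ` coset a" by (simp add: x coset_eq_ball)
next
  fix z assume "z \<in> \<sigma> ` coset a"
  then obtain x where "z = \<sigma> x" "nrm (x - a) \<le> 1 / p" by (auto simp: coset_eq_ball)
  then show "z \<in> coset (\<sigma> a)" using \<sigma>_nrm[of "x - a"] by (simp add: coset_eq_ball \<sigma>_diff)
qed

lemma tilt_\<sigma>_eq_0_iff: "compatible_seq a \<Longrightarrow> tilt (\<lambda>n. \<sigma> (a n)) = 0 \<longleftrightarrow> tilt a = 0"
  by (simp add: tilt_eq_0_iff compat_\<sigma> \<sigma>_nrm)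

lemma tilt_\<sigma>_eq_iff:
  "compatible_seq a \<Longrightarrow> compatible_seq b \<Longrightarrow> tilt (\<lambda>n. \<sigma> (a n)) = tilt (\<lambda>n. \<sigma> (b n)) \<longleftrightarrow> tilt a = tilt b"
  by (simp add: tilt_eq_iff compat_\<sigma> \<sigma>_nrm flip: \<sigma>_diff)

lemma tilt_act_fraction:
  assumes a: "compatible_seq a" and b: "compatible_seq b" "tilt b \<noteq> 0"
  shows "tilt_act \<sigma> (tilt a / tilt b) = tilt (\<lambda>n. \<sigma> (a n)) / tilt (\<lambda>n. \<sigma> (b n))"
  unfolding tilt_act_def
proof (rule the_equality)
  show "\<exists>x\<in>carrier tilt_ring. \<exists>y\<in>carrier tilt_ring. \<iota> y \<noteq> 0 \<and> tilt a / tilt b = \<iota> x / \<iota> y \<and>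
      tilt (\<lambda>n. \<sigma> (a n)) / tilt (\<lambda>n. \<sigma> (b n)) = \<iota> (\<lambda>n. \<sigma> ` x n) / \<iota> (\<lambda>n. \<sigma> ` y n)"
    using tilt_carrier[OF a] tilt_carrier[OF b(1)] b(2)
    by (intro bexI[of _ "\<lambda>n. coset (a n)"] bexI[of _ "\<lambda>n. coset (b n)"])
      (simp_all add: tilt_def \<sigma>_coset)
next
  fix w
  assume "\<exists>x\<in>carrier tilt_ring. \<exists>y\<in>carrier tilt_ring. \<iota> y \<noteq> 0 \<and> tilt a / tilt b = \<iota> x / \<iota> y \<and>
      w = \<iota> (\<lambda>n. \<sigma> ` x n) / \<iota> (\<lambda>n. \<sigma> ` y n)"
  then obtain x y where xy: "x \<in> carrier tilt_ring" "y \<in> carrier tilt_ring" "\<iota> y \<noteq> 0"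
    "tilt a / tilt b = \<iota> x / \<iota> y" "w = \<iota> (\<lambda>n. \<sigma> ` x n) / \<iota> (\<lambda>n. \<sigma> ` y n)" by blast
  obtain a' where a': "compatible_seq a'" "x = (\<lambda>n. coset (a' n))" using xy(1) unfolding tilt_ring_carrier by blast
  obtain b' where b': "compatible_seq b'" "y = (\<lambda>n. coset (b' n))" using xy(2) unfolding tilt_ring_carrier by blast
  have nz: "tilt b' \<noteq> 0" using xy(3) by (simp add: b' tilt_def)
  have w: "w = tilt (\<lambda>n. \<sigma> (a' n)) / tilt (\<lambda>n. \<sigma> (b' n))"
    unfolding xy(5) a'(2) b'(2) by (simp add: tilt_def \<sigma>_coset)
  have "tilt a / tilt b = tilt a' / tilt b'" using xy(4) by (simp add: a' b' tilt_def)
  then have "tilt a * tilt b' = tilt a' * tilt b" using nz b(2) by (simp add: frac_eq_eq)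
  then have "tilt (\<lambda>n. a n * b' n) = tilt (\<lambda>n. a' n * b n)" using a b a' b' by (simp add: tilt_mult)
  then have "tilt (\<lambda>n. \<sigma> (a n * b' n)) = tilt (\<lambda>n. \<sigma> (a' n * b n))"
    using tilt_\<sigma>_eq_iff[OF compat_mult[OF a b'(1)] compat_mult[OF a'(1) b(1)]] by simp
  then have "tilt (\<lambda>n. \<sigma> (a n)) * tilt (\<lambda>n. \<sigma> (b' n)) = tilt (\<lambda>n. \<sigma> (a' n)) * tilt (\<lambda>n. \<sigma> (b n))"
    using a b a' b' by (simp add: \<sigma>_mult tilt_mult compat_\<sigma>)
  moreover have "tilt (\<lambda>n. \<sigma> (b n)) \<noteq> 0" "tilt (\<lambda>n. \<sigma> (b' n)) \<noteq> 0"
    using b nz b'(1) by (simp_all add: tilt_\<sigma>_eq_0_iff)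
  ultimately show "w = tilt (\<lambda>n. \<sigma> (a n)) / tilt (\<lambda>n. \<sigma> (b n))"
    unfolding w by (simp add: frac_eq_eq)
qed

lemma tilt_act_tilt: "compatible_seq a \<Longrightarrow> tilt_act \<sigma> (tilt a) = tilt (\<lambda>n. \<sigma> (a n))"
  using tilt_act_fraction[of a "\<lambda>_. 1"] by (simp add: compat_const tilt_1 \<sigma>_1)

lemma tilt_act_mult: "tilt_act \<sigma> (x * y) = tilt_act \<sigma> x * tilt_act \<sigma> y"
proof -
  obtain a b where ab: "compatible_seq a" "compatible_seq b" "tilt b \<noteq> 0" "x = tilt a / tilt b" by (rule fraction_tilt)
  obtain c d where cd: "compatible_seq c" "compatible_seq d" "tilt d \<noteq> 0" "y = tilt c / tilt d" by (rule fraction_tilt)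
  have xy: "x * y = tilt (\<lambda>n. a n * c n) / tilt (\<lambda>n. b n * d n)" using ab cd by (simp add: tilt_mult)
  have nz: "tilt (\<lambda>n. b n * d n) \<noteq> 0" using ab cd by (simp add: tilt_mult)
  show ?thesis
    unfolding xy tilt_act_fraction[OF compat_mult[OF ab(1) cd(1)] compat_mult[OF ab(2) cd(2)] nz]
    using ab cd by (simp add: tilt_act_fraction \<sigma>_mult tilt_mult compat_\<sigma>)
qed

lemma tilt_act_add: "tilt_act \<sigma> (x + y) = tilt_act \<sigma> x + tilt_act \<sigma> y"
proof -
  obtain a b where ab: "compatible_seq a" "compatible_seq b" "tilt b \<noteq> 0" "x = tilt a / tilt b" by (rule fraction_tilt)
  obtain c d where cd: "compatible_seq c" "compatible_seq d" "tilt d \<noteq> 0" "y = tilt c / tilt d" by (rule fraction_tilt)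
  have num: "compatible_seq (\<lambda>n. a n * d n + c n * b n)" using ab cd by (intro compat_add compat_mult)
  have xy: "x + y = tilt (\<lambda>n. a n * d n + c n * b n) / tilt (\<lambda>n. b n * d n)"
    using ab cd by (simp add: tilt_mult tilt_add compat_mult add_frac_eq)
  have nz: "tilt (\<lambda>n. b n * d n) \<noteq> 0" using ab cd by (simp add: tilt_mult)
  have nz': "tilt (\<lambda>n. \<sigma> (b n)) \<noteq> 0" "tilt (\<lambda>n. \<sigma> (d n)) \<noteq> 0" using ab cd by (simp_all add: tilt_\<sigma>_eq_0_iff)
  show ?thesis
    unfolding xy tilt_act_fraction[OF num compat_mult[OF ab(2) cd(2)] nz]
    using ab cd nz' by (simp add: tilt_act_fraction \<sigma>_mult \<sigma>_add tilt_mult tilt_add compat_mult compat_\<sigma> add_frac_eq)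
qed

end

lemma exists_epsilon:
  "\<exists>\<sigma>\<in>GK. \<exists>\<epsilon>\<in>u_pow_O 0. (\<forall>x y. tilt_act \<sigma> (x + y) = tilt_act \<sigma> x + tilt_act \<sigma> y) \<and>
    (\<forall>x y. tilt_act \<sigma> (x * y) = tilt_act \<sigma> x * tilt_act \<sigma> y) \<and>
    tilt_act \<sigma> u = \<epsilon> * u \<and> \<epsilon> \<noteq> 1 \<and> vb (\<epsilon> - 1) = real p / (real p - 1)"
proof -
  obtain \<sigma> where \<sigma>: "\<sigma> \<in> GK" "\<sigma> (pw 1) \<noteq> pw 1" "\<And>x y. \<sigma> (x + y) = \<sigma> x + \<sigma> y"
    "\<And>x y. \<sigma> (x * y) = \<sigma> x * \<sigma> y" "\<And>x. nrm (\<sigma> x) = nrm x" "surj \<sigma>"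
    using exists_Galois_element by blast
  define s where "s n = \<sigma> (pw n) / pw n" for n
  have s0: "s 0 = 1" using \<sigma>(1) uniformiser(1) pw_nonzero[of 0] by (simp add: s_def GK_def Gal_def)
  have s1: "s 1 \<noteq> 1" using \<sigma>(2) pw_nonzero[of 1] by (simp add: s_def)
  have s: "s (Suc n) ^ p = s n" for n
    by (simp add: s_def power_divide roots(2) flip: \<sigma>_power[OF \<sigma>(3-6)])
  note eps = vb_epsilon_minus_1[OF s0 s1 s]
  have "tilt_act \<sigma> u = tilt (\<lambda>n. \<sigma> (pw n))"
    unfolding u_eq_tilt by (rule tilt_act_tilt[OF \<sigma>(3-6) compatible_pw])
  also have "(\<lambda>n. \<sigma> (pw n)) = (\<lambda>n. s n * pw n)" using pw_nonzero by (simp add: s_def)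
  also have "tilt (\<lambda>n. s n * pw n) = tilt s * u"
    unfolding u_eq_tilt by (rule tilt_mult[OF eps(1) compatible_pw])
  finally have "tilt_act \<sigma> u = tilt s * u" .
  moreover have "tilt s \<in> u_pow_O 0" using eps(1) O_iff_tilt by blast
  ultimately show ?thesis
    using \<sigma>(1) tilt_act_add[OF \<sigma>(3-6)] tilt_act_mult[OF \<sigma>(3-6)] eps(2,3) by blast
qed

end

section \<open>Power series over the residue field\<close>

context tilted_field
begin

text \<open>
  Changing the components of a compatible sequence modulo \<open>p\<close> leaves it compatible, so the components can be
  represented in \<open>K\<close> all at once.
\<close>

lemma kres_iff: "z \<in> kres \<longleftrightarrow> (\<exists>a. compatible_seq a \<and> (\<forall>n. a n \<in> K) \<and> z = tilt a)"
proof
  assume "z \<in> kres"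
  then obtain x where x: "x \<in> carrier tilt_ring" "\<And>n. \<exists>a\<in>K. nrm a \<le> 1 \<and> x n = coset a" "z = \<iota> x"
    by (auto simp: kres_def)
  then obtain b where b: "\<And>n. b n \<in> K" "\<And>n. nrm (b n) \<le> 1" "\<And>n. x n = coset (b n)" by metis
  obtain a where a: "compatible_seq a" "x = (\<lambda>n. coset (a n))" using x(1) unfolding tilt_ring_carrier by blast
  have ab: "nrm (a n - b n) \<le> 1 / p" for n
    using b(3)[of n] a(2) by (simp add: coset_eq_iff[symmetric])
  have "compatible_seq b"
    unfolding compatible_seq_def
  proof (intro allI conjI)
    fix n
    let ?h = "nrm (a (Suc n) - b (Suc n))"
    have h: "?h \<le> 1 / p" "?h \<le> 1" "0 \<le> ?h"
      using ab[of "Suc n"] inv_p_less_1 nrm_nonneg by (auto simp del: p_pos intro: order.trans less_imp_le)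
    have "nrm (a (Suc n) ^ p - b (Suc n) ^ p) \<le> max (?h / p) (?h ^ p)"
      by (rule nrm_power_p_diff[OF compatD(1)[OF a(1)] b(2)])
    also have "\<dots> \<le> 1 / p"
    proof -
      have "?h ^ p \<le> ?h ^ 1" using h by (intro power_decreasing) (use p_ge_2 in auto)
      moreover have "?h / p \<le> 1 / p" using h by (intro divide_right_mono) auto
      ultimately show ?thesis using h by simp
    qed
    finally have 1: "nrm (b (Suc n) ^ p - a (Suc n) ^ p) \<le> 1 / p" by (simp add: nrm_minus_commute)
    from nrm_trans[OF nrm_trans[OF 1 compatD(2)[OF a(1)]] ab]
    show "nrm (b (Suc n) ^ p - b n) \<le> 1 / p" .
  qed (rule b(2))
  moreover have "x = (\<lambda>n. coset (b n))" using b(3) by (rule ext)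
  then have "z = tilt b" using x(3) by (simp add: tilt_def)
  ultimately show "\<exists>a. compatible_seq a \<and> (\<forall>n. a n \<in> K) \<and> z = tilt a" using b(1) by blast
next
  assume "\<exists>a. compatible_seq a \<and> (\<forall>n. a n \<in> K) \<and> z = tilt a"
  then obtain a where "compatible_seq a" "\<And>n. a n \<in> K" "z = tilt a" by blast
  then show "z \<in> kres"
    unfolding kres_def tilt_def using tilt_carrier compatD(1) by blast
qed

lemma kres_subset_O: "z \<in> kres \<Longrightarrow> z \<in> u_pow_O 0"
  using O_iff_tilt kres_iff by blast

lemma kres_subring: "is_subring kres"
  unfolding is_subring_def
proof (intro conjI ballI)
  show "0 \<in> kres" unfolding kres_iff
    by (rule exI[of _ "\<lambda>_. 0"]) (simp add: compat_const tilt_0 is_subringD(1)[OF K_subring])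
  show "1 \<in> kres" unfolding kres_iff
    by (rule exI[of _ "\<lambda>_. 1"]) (simp add: compat_const tilt_1 is_subringD(2)[OF K_subring])
  fix x y assume "x \<in> kres" "y \<in> kres"
  then obtain a b where a: "compatible_seq a" "\<And>n. a n \<in> K" "x = tilt a"
    and b: "compatible_seq b" "\<And>n. b n \<in> K" "y = tilt b"
    unfolding kres_iff by blast
  show "x + y \<in> kres" unfolding kres_iff
    by (rule exI[of _ "\<lambda>n. a n + b n"]) (simp add: a b compat_add tilt_add is_subringD(3)[OF K_subring])
  show "x * y \<in> kres" unfolding kres_iff
    by (rule exI[of _ "\<lambda>n. a n * b n"]) (simp add: a b compat_mult tilt_mult is_subringD(4)[OF K_subring])
  have "x + tilt (\<lambda>n. - a n) = 0"
    using tilt_add[OF a(1) compat_minus[OF a(1)]] by (simp add: a(3) tilt_0)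
  then have "- x = tilt (\<lambda>n. - a n)" by (rule minus_unique)
  then show "- x \<in> kres" unfolding kres_iff
    by (intro exI[of _ "\<lambda>n. - a n"]) (simp add: a compat_minus is_subringD(5)[OF K_subring])
qed

text \<open>
  A nonzero element of the residue field has a component of absolute value larger than \<open>1 / p\<close>, hence
  equal to \<open>1\<close> as \<open>K\<close> is unramified, and then all its components have absolute value \<open>1\<close>.
\<close>

lemma kres_unit:
  assumes z: "z \<in> kres" "z \<noteq> 0"
  shows "vb z = 0" "inverse z \<in> kres"
proof -
  obtain a where a: "compatible_seq a" "\<And>n. a n \<in> K" "z = tilt a" using z(1) unfolding kres_iff by blast
  obtain n where n: "\<not> nrm (a n) \<le> 1 / p" using z(2) a tilt_eq_0_iff[OF a(1)] by blast
  have "nrm (a n) = 1"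
    using nrm_K_less_1[OF a(2)[of n]] n compatD(1)[OF a(1), of n] by linarith
  then have "nrm (a n ^ p ^ n) = 1" by simp
  moreover have "nrm (a n ^ p ^ n - a 0) < 1"
    using le_less_trans[OF compat_iterate[OF a(1), of 0 n] inv_p_less_1] by simp
  ultimately have a0: "nrm (a 0) = 1" using nrm_eqI[of "a n ^ p ^ n" "a 0"] by simp
  have am: "nrm (a m) = 1" for m
  proof -
    have "nrm (a 0 - a m ^ p ^ m) < 1"
      using le_less_trans[OF compat_iterate[OF a(1), of 0 m] inv_p_less_1] by (simp add: nrm_minus_commute)
    then have "nrm (a m ^ p ^ m) = 1" using nrm_eqI[of "a 0" "a m ^ p ^ m"] a0 by simp
    then show ?thesis
      using power_eq_imp_eq_base[of "nrm (a m)" "p ^ m" 1] nrm_nonneg by simp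
  qed
  have am0: "a m \<noteq> 0" for m using am[of m] by auto
  define b where "b m = inverse (a m)" for m
  have cb: "compatible_seq b"
    unfolding compatible_seq_def
  proof (intro allI conjI)
    fix m
    show "nrm (b m) \<le> 1" by (simp add: b_def nrm_inverse am)
    have "b (Suc m) ^ p - b m = (a m - a (Suc m) ^ p) / (a m * a (Suc m) ^ p)"
      using am0 by (simp add: b_def field_simps)
    then show "nrm (b (Suc m) ^ p - b m) \<le> 1 / p"
      using compatD(2)[OF a(1), of m] by (simp add: nrm_divide nrm_mult am nrm_minus_commute)
  qed
  have "z * tilt b = 1"
    using tilt_mult[OF a(1) cb] am0 by (simp add: b_def a(3) tilt_1)
  then have inv: "inverse z = tilt b" by (rule inverse_unique)
  have "b m \<in> K" for m unfolding b_def by (rule subfield_typeD(6)[OF K_subfield a(2)])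
  then show "inverse z \<in> kres" unfolding kres_iff inv using cb by blast
  have "tilt b \<noteq> 0" using \<open>z * tilt b = 1\<close> by auto
  then have "vb z + vb (tilt b) = 0"
    using vb_mult[OF z(2), of "tilt b"] \<open>z * tilt b = 1\<close> by simp
  moreover have "vb z \<ge> 0" using kres_subset_O[OF z(1)] z(2) by (simp add: u_pow_O_def)
  moreover have "vb (tilt b) \<ge> 0"
    using O_iff_tilt[of "tilt b"] cb \<open>tilt b \<noteq> 0\<close> by (auto simp: u_pow_O_def)
  ultimately show "vb z = 0" by simp
qed

lemma kres_perfect:
  assumes "z \<in> kres" shows "\<exists>w\<in>kres. w ^ p = z"
proof -
  obtain a where a: "compatible_seq a" "\<And>n. a n \<in> K" "z = tilt a" using assms unfolding kres_iff by blast
  have "tilt (\<lambda>n. a (n + 1)) ^ p = z" using tilt_shift[OF a(1), of 1] a(3) by simp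
  moreover have "tilt (\<lambda>n. a (n + 1)) \<in> kres"
    unfolding kres_iff using compat_shift[OF a(1), of 1] a(2) by blast
  ultimately show ?thesis by blast
qed

lemma kres_power_p: "z \<in> kres \<Longrightarrow> z ^ p \<in> kres"
  by (rule is_subring_power[OF kres_subring])

definition expansion :: "'d \<Rightarrow> 'd \<Rightarrow> (nat \<Rightarrow> 'd) \<Rightarrow> bool"
  where "expansion t z a \<longleftrightarrow> (\<forall>n. z - (\<Sum>i<n. a i * t ^ i) \<in> u_pow_O (n * vb t))"

lemma expansionD: "expansion t z a \<Longrightarrow> z - (\<Sum>i<n. a i * t ^ i) \<in> u_pow_O (n * vb t)"
  by (simp add: expansion_def)

lemma power_series_iff:
  assumes "t \<noteq> 0"
  shows "z \<in> power_series t \<longleftrightarrow> (\<exists>a. (\<forall>i. a i \<in> kres) \<and> expansion t z a)"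
proof -
  have "(\<exists>y\<in>u_pow_O 0. x = t ^ n * y) \<longleftrightarrow> x \<in> u_pow_O (n * vb t)" for x n
  proof
    assume "\<exists>y\<in>u_pow_O 0. x = t ^ n * y"
    then show "x \<in> u_pow_O (n * vb t)"
    proof
      fix y assume y: "y \<in> u_pow_O 0" "x = t ^ n * y"
      have "t ^ n \<in> u_pow_O (n * vb t)" using assms by (simp add: u_pow_O_def vb_power)
      from u_pow_O_mult[OF this y(1)] show ?thesis by (simp add: y(2))
    qed
  next
    assume x: "x \<in> u_pow_O (n * vb t)"
    have "x / t ^ n \<in> u_pow_O 0"
      using x assms by (cases "x = 0") (auto simp: u_pow_O_def vb_divide vb_power)
    moreover have "x = t ^ n * (x / t ^ n)" using assms by simp
    ultimately show "\<exists>y\<in>u_pow_O 0. x = t ^ n * y" by blast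
  qed
  then show ?thesis by (simp add: power_series_def expansion_def)
qed

lemma kuu_iff: "z \<in> kuu \<longleftrightarrow> (\<exists>a. (\<forall>i. a i \<in> kres) \<and> expansion u z a)"
  unfolding kuu_def by (rule power_series_iff[OF u_nonzero])

lemma u_pow_O_all_imp_0:
  assumes "\<And>n::nat. x \<in> u_pow_O (n * r)" "r > 0" shows "x = 0"
proof (rule ccontr)
  assume x: "x \<noteq> 0"
  obtain n :: nat where "vb x < n * r" using reals_Archimedean3[OF assms(2)] by blast
  then show False using assms(1)[of n] x by (simp add: u_pow_O_def)
qed

lemma expansion_unique:
  assumes "expansion t z a" "expansion t w a" "vb t > 0"
  shows "z = w"
proof -
  have "z - w \<in> u_pow_O (n * vb t)" for n :: nat
    using u_pow_O_diff[OF expansionD[OF assms(1), of n] expansionD[OF assms(2), of n]] by simp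
  then show ?thesis using u_pow_O_all_imp_0[of "z - w" "vb t"] assms(3) by simp
qed

lemma partial_sum_in_O:
  assumes "\<And>i. a i \<in> kres"
  shows "(\<Sum>i<n. a i * u ^ i) \<in> u_pow_O 0"
proof (rule u_pow_O_sum)
  fix i
  have "u ^ i \<in> u_pow_O 0" by (rule u_pow_O_mono[OF u_in_O]) simp
  then show "a i * u ^ i \<in> u_pow_O 0" by (rule u_pow_O_mult_left[OF kres_subset_O[OF assms]])
qed

lemma expansion_in_O: "expansion u z a \<Longrightarrow> z \<in> u_pow_O 0"
  using expansionD[of u z a 0] by simp

lemma expansion_add:
  assumes "expansion t z a" "expansion t w b" shows "expansion t (z + w) (\<lambda>i. a i + b i)"
  unfolding expansion_def
proof
  fix n :: nat
  show "z + w - (\<Sum>i<n. (a i + b i) * t ^ i) \<in> u_pow_O (n * vb t)"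
    using u_pow_O_add[OF expansionD[OF assms(1), of n] expansionD[OF assms(2), of n]]
    by (simp add: distrib_right sum.distrib algebra_simps)
qed

lemma expansion_minus: "expansion t z a \<Longrightarrow> expansion t (- z) (\<lambda>i. - a i)"
  unfolding expansion_def
proof
  fix n :: nat assume a: "\<forall>n. z - (\<Sum>i<n. a i * t ^ i) \<in> u_pow_O (n * vb t)"
  show "- z - (\<Sum>i<n. - a i * t ^ i) \<in> u_pow_O (n * vb t)"
    using u_pow_O_minus[OF a[rule_format, of n]] by (simp add: sum_negf)
qed

lemma expansion_const: "c \<in> kres \<Longrightarrow> expansion u c (\<lambda>i. if i = 0 then c else 0)"
  unfolding expansion_def
proof
  fix n :: nat assume "c \<in> kres"
  then show "c - (\<Sum>i<n. (if i = 0 then c else 0) * u ^ i) \<in> u_pow_O (n * vb u)"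
    using kres_subset_O[of c] by (cases n) (simp_all add: sum.lessThan_Suc_shift del: sum.lessThan_Suc)
qed

lemma truncated_product:
  assumes a: "\<And>i. a i \<in> kres" and b: "\<And>i. b i \<in> kres"
  shows "(\<Sum>i<n. a i * u ^ i) * (\<Sum>j<n. b j * u ^ j) - (\<Sum>k<n. (\<Sum>i\<le>k. a i * b (k - i)) * u ^ k) \<in> u_pow_O n"
proof -
  let ?f = "\<lambda>i j. a i * b j * u ^ (i + j)"
  have "(\<Sum>i<n. a i * u ^ i) * (\<Sum>j<n. b j * u ^ j) = (\<Sum>i<n. \<Sum>j<n. ?f i j)"
    by (simp add: sum_product power_add mult_ac)
  also have "\<dots> = (\<Sum>(i, j)\<in>{..<n} \<times> {..<n}. ?f i j)" by (rule sum.cartesian_product)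
  also have "{..<n} \<times> {..<n} = {(i, j). i + j < n} \<union> {(i, j). i < n \<and> j < n \<and> n \<le> i + j}" by auto
  also have "(\<Sum>(i, j)\<in>\<dots>. ?f i j) = (\<Sum>(i, j)\<in>{(i, j). i + j < n}. ?f i j) +
      (\<Sum>(i, j)\<in>{(i, j). i < n \<and> j < n \<and> n \<le> i + j}. ?f i j)"
  proof (rule sum.union_disjoint)
    show "finite {(i, j). i + j < n}"
      by (rule finite_subset[of _ "{..<n} \<times> {..<n}"]) auto
    show "finite {(i, j). i < n \<and> j < n \<and> n \<le> i + j}"
      by (rule finite_subset[of _ "{..<n} \<times> {..<n}"]) auto
  qed auto
  also have "(\<Sum>(i, j)\<in>{(i, j). i + j < n}. ?f i j) = (\<Sum>k<n. \<Sum>i\<le>k. ?f i (k - i))"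
    by (rule sum.triangle_reindex)
  also have "\<dots> = (\<Sum>k<n. (\<Sum>i\<le>k. a i * b (k - i)) * u ^ k)"
    by (simp add: sum_distrib_right)
  finally have "(\<Sum>i<n. a i * u ^ i) * (\<Sum>j<n. b j * u ^ j) - (\<Sum>k<n. (\<Sum>i\<le>k. a i * b (k - i)) * u ^ k) =
      (\<Sum>(i, j)\<in>{(i, j). i < n \<and> j < n \<and> n \<le> i + j}. ?f i j)" by simp
  also have "\<dots> \<in> u_pow_O n"
  proof (rule u_pow_O_sum)
    fix z assume "z \<in> {(i, j). i < n \<and> j < n \<and> n \<le> i + j}"
    then obtain i j where z: "z = (i, j)" "n \<le> i + j" by auto
    have "u ^ (i + j) \<in> u_pow_O n" by (rule u_pow_O_mono[OF u_in_O]) (use z in simp)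
    then show "(case z of (i, j) \<Rightarrow> ?f i j) \<in> u_pow_O n"
      unfolding z(1) prod.case by (intro u_pow_O_mult_left kres_subset_O a b)
  qed
  finally show ?thesis .
qed

lemma expansion_mult:
  assumes a: "\<And>i. a i \<in> kres" "expansion u z a" and b: "\<And>i. b i \<in> kres" "expansion u w b"
  shows "expansion u (z * w) (\<lambda>k. \<Sum>i\<le>k. a i * b (k - i))"
  unfolding expansion_def
proof
  fix n
  let ?A = "\<Sum>i<n. a i * u ^ i" and ?B = "\<Sum>i<n. b i * u ^ i"
  let ?C = "\<Sum>k<n. (\<Sum>i\<le>k. a i * b (k - i)) * u ^ k"
  have "z * w - ?C = w * (z - ?A) + ?A * (w - ?B) + (?A * ?B - ?C)"
    by (simp add: algebra_simps)
  moreover have "w * (z - ?A) \<in> u_pow_O n" "?A * (w - ?B) \<in> u_pow_O n"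
    using expansionD[OF a(2), of n] expansionD[OF b(2), of n]
    by (auto intro!: u_pow_O_mult_left expansion_in_O[OF b(2)] partial_sum_in_O a(1))
  ultimately show "z * w - ?C \<in> u_pow_O (n * vb u)"
    using u_pow_O_add[OF u_pow_O_add truncated_product[of a b n, OF a(1) b(1)], of "w * (z - ?A)" "?A * (w - ?B)"]
    by (simp only: vb_u mult_1_right)
qed

lemma kres_subset_kuu: "c \<in> kres \<Longrightarrow> c \<in> kuu"
  unfolding kuu_iff using expansion_const[of c] is_subringD(1)[OF kres_subring]
  by (intro exI[of _ "\<lambda>i. if i = 0 then c else 0"]) simp

lemma kuu_subring: "is_subring kuu"
  unfolding is_subring_def
proof (intro conjI ballI)
  show "0 \<in> kuu" "1 \<in> kuu"
    by (rule kres_subset_kuu[OF is_subringD(1)[OF kres_subring]], rule kres_subset_kuu[OF is_subringD(2)[OF kres_subring]])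
  fix x y assume "x \<in> kuu" "y \<in> kuu"
  then obtain a b where a: "\<And>i. a i \<in> kres" "expansion u x a" and b: "\<And>i. b i \<in> kres" "expansion u y b"
    unfolding kuu_iff by blast
  have "a i + b i \<in> kres" for i using a b is_subringD(3)[OF kres_subring] by blast
  then show "x + y \<in> kuu"
    unfolding kuu_iff using expansion_add[OF a(2) b(2)] by (intro exI[of _ "\<lambda>i. a i + b i"]) simp
  have "(\<Sum>i\<le>k. a i * b (k - i)) \<in> kres" for k
    by (intro is_subring_sum[OF kres_subring] is_subringD(4)[OF kres_subring] a b)
  then show "x * y \<in> kuu"
    unfolding kuu_iff using expansion_mult[OF a b] by (intro exI[of _ "\<lambda>k. \<Sum>i\<le>k. a i * b (k - i)"]) simp
  have "- a i \<in> kres" for i using a is_subringD(5)[OF kres_subring] by blast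
  then show "- x \<in> kuu"
    unfolding kuu_iff using expansion_minus[OF a(2)] by (intro exI[of _ "\<lambda>i. - a i"]) simp
qed

lemma kuu_subset_O: "z \<in> kuu \<Longrightarrow> z \<in> u_pow_O 0"
  unfolding kuu_iff using expansion_in_O by blast

lemma u_in_kuu: "u \<in> kuu"
  unfolding kuu_iff
proof (intro exI conjI allI)
  show "(if i = 1 then 1 else 0) \<in> kres" for i :: nat using is_subringD(1,2)[OF kres_subring] by simp
  show "expansion u u (\<lambda>i. if i = 1 then 1 else 0)"
    unfolding expansion_def
  proof
    fix n :: nat
    have "(\<Sum>i<n. (if i = 1 then 1 else 0) * u ^ i) = (if 1 < n then u else 0)"
      by (simp add: if_distrib[of "\<lambda>c. c * _"] sum.delta cong: if_cong)
    moreover have "u \<in> u_pow_O 1" using u_in_O[of 1] by simp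
    ultimately show "u - (\<Sum>i<n. (if i = 1 then 1 else 0) * u ^ i) \<in> u_pow_O (n * vb u)"
      by (auto intro: u_pow_O_mono)
  qed
qed

lemma expansion_unit:
  assumes a: "\<And>i. a i \<in> kres" "expansion u z a" "a 0 \<noteq> 0"
  shows "z \<noteq> 0" "vb z = 0"
proof -
  have d: "z - a 0 \<in> u_pow_O 1" using expansionD[OF a(2), of 1] by simp
  have a0: "vb (a 0) = 0" by (rule kres_unit(1)[OF a(1) a(3)])
  have not1: "a 0 \<notin> u_pow_O r" if "r > 0" for r using a0 a(3) that by (simp add: u_pow_O_def)
  show z: "z \<noteq> 0"
  proof
    assume "z = 0"
    then show False using u_pow_O_minus[OF d] not1[of 1] by simp
  qed
  have "vb z \<ge> 0" using expansion_in_O[OF a(2)] z by (simp add: u_pow_O_def)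
  moreover have "\<not> vb z > 0"
  proof
    assume v: "vb z > 0"
    define r where "r = min (vb z) 1"
    have "r > 0" using v by (simp add: r_def)
    have "z \<in> u_pow_O r" by (simp add: u_pow_O_def r_def)
    moreover have "z - a 0 \<in> u_pow_O r" by (rule u_pow_O_mono[OF d]) (simp add: r_def)
    ultimately have "z - (z - a 0) \<in> u_pow_O r" by (rule u_pow_O_diff)
    then show False using not1[OF \<open>r > 0\<close>] by simp
  qed
  ultimately show "vb z = 0" by simp
qed

text \<open>
  The coefficients of the inverse power series are computed recursively and stay in the field \<open>k\<close>.
\<close>

lemma fps_inverse_kres:
  fixes a :: "nat \<Rightarrow> 'd"
  assumes a: "\<And>i. a i \<in> kres" "a 0 \<noteq> 0"
  obtains b where "\<And>i. b i \<in> kres" "\<And>k. (\<Sum>i\<le>k. a i * b (k - i)) = (if k = 0 then 1 else 0)"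
proof -
  define b where "b = fps_nth (inverse (Abs_fps a))"
  have "Abs_fps a * inverse (Abs_fps a) = 1" using a(2) by (simp add: inverse_mult_eq_1')
  then have sum: "(\<Sum>i\<le>k. a i * b (k - i)) = (if k = 0 then 1 else 0)" for k
    using fps_mult_nth[of "Abs_fps a" "inverse (Abs_fps a)" k] by (simp add: b_def atLeast0AtMost)
  have ia: "inverse (a 0) \<in> kres" by (rule kres_unit(2)[OF a])
  have "b k \<in> kres" for k
  proof (induction k rule: less_induct)
    case (less k)
    have "(\<Sum>i\<le>k. a i * b (k - i)) = a 0 * b k + (\<Sum>i=1..k. a i * b (k - i))"
      by (simp add: atMost_atLeast0 sum.atLeast_Suc_atMost)
    then have "a 0 * b k = (if k = 0 then 1 else 0) - (\<Sum>i=1..k. a i * b (k - i))"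
      using sum[of k] by (simp add: algebra_simps)
    then have "b k = inverse (a 0) * ((if k = 0 then 1 else 0) - (\<Sum>i=1..k. a i * b (k - i)))"
      using a(2) by (metis (no_types, lifting) mult.assoc left_inverse mult_1)
    also have "\<dots> \<in> kres"
      by (intro is_subringD(4,6)[OF kres_subring] ia is_subring_sum[OF kres_subring] a(1) less)
        (auto simp: is_subringD(1,2)[OF kres_subring])
    finally show ?case .
  qed
  then show ?thesis using that sum by blast
qed

lemma kuu_unit_inverse:
  assumes a: "\<And>i. a i \<in> kres" "expansion u z a" "a 0 \<noteq> 0"
  shows "inverse z \<in> kuu"
proof -
  obtain b where b: "\<And>i. b i \<in> kres" "\<And>k. (\<Sum>i\<le>k. a i * b (k - i)) = (if k = 0 then 1 else 0)"
    using fps_inverse_kres[of a, OF a(1,3)] by blast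
  note z = expansion_unit[OF a]
  have iz: "inverse z \<in> u_pow_O 0" using z by (simp add: u_pow_O_def vb_divide inverse_eq_divide)
  have "expansion u (inverse z) b"
    unfolding expansion_def
  proof
    fix n :: nat
    let ?A = "\<Sum>i<n. a i * u ^ i" and ?B = "\<Sum>i<n. b i * u ^ i"
    show "inverse z - ?B \<in> u_pow_O (n * vb u)"
    proof (cases "n = 0")
      case True
      then show ?thesis using iz by simp
    next
      case False
      have "(\<Sum>k<n. (\<Sum>i\<le>k. a i * b (k - i)) * u ^ k) = 1"
        using False unfolding b(2) by (simp add: if_distrib[of "\<lambda>c. c * _"] cong: if_cong)
      then have AB: "?A * ?B - 1 \<in> u_pow_O n" using truncated_product[of a b n, OF a(1) b(1)] by simp
      have BA: "?B * (z - ?A) \<in> u_pow_O n"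
        using expansionD[OF a(2), of n] by (auto intro!: u_pow_O_mult_left partial_sum_in_O b(1))
      have "inverse z * (- ((?A * ?B - 1) + ?B * (z - ?A))) \<in> u_pow_O n"
        by (intro u_pow_O_mult_left[OF iz] u_pow_O_minus u_pow_O_add AB BA)
      moreover have "- ((?A * ?B - 1) + ?B * (z - ?A)) = 1 - z * ?B" by (simp add: algebra_simps)
      moreover have "inverse z * (1 - z * ?B) = inverse z - ?B" using z(1) by (simp add: right_diff_distrib)
      ultimately show ?thesis by (simp only: vb_u mult_1_right)
    qed
  qed
  then show ?thesis unfolding kuu_iff using b(1) by blast
qed

text \<open>
  The lowest nonzero coefficient lies in the field \<open>k\<close>, so dividing by the corresponding power of \<open>u\<close> leaves a unit.
\<close>

lemma kuu_factor:
  assumes z: "z \<in> kuu" "z \<noteq> 0"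
  obtains k :: nat and w where "z = u ^ k * w" "w \<in> kuu" "w \<noteq> 0" "vb w = 0" "inverse w \<in> kuu"
proof -
  obtain a where a: "\<And>i. a i \<in> kres" "expansion u z a" using z(1) unfolding kuu_iff by blast
  have "\<exists>k. a k \<noteq> 0"
  proof (rule ccontr)
    assume "\<not> ?thesis"
    then have "expansion u 0 a" by (simp add: expansion_def)
    then show False using expansion_unique[OF a(2)] z(2) by simp
  qed
  define k where "k = (LEAST k. a k \<noteq> 0)"
  have k: "a k \<noteq> 0" "\<And>i. i < k \<Longrightarrow> a i = 0"
    unfolding k_def using LeastI_ex[OF \<open>\<exists>k. a k \<noteq> 0\<close>] not_less_Least by blast+
  define w where "w = z / u ^ k"
  define b where "b i = a (k + i)" for i
  have zw: "z = u ^ k * w" using u_nonzero by (simp add: w_def)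
  have b: "\<And>i. b i \<in> kres" "b 0 \<noteq> 0" using a(1) k by (auto simp: b_def)
  have w: "expansion u w b"
    unfolding expansion_def
  proof
    fix n
    have "(\<Sum>i<k + n. a i * u ^ i) = (\<Sum>i<k. a i * u ^ i) + (\<Sum>i<n. a (k + i) * u ^ (k + i))"
      by (induction n) (simp_all add: add.assoc)
    then have "z - (\<Sum>i<k + n. a i * u ^ i) = u ^ k * (w - (\<Sum>i<n. b i * u ^ i))"
      using k(2) by (simp add: zw b_def power_add sum_distrib_left right_diff_distrib mult_ac)
    then have "u ^ k * (w - (\<Sum>i<n. b i * u ^ i)) \<in> u_pow_O (real k + real n)"
      using expansionD[OF a(2), of "k + n"] by simp
    then show "w - (\<Sum>i<n. b i * u ^ i) \<in> u_pow_O (n * vb u)" by (simp add: u_pow_O_u)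
  qed
  have "w \<in> kuu" unfolding kuu_iff using w b(1) by blast
  then show ?thesis
    using that[OF zw] expansion_unit[OF b(1) w b(2)] kuu_unit_inverse[OF b(1) w b(2)] by blast
qed

lemma kuu_divide:
  assumes z: "z \<in> kuu" and w: "w \<in> kuu" "w \<noteq> 0" and O: "z / w \<in> u_pow_O 0"
  shows "z / w \<in> kuu"
proof (cases "z = 0")
  case False
  obtain k x where x: "z = u ^ k * x" "x \<in> kuu" "x \<noteq> 0" "vb x = 0" by (rule kuu_factor[OF z False])
  obtain l y where y: "w = u ^ l * y" "y \<in> kuu" "y \<noteq> 0" "vb y = 0" "inverse y \<in> kuu" by (rule kuu_factor[OF w])
  have "vb z = k" "vb w = l" using x y by (simp_all add: vb_mult u_nonzero)
  then have "l \<le> k" using O False w(2) by (simp add: u_pow_O_def vb_divide)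
  then have "z / w = u ^ (k - l) * x * inverse y"
    using u_nonzero y(3) by (simp add: x(1) y(1) power_diff divide_inverse)
  then show ?thesis
    using is_subringD(4)[OF kuu_subring] is_subring_power[OF kuu_subring u_in_kuu] x(2) y(5) by metis
qed (simp add: is_subringD(1)[OF kuu_subring])

lemma kuu_division: "has_division kuu"
  unfolding has_division_def
proof (intro ballI impI)
  fix x y assume xy: "x \<in> kuu" "y \<in> kuu" "x \<noteq> 0 \<or> y \<noteq> 0"
  show "(y \<noteq> 0 \<and> x / y \<in> kuu) \<or> (x \<noteq> 0 \<and> y / x \<in> kuu)"
  proof (cases "x = 0 \<or> y = 0")
    case True
    then show ?thesis using xy is_subringD(1)[OF kuu_subring] by auto
  next
    case False
    then have "x / y \<in> u_pow_O 0 \<or> y / x \<in> u_pow_O 0" by (auto simp: u_pow_O_def vb_divide)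
    then show ?thesis using kuu_divide xy(1,2) False by blast
  qed
qed

end

context unramified_field
begin

lemma nrm_sum_power_p:
  assumes "\<And>i. i \<in> I \<Longrightarrow> nrm (f i) \<le> 1"
  shows "nrm ((\<Sum>i\<in>I. f i) ^ p - (\<Sum>i\<in>I. f i ^ p)) \<le> 1 / p"
  using assms
proof (induction I rule: infinite_finite_induct)
  case (insert i I)
  have "nrm ((f i + (\<Sum>i\<in>I. f i)) ^ p - (f i ^ p + (\<Sum>i\<in>I. f i) ^ p)) \<le> 1 / p"
    by (intro nrm_power_p_add nrm_sum_le insert(4)) auto
  moreover have "nrm (f i ^ p + (\<Sum>i\<in>I. f i) ^ p - (f i ^ p + (\<Sum>i\<in>I. f i ^ p))) \<le> 1 / p"
    using insert(3)[OF insert(4)] by simp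
  ultimately have "nrm ((f i + (\<Sum>i\<in>I. f i)) ^ p - (f i ^ p + (\<Sum>i\<in>I. f i ^ p))) \<le> 1 / p"
    by (rule nrm_trans)
  then show ?case unfolding sum.insert[OF insert(1,2)] .
qed (use p_ge_2 in \<open>auto simp: power_0_left\<close>)

end

context tilted_field
begin

text \<open>
  Since \<open>(pw n) ^ (p ^ n)\<close> has absolute value \<open>1 / p\<close>, only the first \<open>p ^ n\<close> terms of a power series
  contribute to the component with index \<open>n\<close>.
\<close>

lemma expansion_exists:
  assumes a: "\<And>i. a i \<in> kres"
  shows "\<exists>z. expansion u z a"
proof -
  have "\<forall>i. \<exists>\<gamma>. compatible_seq \<gamma> \<and> a i = tilt \<gamma>" using a kres_iff by blast
  then obtain \<gamma> where \<gamma>: "\<And>i. compatible_seq (\<gamma> i)" "\<And>i. a i = tilt (\<gamma> i)" by metis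
  define g where "g i n = \<gamma> i n * pw n ^ i" for i n
  have cg: "compatible_seq (g i)" for i
    unfolding g_def by (rule compat_mult[OF \<gamma>(1) compat_power[OF compatible_pw]])
  have tg: "tilt (g i) = a i * u ^ i" for i
    unfolding g_def using tilt_mult[OF \<gamma>(1) compat_power[OF compatible_pw], of i i] tilt_power[OF compatible_pw, of i]
    by (simp add: u_eq_tilt \<gamma>(2))
  have g1: "nrm (g i n) \<le> 1" for i n by (rule compatD(1)[OF cg])
  have tail: "nrm (g i n) \<le> 1 / p" if "p ^ n \<le> i" for i n
  proof -
    have "nrm (pw n) ^ i \<le> nrm (pw n) ^ (p ^ n)"
      using that nrm_pw_less_1[of n] nrm_nonneg by (intro power_decreasing) auto
    then have "nrm (\<gamma> i n) * nrm (pw n) ^ i \<le> 1 * (1 / p)"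
      using nrm_nonneg compatD(1)[OF \<gamma>(1)] unfolding nrm_pw by (intro mult_mono) auto
    then show ?thesis by (simp add: g_def nrm_mult)
  qed
  define L where "L n = (\<Sum>i<p ^ n. g i n)" for n
  have L: "compatible_seq L"
    unfolding compatible_seq_def
  proof (intro allI conjI)
    fix n
    show "nrm (L n) \<le> 1" unfolding L_def by (rule nrm_sum_le) (use g1 in auto)
    have 1: "nrm (L (Suc n) ^ p - (\<Sum>i<p ^ Suc n. g i (Suc n) ^ p)) \<le> 1 / p"
      unfolding L_def by (rule nrm_sum_power_p) (rule g1)
    have "nrm (\<Sum>i<p ^ Suc n. g i (Suc n) ^ p - g i n) \<le> 1 / p"
      by (rule nrm_sum_le) (use compatD(2)[OF cg] in auto)
    then have 2: "nrm ((\<Sum>i<p ^ Suc n. g i (Suc n) ^ p) - (\<Sum>i<p ^ Suc n. g i n)) \<le> 1 / p"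
      by (simp add: sum_subtractf)
    have le: "p ^ n \<le> p ^ Suc n" using p_ge_2 by simp
    have "(\<Sum>i<p ^ Suc n. g i n) = L n + (\<Sum>i\<in>{p ^ n..<p ^ Suc n}. g i n)"
      unfolding L_def using sum.atLeastLessThan_concat[OF le0 le, of "\<lambda>i. g i n"]
      by (simp add: lessThan_atLeast0)
    moreover have "nrm (\<Sum>i\<in>{p ^ n..<p ^ Suc n}. g i n) \<le> 1 / p"
      by (rule nrm_sum_le) (use tail in auto)
    ultimately have 3: "nrm ((\<Sum>i<p ^ Suc n. g i n) - L n) \<le> 1 / p" by simp
    show "nrm (L (Suc n) ^ p - L n) \<le> 1 / p" by (rule nrm_trans[OF nrm_trans[OF 1 2] 3])
  qed
  have "expansion u (tilt L) a"
    unfolding expansion_def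
  proof
    fix m :: nat
    have "m < 2 ^ m" by (rule less_exp)
    also have "2 ^ m \<le> p ^ m" using p_ge_2 by (intro power_mono) auto
    finally have m: "m \<le> p ^ m" by simp
    let ?S = "\<lambda>n. \<Sum>i<p ^ m. g i n"
    have cS: "compatible_seq ?S" "tilt ?S = (\<Sum>i<p ^ m. a i * u ^ i)"
      using tilt_sum[of "{..<p ^ m}" g] cg by (simp_all add: tg)
    have cD: "compatible_seq (\<lambda>n. L n - ?S n)" by (rule compat_diff[OF L cS(1)])
    have "tilt (\<lambda>n. L n - ?S n) = tilt L - tilt ?S"
      using tilt_add[OF cD cS(1)] by simp
    moreover have "tilt (\<lambda>n. L n - ?S n) \<in> u_pow_O (p ^ m)"
      unfolding tilt_in_u_pow_O_iff[OF cD] by (simp add: L_def)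
    ultimately have "tilt L - (\<Sum>i<p ^ m. a i * u ^ i) \<in> u_pow_O (p ^ m)"
      by (simp only: cS(2))
    moreover have "real m \<le> real (p ^ m)" using m by (simp only: of_nat_le_iff)
    ultimately have 1: "tilt L - (\<Sum>i<p ^ m. a i * u ^ i) \<in> u_pow_O m"
      by (rule u_pow_O_mono)
    have split: "(\<Sum>i<p ^ m. a i * u ^ i) = (\<Sum>i<m. a i * u ^ i) + (\<Sum>i\<in>{m..<p ^ m}. a i * u ^ i)"
      using sum.atLeastLessThan_concat[OF le0 m, of "\<lambda>i. a i * u ^ i"]
      by (simp add: lessThan_atLeast0)
    have 2: "(\<Sum>i\<in>{m..<p ^ m}. a i * u ^ i) \<in> u_pow_O m"
    proof (rule u_pow_O_sum)
      fix i assume "i \<in> {m..<p ^ m}"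
      then have "u ^ i \<in> u_pow_O m" by (intro u_pow_O_mono[OF u_in_O]) simp
      then show "a i * u ^ i \<in> u_pow_O m" by (rule u_pow_O_mult_left[OF kres_subset_O[OF a]])
    qed
    have eq: "tilt L - (\<Sum>i<m. a i * u ^ i) =
        (tilt L - (\<Sum>i<p ^ m. a i * u ^ i)) + (\<Sum>i\<in>{m..<p ^ m}. a i * u ^ i)"
      unfolding split by simp
    show "tilt L - (\<Sum>i<m. a i * u ^ i) \<in> u_pow_O (m * vb u)"
      unfolding eq using u_pow_O_add[OF 1 2] by simp
  qed
  then show ?thesis by blast
qed

lemma expansion_frobenius:
  assumes "expansion u z a" shows "expansion (u ^ p) (z ^ p) (\<lambda>i. a i ^ p)"
  unfolding expansion_def
proof
  fix n :: nat
  have "(z - (\<Sum>i<n. a i * u ^ i)) ^ p \<in> u_pow_O (p * n)"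
    using u_pow_O_power[OF expansionD[OF assms, of n], of p] by simp
  moreover have "(z - (\<Sum>i<n. a i * u ^ i)) ^ p = z ^ p - (\<Sum>i<n. a i ^ p * (u ^ p) ^ i)"
    by (simp add: frobenius_diff frobenius_sum power_mult_distrib power_mult[symmetric] mult.commute)
  ultimately show "z ^ p - (\<Sum>i<n. a i ^ p * (u ^ p) ^ i) \<in> u_pow_O (n * vb (u ^ p))"
    by (simp add: mult.commute)
qed

text \<open>
  Since \<open>k\<close> is perfect, the coefficients of a series in \<open>u ^ p\<close> have \<open>p\<close>-th roots in \<open>k\<close>.
\<close>

lemma power_series_frobenius: "power_series (u ^ p) = (\<lambda>w. w ^ p) ` kuu"
proof (intro Set.set_eqI iffI)
  have up: "u ^ p \<noteq> 0" using u_nonzero by simp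
  fix z
  {
    assume "z \<in> power_series (u ^ p)"
    then obtain a where a: "\<And>i. a i \<in> kres" "expansion (u ^ p) z a" unfolding power_series_iff[OF up] by blast
    obtain b where b: "\<And>i. b i \<in> kres" "\<And>i. b i ^ p = a i" using kres_perfect[OF a(1)] by metis
    obtain w where w: "expansion u w b" using expansion_exists[of b, OF b(1)] by blast
    have "expansion (u ^ p) (w ^ p) a" using expansion_frobenius[OF w] by (simp add: b(2))
    then have "z = w ^ p" using expansion_unique[OF a(2)] by simp
    moreover have "w \<in> kuu" unfolding kuu_iff using w b(1) by blast
    ultimately show "z \<in> (\<lambda>w. w ^ p) ` kuu" by blast
  }
  assume "z \<in> (\<lambda>w. w ^ p) ` kuu"
  then obtain w where "z = w ^ p" "w \<in> kuu" by blast
  then obtain b where w: "z = w ^ p" "\<And>i. b i \<in> kres" "expansion u w b" unfolding kuu_iff by blast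
  then show "z \<in> power_series (u ^ p)"
    unfolding power_series_iff[OF up] using expansion_frobenius[OF w(3)] kres_power_p[OF w(2)]
    by (intro exI[of _ "\<lambda>i. b i ^ p"]) simp
qed

text \<open>
  Sort the terms of the series by the residue \<open>j\<close> of their exponents modulo \<open>p\<close>; after division by \<open>u ^ j\<close>, each class is a
  series in \<open>u ^ p\<close> and hence a \<open>p\<close>-th power.
\<close>

lemma kuu_decompose:
  assumes z: "z \<in> kuu"
  obtains w where "\<And>j. w j \<in> kuu" "z = (\<Sum>j<p. u ^ j * w j ^ p)"
proof -
  obtain a where a: "\<And>i. a i \<in> kres" "expansion u z a" using z unfolding kuu_iff by blast
  obtain b where b: "\<And>i. b i \<in> kres" "\<And>i. b i ^ p = a i" using kres_perfect[OF a(1)] by metis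
  have "\<exists>w. expansion u w (\<lambda>i. b (i * p + j))" for j
    using expansion_exists[of "\<lambda>i. b (i * p + j)", OF b(1)] by blast
  then obtain w where w: "\<And>j. expansion u (w j) (\<lambda>i. b (i * p + j))" by metis
  have wk: "w j \<in> kuu" for j
    unfolding kuu_iff by (intro exI[of _ "\<lambda>i. b (i * p + j)"] conjI allI b(1) w)
  have block: "(\<Sum>l<n * p. f l) = (\<Sum>j<p. \<Sum>i<n. f (i * p + j))" for n and f :: "nat \<Rightarrow> 'd"
  proof (induction n)
    case (Suc n)
    have split: "(\<Sum>l<m + k. f l) = (\<Sum>l<m. f l) + (\<Sum>j<k. f (m + j))" for m k
      by (induction k) (simp_all add: add.assoc)
    have "(\<Sum>l<Suc n * p. f l) = (\<Sum>l<n * p + p. f l)" by (simp add: add.commute)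
    also have "\<dots> = (\<Sum>j<p. \<Sum>i<n. f (i * p + j)) + (\<Sum>j<p. f (n * p + j))" unfolding split Suc ..
    finally show ?case by (simp add: sum.distrib)
  qed simp
  have "z - (\<Sum>j<p. u ^ j * w j ^ p) \<in> u_pow_O (n * real p)" for n :: nat
  proof -
    have wp: "u ^ j * (w j ^ p - (\<Sum>i<n. a (i * p + j) * (u ^ p) ^ i)) \<in> u_pow_O (n * real p)" for j
    proof (rule u_pow_O_mult_left)
      show "u ^ j \<in> u_pow_O 0" by (rule u_pow_O_mono[OF u_in_O]) simp
      show "w j ^ p - (\<Sum>i<n. a (i * p + j) * (u ^ p) ^ i) \<in> u_pow_O (n * real p)"
        using expansionD[OF expansion_frobenius[OF w[of j]], of n] by (simp add: b(2))
    qed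
    have "(\<Sum>j<p. u ^ j * (\<Sum>i<n. a (i * p + j) * (u ^ p) ^ i)) = (\<Sum>j<p. \<Sum>i<n. a (i * p + j) * u ^ (i * p + j))"
      by (simp add: sum_distrib_left power_add power_mult[symmetric] mult_ac)
    also have "\<dots> = (\<Sum>l<n * p. a l * u ^ l)" by (rule block[symmetric])
    finally have eq: "z - (\<Sum>j<p. u ^ j * w j ^ p) = (z - (\<Sum>l<n * p. a l * u ^ l)) -
        (\<Sum>j<p. u ^ j * (w j ^ p - (\<Sum>i<n. a (i * p + j) * (u ^ p) ^ i)))"
      by (simp add: right_diff_distrib sum_subtractf)
    have "z - (\<Sum>l<n * p. a l * u ^ l) \<in> u_pow_O (n * real p)"
      using expansionD[OF a(2), of "n * p"] by simp
    from u_pow_O_diff[OF this u_pow_O_sum[OF wp]] show ?thesis unfolding eq .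
  qed
  then have "z - (\<Sum>j<p. u ^ j * w j ^ p) = 0" using p_pos u_pow_O_all_imp_0 by blast
  then show ?thesis using that[of w] wk by simp
qed

section \<open>Laurent series over the residue field\<close>

lemma u_power_kuu: "u ^ n \<in> kuu"
  by (rule is_subring_power[OF kuu_subring u_in_kuu])

lemma kuu_subset_ku: "z \<in> kuu \<Longrightarrow> z \<in> ku"
  unfolding ku_def mem_Collect_eq by (rule exI[of _ 0]) simp

lemma kuu_u_mult_mono:
  assumes "u ^ m * z \<in> kuu" "m \<le> n" shows "u ^ n * z \<in> kuu"
proof -
  have "u ^ n * z = u ^ (n - m) * (u ^ m * z)" using assms(2) by (simp flip: power_add mult.assoc)
  then show ?thesis using is_subringD(4)[OF kuu_subring u_power_kuu assms(1)] by metis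
qed

lemma ku_subring: "is_subring ku"
  unfolding is_subring_def
proof (intro conjI ballI)
  show "0 \<in> ku" "1 \<in> ku" using kuu_subset_ku is_subringD(1,2)[OF kuu_subring] by blast+
  fix x y assume "x \<in> ku" "y \<in> ku"
  then obtain m n where m: "u ^ m * x \<in> kuu" and n: "u ^ n * y \<in> kuu" unfolding ku_def by blast
  have "u ^ (m + n) * (x + y) = u ^ n * (u ^ m * x) + u ^ m * (u ^ n * y)"
    by (simp add: power_add algebra_simps)
  then have "u ^ (m + n) * (x + y) \<in> kuu"
    using m n is_subringD(3,4)[OF kuu_subring] u_power_kuu by metis
  then show "x + y \<in> ku" unfolding ku_def by blast
  have "u ^ (m + n) * (x * y) = (u ^ m * x) * (u ^ n * y)" by (simp add: power_add algebra_simps)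
  then have "u ^ (m + n) * (x * y) \<in> kuu" using m n is_subringD(4)[OF kuu_subring] by metis
  then show "x * y \<in> ku" unfolding ku_def by blast
  have "u ^ m * (- x) \<in> kuu" using is_subringD(5)[OF kuu_subring m] by simp
  then show "- x \<in> ku" unfolding ku_def by blast
qed

lemma u_inverse_ku: "z \<in> ku \<Longrightarrow> z / u ^ n \<in> ku"
proof -
  assume "z \<in> ku"
  then obtain m where m: "u ^ m * z \<in> kuu" unfolding ku_def by blast
  have "u ^ (m + n) * (z / u ^ n) = u ^ m * z" using u_nonzero by (simp add: power_add)
  then have "u ^ (m + n) * (z / u ^ n) \<in> kuu" using m by simp
  then show ?thesis unfolding ku_def by blast
qed

lemma ku_integral:
  assumes "z \<in> ku" "z \<in> u_pow_O 0" shows "z \<in> kuu"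
proof -
  obtain m where m: "u ^ m * z \<in> kuu" using assms(1) unfolding ku_def by blast
  have "z = (u ^ m * z) / u ^ m" using u_nonzero by simp
  then show ?thesis using kuu_divide[OF m u_power_kuu[of m]] assms(2) u_nonzero by simp
qed

lemma ku_vb: "z \<in> ku \<Longrightarrow> z \<noteq> 0 \<Longrightarrow> \<exists>k::int. vb z = k"
proof -
  assume z: "z \<in> ku" "z \<noteq> 0"
  then obtain m where m: "u ^ m * z \<in> kuu" unfolding ku_def by blast
  moreover have "u ^ m * z \<noteq> 0" using z(2) u_nonzero by simp
  ultimately obtain k w where w: "u ^ m * z = u ^ k * w" "w \<noteq> 0" "vb w = 0" by (rule kuu_factor)
  have "m + vb z = k"
    using arg_cong[OF w(1), of vb] w(2,3) z(2) u_nonzero by (simp add: vb_mult)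
  then have "vb z = of_int (int k - int m)" by simp
  then show ?thesis by blast
qed

lemma ku_decompose:
  assumes "z \<in> ku"
  obtains w where "\<And>j. w j \<in> ku" "z = (\<Sum>j<p. u ^ j * w j ^ p)"
proof -
  obtain m where m: "u ^ m * z \<in> kuu" using assms unfolding ku_def by blast
  have "m \<le> p * m" using p_ge_2 by simp
  from kuu_u_mult_mono[OF m this] have "u ^ (p * m) * z \<in> kuu" .
  then obtain w where w: "\<And>j. w j \<in> kuu" "u ^ (p * m) * z = (\<Sum>j<p. u ^ j * w j ^ p)" using kuu_decompose by blast
  have "z = (u ^ (p * m) * z) / u ^ (p * m)" using u_nonzero by simp
  also have "\<dots> = (\<Sum>j<p. u ^ j * (w j / u ^ m) ^ p)"
    unfolding w(2) by (simp add: sum_divide_distrib power_divide power_mult[symmetric] mult.commute)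
  finally show ?thesis using that[of "\<lambda>j. w j / u ^ m"] w(1) kuu_subset_ku u_inverse_ku by blast
qed

text \<open>The valuations of the nonzero \<open>u ^ j * \<beta> j ^ p\<close> are distinct modulo \<open>p\<close>.\<close>

lemma ku_decompose_unique:
  assumes \<beta>: "\<And>j. j < p \<Longrightarrow> \<beta> j \<in> ku" and sum: "(\<Sum>j<p. u ^ j * \<beta> j ^ p) = 0" and j: "j < p"
  shows "\<beta> j = 0"
proof -
  have "\<forall>j\<in>{..<p}. u ^ j * \<beta> j ^ p = 0"
  proof (rule sum_distinct_vb_eq_0[OF _ sum])
    fix i j assume ij: "i \<in> {..<p}" "j \<in> {..<p}" "u ^ i * \<beta> i ^ p \<noteq> 0" "u ^ j * \<beta> j ^ p \<noteq> 0"
      and eq: "vb (u ^ i * \<beta> i ^ p) = vb (u ^ j * \<beta> j ^ p)"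
    have nz: "\<beta> i \<noteq> 0" "\<beta> j \<noteq> 0" using ij p_ge_2 by auto
    obtain k l :: int where kl: "vb (\<beta> i) = k" "vb (\<beta> j) = l"
      using ku_vb[OF \<beta> nz(1)] ku_vb[OF \<beta> nz(2)] ij(1,2) by auto
    have "real i + p * real_of_int k = real j + p * real_of_int l"
      using eq nz u_nonzero by (simp add: vb_mult vb_power kl)
    then have "real_of_int (int i + int p * k) = real_of_int (int j + int p * l)" by simp
    then have e: "int i + int p * k = int j + int p * l" by (simp only: of_int_eq_iff)
    have "int i = (int i + int p * k) mod int p" "int j = (int j + int p * l) mod int p" using ij(1,2) by simp_all
    then show "i = j" using e by simp
  qed simp
  then show ?thesis using j u_nonzero by simp
qed

end

lemma is_basis_iff:
  "is_basis A N n b \<longleftrightarrow> N = lincomb cscale A {..<n} b \<and> indep_family cscale A {..<n} b"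
proof -
  have "(\<forall>i\<in>{..<n}. P i) \<longleftrightarrow> (\<forall>i<n. P i)" for P by auto
  then show ?thesis unfolding is_basis_def lincomb_def indep_family_def by blast
qed

lemma is_basis_reindex:
  assumes f: "bij_betw f {..<n} I" and N: "N = lincomb cscale A I m" and indep: "indep_family cscale A I m"
  shows "is_basis A N n (\<lambda>i. m (f i))"
  unfolding is_basis_iff
proof
  define g where "g = the_inv_into {..<n} f"
  have fg: "f (g i) = i" if "i \<in> I" for i
    using f_the_inv_into_f_bij_betw[OF f] that by (simp add: g_def)
  have gf: "g (f j) = j" if "j < n" for j
    using the_inv_into_f_f[of f "{..<n}" j] f that by (simp add: g_def bij_betw_def)
  have fI: "f j \<in> I" if "j < n" for j using f that by (auto simp: bij_betw_def)
  have gn: "g i < n" if "i \<in> I" for i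
    using bij_betwE[OF bij_betw_the_inv_into[OF f]] that by (auto simp: g_def)
  have sum1: "(\<Sum>i\<in>I. cscale (c i) (m i)) = (\<Sum>j<n. cscale (c (f j)) (m (f j)))" for c
    by (rule sum.reindex_bij_betw[OF f, symmetric])
  have sum2: "(\<Sum>j<n. cscale (d j) (m (f j))) = (\<Sum>i\<in>I. cscale (d (g i)) (m i))" for d
    unfolding sum1 by (rule sum.cong) (auto simp: gf)
  show "N = lincomb cscale A {..<n} (\<lambda>i. m (f i))"
    unfolding N
  proof (intro Set.set_eqI iffI)
    fix x
    {
      assume "x \<in> lincomb cscale A I m"
      then obtain c where "\<forall>i\<in>I. c i \<in> A" "x = (\<Sum>i\<in>I. cscale (c i) (m i))" by (rule lincombE)
      then show "x \<in> lincomb cscale A {..<n} (\<lambda>i. m (f i))"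
        by (intro lincombI[of _ "\<lambda>j. c (f j)"]) (auto simp: sum1 fI)
    }
    assume "x \<in> lincomb cscale A {..<n} (\<lambda>i. m (f i))"
    then obtain d where "\<forall>j\<in>{..<n}. d j \<in> A" "x = (\<Sum>j<n. cscale (d j) (m (f j)))" by (rule lincombE)
    then show "x \<in> lincomb cscale A I m"
      by (intro lincombI[of _ "\<lambda>i. d (g i)"]) (auto simp: sum2 gn)
  qed
  show "indep_family cscale A {..<n} (\<lambda>i. m (f i))"
    unfolding indep_family_def
  proof (intro allI impI ballI)
    fix d j assume d: "\<forall>j\<in>{..<n}. d j \<in> A" "(\<Sum>j<n. cscale (d j) (m (f j))) = 0" "j \<in> {..<n}"
    have "d (g (f j)) = 0"
      by (rule indep_familyD[OF indep, of "\<lambda>i. d (g i)"]) (use d sum2[of d] gn fI in auto)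
    then show "d j = 0" using gf d(3) by simp
  qed
qed

lemma sum_mem_additive:
  assumes "0 \<in> P" "\<And>x y. x \<in> P \<Longrightarrow> y \<in> P \<Longrightarrow> x + y \<in> P" "\<And>i. i \<in> I \<Longrightarrow> f i \<in> P"
  shows "(\<Sum>i\<in>I. f i) \<in> P"
  using assms(3) by (induction I rule: infinite_finite_induct) (auto intro: assms)

lemma sum_fun_apply: "(\<Sum>i\<in>I. f i) x = (\<Sum>i\<in>I. f i x)"
  by (induction I rule: infinite_finite_induct) auto

section \<open>Lattices are free\<close>

context galois_rep
begin

lemma SF_eq_lincomb: "(SF :: ('f, 'd) tensor set) = lincomb cscale kuu UNIV (\<lambda>a. tens a 1)"
proof
  show "SF \<subseteq> lincomb cscale kuu (UNIV :: 'f set) (\<lambda>a. tens a 1)"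
  proof
    fix z :: "('f, 'd) tensor" assume "z \<in> SF"
    then obtain n c s where z: "z = (\<Sum>i<(n::nat). cscale (c i) (s i))" "\<forall>i<n. c i \<in> kuu"
        "\<forall>i<n. s i \<in> range (\<lambda>a. tens a 1)"
      by (auto simp: SF_def span_over_def)
    show "z \<in> lincomb cscale kuu UNIV (\<lambda>a. tens a 1)"
      unfolding z(1)
    proof (intro cs.lincomb_sum[OF kuu_subring] cs.lincomb_scale[OF kuu_subring])
      fix i assume i: "i \<in> {..<n}"
      then show "c i \<in> kuu" using z(2) by simp
      obtain a where "s i = tens a 1" using z(3) i by blast
      then show "s i \<in> lincomb cscale kuu UNIV (\<lambda>a. tens a 1)"
        using cs.lincomb_member[OF kuu_subring, of UNIV a "\<lambda>a. tens a 1"] by simp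
    qed
  qed
  show "lincomb cscale kuu UNIV (\<lambda>a. tens a 1) \<subseteq> (SF :: ('f, 'd) tensor set)"
  proof
    fix z :: "('f, 'd) tensor" assume "z \<in> lincomb cscale kuu UNIV (\<lambda>a. tens a 1)"
    then obtain c where c: "\<forall>a\<in>UNIV. c a \<in> kuu" "z = (\<Sum>a\<in>UNIV. cscale (c a) (tens a 1))" by (rule lincombE)
    show "z \<in> SF"
      unfolding c(2) SF_def
    proof (rule span_over_sum[OF is_subringD(1)[OF kuu_subring]])
      fix a :: 'f
      show "cscale (c a) (tens a 1) \<in> span_over kuu (range (\<lambda>a. tens a 1))"
        by (rule span_over_scale[OF _ span_over_member[OF is_subringD(2)[OF kuu_subring]]])
          (use c(1) is_subringD(4)[OF kuu_subring] in auto)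
    qed
  qed
qed

lemma SF_module:
  "0 \<in> (SF :: ('f, 'd) tensor set)" "x \<in> SF \<Longrightarrow> y \<in> SF \<Longrightarrow> x + y \<in> (SF :: ('f, 'd) tensor set)"
  "c \<in> kuu \<Longrightarrow> x \<in> SF \<Longrightarrow> cscale c x \<in> (SF :: ('f, 'd) tensor set)"
  unfolding SF_eq_lincomb
  by (rule cs.lincomb_zero[OF kuu_subring], erule (1) cs.lincomb_add[OF kuu_subring], erule (1) cs.lincomb_scale[OF kuu_subring])

lemma SF_submoduleD:
  assumes "SF_submodule N"
  shows "0 \<in> N" "x \<in> N \<Longrightarrow> y \<in> N \<Longrightarrow> x + y \<in> N" "c \<in> kuu \<Longrightarrow> x \<in> N \<Longrightarrow> cscale c x \<in> N"
    "(\<And>i. i \<in> I \<Longrightarrow> f i \<in> N) \<Longrightarrow> (\<Sum>i\<in>I. f i) \<in> N"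
    "x \<in> N \<Longrightarrow> y \<in> N \<Longrightarrow> x - y \<in> N"
proof -
  show a: "0 \<in> N" "\<And>x y. x \<in> N \<Longrightarrow> y \<in> N \<Longrightarrow> x + y \<in> N" "\<And>c x. c \<in> kuu \<Longrightarrow> x \<in> N \<Longrightarrow> cscale c x \<in> N"
    using assms by (auto simp: SF_submodule_def)
  show "(\<And>i. i \<in> I \<Longrightarrow> f i \<in> N) \<Longrightarrow> (\<Sum>i\<in>I. f i) \<in> N" by (rule sum_mem_additive[of N]) (use a in auto)
  assume "x \<in> N" "y \<in> N"
  moreover have "cscale (- 1) y \<in> N"
    using a(3) \<open>y \<in> N\<close> is_subringD(2,5)[OF kuu_subring] by blast
  ultimately show "x - y \<in> N" using a(2)[of x "cscale (- 1) y"] by simp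
qed

text \<open>The images of the \<open>tens a 1\<close> in each coordinate generate, as \<open>\<bbbF>\<close> is finite.\<close>

lemma finite_projective_generated:
  assumes sub: "SF_submodule N" and proj: "SF_finite_projective N"
  shows "\<exists>(I :: (nat \<times> 'f) set) g. finite I \<and> N = lincomb cscale kuu I g"
proof -
  obtain n and j :: "('v, 'd) tensor \<Rightarrow> nat \<Rightarrow> ('f, 'd) tensor" and s where
    j: "j ` N \<subseteq> SF_free n" and s: "SF_linear_on (SF_free n) cscale_free fscale_free cscale fscale s"
    and sN: "s ` SF_free n \<subseteq> N" and sj: "\<forall>x\<in>N. s (j x) = x"
    using proj unfolding SF_finite_projective_def by blast
  have s_add: "s (x + y) = s x + s y" if "x \<in> SF_free n" "y \<in> SF_free n" for x y
    using s that by (auto simp: SF_linear_on_def)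
  have s_scale: "s (cscale_free c x) = cscale c (s x)" if "c \<in> kuu" "x \<in> SF_free n" for c x
    using s that by (auto simp: SF_linear_on_def)
  define E :: "nat \<times> 'f \<Rightarrow> nat \<Rightarrow> ('f, 'd) tensor" where "E = (\<lambda>(i, a) k. if k = i then tens a 1 else 0)"
  define g where "g z = s (E z)" for z
  let ?I = "{..<n} \<times> (UNIV :: 'f set)"
  have tens_SF: "tens a 1 \<in> SF" for a :: 'f
    unfolding SF_eq_lincomb by (rule cs.lincomb_member[OF kuu_subring, of UNIV a "\<lambda>a. tens a 1"]) auto
  have E: "E z \<in> SF_free n" if "z \<in> ?I" for z
    using that tens_SF SF_module(1) by (auto simp: E_def SF_free_def)
  have zero: "(0 :: nat \<Rightarrow> ('f, 'd) tensor) \<in> SF_free n" by (auto simp: SF_free_def SF_module(1))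
  have plus: "x + y \<in> SF_free n" if "x \<in> SF_free n" "y \<in> SF_free n" for x y :: "nat \<Rightarrow> ('f, 'd) tensor"
    using that by (auto simp: SF_free_def SF_module(2))
  have scale: "cscale_free c x \<in> SF_free n" if "c \<in> kuu" "x \<in> SF_free n" for c and x :: "nat \<Rightarrow> ('f, 'd) tensor"
    using that by (auto simp: SF_free_def cscale_free_def SF_module(3))
  have s0: "s 0 = 0" using s_add[OF zero zero] by simp
  have "N \<subseteq> lincomb cscale kuu ?I g"
  proof
    fix x assume x: "x \<in> N"
    define y where "y = j x"
    have y: "y \<in> SF_free n" using j x by (auto simp: y_def)
    have "\<forall>k. \<exists>c. k < n \<longrightarrow> (\<forall>a. c a \<in> kuu) \<and> y k = (\<Sum>a\<in>UNIV. cscale (c a) (tens a 1))"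
    proof
      fix k
      show "\<exists>c. k < n \<longrightarrow> (\<forall>a. c a \<in> kuu) \<and> y k = (\<Sum>a\<in>UNIV. cscale (c a) (tens a 1))"
      proof (cases "k < n")
        case True
        then have "y k \<in> lincomb cscale kuu UNIV (\<lambda>a. tens a 1)"
          using y by (simp add: SF_free_def flip: SF_eq_lincomb)
        then show ?thesis unfolding lincomb_def by auto
      qed simp
    qed
    then obtain c where c: "\<And>k a. k < n \<Longrightarrow> c k a \<in> kuu" "\<And>k. k < n \<Longrightarrow> y k = (\<Sum>a\<in>UNIV. cscale (c k a) (tens a 1))"
      by metis
    have y_eq: "y = (\<Sum>z\<in>?I. cscale_free (c (fst z) (snd z)) (E z))"
    proof
      fix k
      have "(\<Sum>z\<in>?I. cscale_free (c (fst z) (snd z)) (E z)) k =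
          (\<Sum>i<n. \<Sum>a\<in>UNIV. cscale_free (c i a) (E (i, a)) k)"
        by (simp add: sum_fun_apply sum.cartesian_product case_prod_beta)
      also have "\<dots> = (\<Sum>i<n. if k = i then (\<Sum>a\<in>UNIV. cscale (c i a) (tens a 1)) else 0)"
        by (intro sum.cong refl) (auto simp: cscale_free_def E_def)
      also have "\<dots> = y k"
        using y c(2) by (auto simp: SF_free_def)
      finally show "y k = (\<Sum>z\<in>?I. cscale_free (c (fst z) (snd z)) (E z)) k" by simp
    qed
    let ?P = "{y \<in> SF_free n. s y \<in> lincomb cscale kuu ?I g}"
    have "y \<in> ?P"
      unfolding y_eq
    proof (rule sum_mem_additive)
      show "0 \<in> ?P" using zero s0 cs.lincomb_zero[OF kuu_subring] by simp
      show "x + y \<in> ?P" if "x \<in> ?P" "y \<in> ?P" for x y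
        using that plus s_add cs.lincomb_add[OF kuu_subring] by auto
      fix z assume z: "z \<in> ?I"
      then have cz: "c (fst z) (snd z) \<in> kuu" using c(1) by auto
      have "cscale (c (fst z) (snd z)) (g z) \<in> lincomb cscale kuu ?I g"
        by (intro cs.lincomb_scale[OF kuu_subring] cs.lincomb_member[OF kuu_subring] cz z) simp
      then show "cscale_free (c (fst z) (snd z)) (E z) \<in> ?P"
        using scale[OF cz E[OF z]] s_scale[OF cz E[OF z]] by (simp add: g_def)
    qed
    then show "x \<in> lincomb cscale kuu ?I g" using sj x by (simp add: y_def)
  qed
  moreover have "lincomb cscale kuu ?I g \<subseteq> N"
  proof
    fix x assume "x \<in> lincomb cscale kuu ?I g"
    then obtain c where c: "\<forall>z\<in>?I. c z \<in> kuu" "x = (\<Sum>z\<in>?I. cscale (c z) (g z))" by (rule lincombE)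
    show "x \<in> N"
      unfolding c(2) by (intro SF_submoduleD(4)[OF sub] SF_submoduleD(3)[OF sub]) (use c(1) sN E in \<open>auto simp: g_def\<close>)
  qed
  ultimately show ?thesis by (intro exI[of _ ?I] exI[of _ g]) auto
qed

lemma indep_kuu_imp_ku:
  fixes m :: "'i \<Rightarrow> ('v, 'd) tensor"
  assumes I: "finite I" and indep: "indep_family cscale kuu I m"
  shows "indep_family cscale ku I m"
  unfolding indep_family_def
proof (intro allI impI ballI)
  fix c i assume c: "\<forall>i\<in>I. c i \<in> ku" "(\<Sum>i\<in>I. cscale (c i) (m i)) = 0" and i: "i \<in> I"
  have "\<exists>R. \<forall>i\<in>J. u ^ R * c i \<in> kuu" if "finite J" "J \<subseteq> I" for J
    using that
  proof (induction J)
    case (insert j J)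
    then obtain R where R: "\<forall>i\<in>J. u ^ R * c i \<in> kuu" by blast
    obtain S where S: "u ^ S * c j \<in> kuu" using c(1) insert(4) unfolding ku_def by blast
    have "\<forall>i\<in>insert j J. u ^ (max R S) * c i \<in> kuu"
      using R S by (auto intro: kuu_u_mult_mono[of R] kuu_u_mult_mono[of S])
    then show ?case by blast
  qed simp
  then obtain R where R: "\<forall>i\<in>I. u ^ R * c i \<in> kuu" using I by blast
  have "(\<Sum>i\<in>I. cscale (u ^ R * c i) (m i)) = cscale (u ^ R) (\<Sum>i\<in>I. cscale (c i) (m i))"
    by (simp add: cs.scale_sum_right)
  then have "u ^ R * c i = 0"
    using indep_familyD[OF indep, of "\<lambda>i. u ^ R * c i" i] R c(2) i by simp
  then show "c i = 0" using u_nonzero by simp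
qed

text \<open>
  The change of basis to a basis \<open>b\<close> of \<open>M\<close> that is also a basis of the whole space is invertible over
  \<open>ku\<close>, hence over \<open>C\<^sup>\<flat>\<close>.
\<close>

lemma indep_kuu_imp_UNIV:
  fixes m :: "'i \<Rightarrow> ('v, 'd) tensor"
  assumes I: "finite I" and indep: "indep_family cscale kuu I m" and N: "N = lincomb cscale kuu I m"
    and M: "N \<subseteq> M" "{x. \<exists>n::nat. cscale (u ^ n) x \<in> N} = M"
    and b: "is_basis ku M n b" "is_basis UNIV UNIV n b"
  shows "indep_family cscale UNIV I m"
proof -
  have Mb: "M = lincomb cscale ku {..<n} b" using b(1) by (simp add: is_basis_iff)
  have ib: "indep_family cscale UNIV {..<n} b" using b(2) by (simp add: is_basis_iff)
  have iku: "indep_family cscale ku I m" by (rule indep_kuu_imp_ku[OF I indep])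
  have "\<exists>A. (\<forall>j<n. A j \<in> ku) \<and> m i = (\<Sum>j<n. cscale (A j) (b j))" if i: "i \<in> I" for i
  proof -
    have "m i \<in> N" unfolding N by (rule cs.lincomb_member[OF kuu_subring I i])
    then have "m i \<in> lincomb cscale ku {..<n} b" using M(1) Mb by blast
    then show ?thesis unfolding lincomb_def by auto
  qed
  then obtain A where A: "\<And>i j. i \<in> I \<Longrightarrow> j < n \<Longrightarrow> A i j \<in> ku" "\<And>i. i \<in> I \<Longrightarrow> m i = (\<Sum>j<n. cscale (A i j) (b j))"
    by metis
  have "\<exists>B. (\<forall>l\<in>I. B l \<in> ku) \<and> b j = (\<Sum>l\<in>I. cscale (B l) (m l))" if j: "j < n" for j
  proof -
    have "b j \<in> M" unfolding Mb by (rule cs.lincomb_member[OF ku_subring]) (use j in auto)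
    then obtain r where "cscale (u ^ r) (b j) \<in> N" using M(2) by blast
    then obtain e where e: "\<forall>l\<in>I. e l \<in> kuu" "cscale (u ^ r) (b j) = (\<Sum>l\<in>I. cscale (e l) (m l))"
      unfolding N by (rule lincombE)
    have "b j = cscale (1 / u ^ r) (cscale (u ^ r) (b j))" using u_nonzero by simp
    also have "\<dots> = (\<Sum>l\<in>I. cscale (e l / u ^ r) (m l))" unfolding e(2) by (simp add: cs.scale_sum_right)
    finally show ?thesis using e(1) kuu_subset_ku u_inverse_ku by (intro exI[of _ "\<lambda>l. e l / u ^ r"]) auto
  qed
  then obtain B where B: "\<And>j l. j < n \<Longrightarrow> l \<in> I \<Longrightarrow> B j l \<in> ku" "\<And>j. j < n \<Longrightarrow> b j = (\<Sum>l\<in>I. cscale (B j l) (m l))"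
    by metis
  have AB: "(\<Sum>j<n. A i j * B j l) = (if l = i then 1 else 0)" if i: "i \<in> I" and l: "l \<in> I" for i l
  proof -
    have "m i = (\<Sum>j<n. \<Sum>l\<in>I. cscale (A i j * B j l) (m l))"
      by (subst A(2)[OF i]) (simp add: B(2) cs.scale_sum_right)
    also have "\<dots> = (\<Sum>l\<in>I. cscale (\<Sum>j<n. A i j * B j l) (m l))"
      by (subst sum.swap) (simp add: cs.scale_sum_left)
    finally have 1: "m i = (\<Sum>l\<in>I. cscale (\<Sum>j<n. A i j * B j l) (m l))" .
    have 2: "m i = (\<Sum>l\<in>I. cscale (if l = i then 1 else 0) (m l))"
      using I i by (simp add: if_distrib[of "\<lambda>c. cscale c _"] if_distribR cong: if_cong)
    have "(\<Sum>l\<in>I. cscale ((\<Sum>j<n. A i j * B j l) - (if l = i then 1 else 0)) (m l)) = 0"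
      unfolding cs.scale_left_diff_distrib sum_subtractf using 1 2 by simp
    moreover have "(\<Sum>j<n. A i j * B j l) - (if l = i then 1 else 0) \<in> ku" if "l \<in> I" for l
      by (intro is_subringD(6)[OF ku_subring] is_subring_sum[OF ku_subring] is_subringD(4)[OF ku_subring] A(1) B(1) i that)
        (auto simp: is_subringD(1,2)[OF ku_subring])
    ultimately have "(\<Sum>j<n. A i j * B j l) - (if l = i then 1 else 0) = 0"
      using indep_familyD[OF iku, of "\<lambda>l. (\<Sum>j<n. A i j * B j l) - (if l = i then 1 else 0)" l] l by blast
    then show ?thesis by (simp only: right_minus_eq)
  qed
  show ?thesis
    unfolding indep_family_def
  proof (intro allI impI ballI)
    fix c l assume c: "(\<Sum>i\<in>I. cscale (c i) (m i)) = 0" and l: "l \<in> I"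
    have "0 = (\<Sum>i\<in>I. \<Sum>j<n. cscale (c i * A i j) (b j))"
      unfolding c[symmetric] by (rule sum.cong[OF refl]) (simp add: A(2) cs.scale_sum_right)
    also have "\<dots> = (\<Sum>j<n. cscale (\<Sum>i\<in>I. c i * A i j) (b j))"
      by (subst sum.swap) (simp add: cs.scale_sum_left)
    finally have 0: "(\<Sum>i\<in>I. c i * A i j) = 0" if "j < n" for j
      using indep_familyD[OF ib, of "\<lambda>j. \<Sum>i\<in>I. c i * A i j" j] that by simp
    have "c l = (\<Sum>i\<in>I. c i * (if l = i then 1 else 0))"
      using I l by (simp add: if_distrib[of "\<lambda>x. _ * x"] cong: if_cong)
    also have "\<dots> = (\<Sum>i\<in>I. c i * (\<Sum>j<n. A i j * B j l))"
      by (rule sum.cong[OF refl]) (simp add: AB l)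
    also have "\<dots> = (\<Sum>j<n. (\<Sum>i\<in>I. c i * A i j) * B j l)"
      unfolding sum_distrib_left sum_distrib_right by (subst sum.swap) (simp add: mult.assoc)
    also have "\<dots> = 0" using 0 by simp
    finally show "c l = 0" .
  qed
qed

section \<open>Semilinear maps and thickened lattices\<close>

lemma frob_add: "frob (x + y) = frob x + frob y"
  unfolding frob_def by (rule tensor_map_add) (auto simp: frobenius_add)

lemma frob_cscale: "frob (cscale c x) = cscale (c ^ p) (frob x)"
  unfolding frob_def by (rule tensor_map_cscale) (auto simp: frobenius_add power_mult_distrib)

lemmas frob_diff = additive_imp_diff[of frob, OF frob_add]
lemmas frob_sum = additive_imp_sum[of frob, OF frob_add]
lemmas frob_zero = additive_imp_zero[of frob, OF frob_add]

lemma \<rho>_add: "\<sigma> \<in> GK \<Longrightarrow> \<rho> \<sigma> (v + w) = \<rho> \<sigma> v + \<rho> \<sigma> w"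
  using \<rho>_linear linear_iff by (metis module_hom.add Vector_Spaces.linear.axioms(3) module_hom_iff)

context
  fixes \<sigma> :: "'c \<Rightarrow> 'c"
  assumes \<sigma>: "\<sigma> \<in> GK"
    and act_add: "\<And>x y. tilt_act \<sigma> (x + y) = tilt_act \<sigma> x + tilt_act \<sigma> y"
    and act_mult: "\<And>x y. tilt_act \<sigma> (x * y) = tilt_act \<sigma> x * tilt_act \<sigma> y"
begin

lemma gact_add: "gact \<sigma> (x + y) = gact \<sigma> x + gact \<sigma> y"
  unfolding gact_def by (rule tensor_map_add) (auto simp: \<rho>_add[OF \<sigma>] act_add)

lemma gact_cscale: "gact \<sigma> (cscale c x) = cscale (tilt_act \<sigma> c) (gact \<sigma> x)"
  unfolding gact_def by (rule tensor_map_cscale) (auto simp: \<rho>_add[OF \<sigma>] act_add act_mult)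

lemma act_power: "n > 0 \<Longrightarrow> tilt_act \<sigma> (x ^ n) = tilt_act \<sigma> x ^ n"
  by (induction n rule: nat_induct_non_zero) (auto simp: act_mult)

lemma gact_frob: "gact \<sigma> (frob x) = frob (gact \<sigma> x)"
proof (rule tensor_ext[of "\<lambda>x. gact \<sigma> (frob x)" "\<lambda>x. frob (gact \<sigma> x)"])
  fix v :: 'v and z :: 'd
  have 1: "frob (tens v z) = tens v (z ^ p)" for v :: 'v and z
    unfolding frob_def by (subst tensor_map_tens) (auto simp: frobenius_add)
  have 2: "gact \<sigma> (tens v z) = tens (\<rho> \<sigma> v) (tilt_act \<sigma> z)" for v z
    unfolding gact_def by (subst tensor_map_tens) (auto simp: \<rho>_add[OF \<sigma>] act_add)
  show "gact \<sigma> (frob (tens v z)) = frob (gact \<sigma> (tens v z))"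
    by (simp add: 1 2 act_power)
qed (simp_all add: gact_add frob_add)

lemmas gact_sum = additive_imp_sum[of "gact \<sigma>", OF gact_add]

end

abbreviation thick :: "('v, 'd) tensor set \<Rightarrow> real \<Rightarrow> ('v, 'd) tensor set"
  where "thick N r \<equiv> span_over (u_pow_O r) N"

lemma thick_scale:
  assumes "a \<in> u_pow_O s" "x \<in> thick N r" shows "cscale a x \<in> thick N (s + r)"
  by (rule span_over_scale[OF _ assms(2)]) (rule u_pow_O_mult[OF assms(1)])

lemma thick_mono: "x \<in> thick N r \<Longrightarrow> s \<le> r \<Longrightarrow> x \<in> thick N s"
  using thick_scale[of 1 "s - r" x r N] by (simp add: u_pow_O_def)

lemma one_in_O: "1 \<in> u_pow_O 0"
  by (rule is_subringD(2)[OF is_subring_O])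

lemma thick_diff: "x \<in> thick N r \<Longrightarrow> y \<in> thick N r \<Longrightarrow> x - y \<in> thick N r"
  using span_over_add[of x "u_pow_O r" N "cscale (- 1) y"] thick_scale[OF u_pow_O_minus[OF one_in_O], of y r N]
  by simp

lemma thick_sum: "(\<And>i. i \<in> I \<Longrightarrow> f i \<in> thick N r) \<Longrightarrow> (\<Sum>i\<in>I. f i) \<in> thick N r"
  by (rule span_over_sum) auto

lemma thick_member: "x \<in> N \<Longrightarrow> x \<in> thick N 0"
  by (rule span_over_member[OF one_in_O])

lemma frob_thick:
  assumes N: "\<And>x. x \<in> N \<Longrightarrow> frob x \<in> N" and x: "x \<in> thick N r"
  shows "frob x \<in> thick N (real p * r)"
proof -
  obtain n c s where x: "x = (\<Sum>i<n. cscale (c i) (s i))" "\<forall>i<(n::nat). c i \<in> u_pow_O r" "\<forall>i<n. s i \<in> N"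
    using x by (auto simp: span_over_def)
  show ?thesis
    by (rule span_overI[where n = n and c = "\<lambda>i. c i ^ p" and s = "\<lambda>i. frob (s i)"])
      (use x N u_pow_O_power[of _ r p] in \<open>auto simp: frob_sum frob_cscale\<close>)
qed

lemma thick_lattice:
  assumes I: "finite I" and N: "N = lincomb cscale kuu I m" and x: "x \<in> thick N r"
  shows "x \<in> lincomb cscale (u_pow_O r) I m"
proof -
  obtain n c s where x: "x = (\<Sum>i<n. cscale (c i) (s i))" "\<forall>i<(n::nat). c i \<in> u_pow_O r" "\<forall>i<n. s i \<in> N"
    using x by (auto simp: span_over_def)
  have "\<forall>i. \<exists>a. i < n \<longrightarrow> (\<forall>k\<in>I. a k \<in> kuu) \<and> s i = (\<Sum>k\<in>I. cscale (a k) (m k))"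
    using x(3) unfolding N lincomb_def by blast
  then obtain a where a: "\<And>i k. i < n \<Longrightarrow> k \<in> I \<Longrightarrow> a i k \<in> kuu" "\<And>i. i < n \<Longrightarrow> s i = (\<Sum>k\<in>I. cscale (a i k) (m k))"
    by metis
  have "x = (\<Sum>i<n. \<Sum>k\<in>I. cscale (c i * a i k) (m k))"
    unfolding x(1) by (rule sum.cong[OF refl]) (simp add: a(2) cs.scale_sum_right)
  also have "\<dots> = (\<Sum>k\<in>I. cscale (\<Sum>i<n. c i * a i k) (m k))"
    by (subst sum.swap) (simp add: cs.scale_sum_left)
  finally show ?thesis
  proof (rule lincombI[rotated])
    fix k assume k: "k \<in> I"
    show "(\<Sum>i<n. c i * a i k) \<in> u_pow_O r"
    proof (rule u_pow_O_sum)
      fix i assume "i \<in> {..<n}"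
      then show "c i * a i k \<in> u_pow_O r"
        using u_pow_O_mult_left[OF kuu_subset_O[OF a(1)[of i k]], of "c i" r] k x(2) by (simp add: mult.commute)
    qed
  qed
qed

text \<open>
  Both memberships are read off from the same coordinates, and an element of \<open>k((u))\<close> is divisible by \<open>u ^ i\<close> in \<open>k[[u]]\<close> as
  soon as it is in the integers of the tilt. This brings the Galois condition, which lives over the tilt, back to \<open>N\<close>.
\<close>

lemma thick_inter_lattice:
  assumes I: "finite I" and N: "N = lincomb cscale kuu I m" and indep: "indep_family cscale UNIV I m"
    and x: "x \<in> thick N (real i)" "x \<in> N"
  shows "x \<in> cscale (u ^ i) ` N"
proof -
  obtain d where d: "\<forall>k\<in>I. d k \<in> u_pow_O (real i)" "x = (\<Sum>k\<in>I. cscale (d k) (m k))"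
    using thick_lattice[OF I N x(1)] by (rule lincombE)
  obtain e where e: "\<forall>k\<in>I. e k \<in> kuu" "x = (\<Sum>k\<in>I. cscale (e k) (m k))"
    using x(2) unfolding N by (rule lincombE)
  have "(\<Sum>k\<in>I. cscale (d k - e k) (m k)) = 0"
    using d(2) e(2) by (simp add: cs.scale_left_diff_distrib sum_subtractf)
  then have de: "d k = e k" if "k \<in> I" for k
    using indep_familyD[OF indep, of "\<lambda>k. d k - e k" k] that by simp
  have "d k / u ^ i \<in> kuu" if k: "k \<in> I" for k
  proof (rule ku_integral)
    show "d k / u ^ i \<in> ku" using de[OF k] e(1) k kuu_subset_ku u_inverse_ku by simp
    obtain y where "y \<in> u_pow_O 0" "d k = u ^ i * y" using d(1) k u_pow_O_nat_iff by blast
    then show "d k / u ^ i \<in> u_pow_O 0" using u_nonzero by simp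
  qed
  then have "(\<Sum>k\<in>I. cscale (d k / u ^ i) (m k)) \<in> N"
    unfolding N by (intro lincombI[of _ "\<lambda>k. d k / u ^ i"]) auto
  moreover have "x = cscale (u ^ i) (\<Sum>k\<in>I. cscale (d k / u ^ i) (m k))"
    using u_nonzero unfolding d(2) by (simp add: cs.scale_sum_right)
  ultimately show ?thesis by blast
qed

section \<open>Crystalline lattices are graded\<close>

text \<open>The summand of degree \<open>j\<close> of the element \<open>\<Sum>j<p. u ^ j \<cdot> \<phi> (x j)\<close>.\<close>

abbreviation piece :: "(nat \<Rightarrow> ('v, 'd) tensor) \<Rightarrow> nat \<Rightarrow> ('v, 'd) tensor"
  where "piece x j \<equiv> cscale (u ^ j) (frob (x j))"

lemma of_int_kuu: "of_int n \<in> kuu"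
  by (rule is_subring_of_int[OF kuu_subring])

lemma piece_of_int: "piece (\<lambda>j. cscale (of_int (a j)) (x j)) j = cscale (of_int (a j)) (piece x j)"
  by (simp add: frob_cscale frobenius_of_int mult.commute)

text \<open>
  The operator \<open>(\<sigma> - 1) / (\<epsilon> - 1)\<close> multiplies the piece of degree \<open>j\<close> by \<open>q j = (\<epsilon> ^ j - 1) / (\<epsilon> - 1)\<close>, up to terms divisible by
  \<open>u ^ p\<close>, and \<open>q j\<close> is congruent to \<open>j\<close> modulo \<open>\<epsilon> - 1\<close>, hence modulo \<open>u\<close>. As the pieces are divisible by \<open>u ^ i\<close>, replacing
  \<open>q j\<close> by \<open>j\<close> is harmless modulo \<open>u ^ Suc i\<close>. The result is the analogue of the Euler operator \<open>u d/du\<close>, for which \<open>\<phi> (N)\<close>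
  consists of constants.
\<close>

lemma euler_step:
  assumes N: "N \<in> L_crys M p" and I: "finite I" "N = lincomb cscale kuu I m" "indep_family cscale UNIV I m"
    and x: "\<And>j. j < p \<Longrightarrow> x j \<in> N" and i: "Suc i \<le> p"
    and pieces: "\<And>j. j < p \<Longrightarrow> piece x j \<in> cscale (u ^ i) ` N"
    and sum: "(\<Sum>j<p. piece x j) \<in> cscale (u ^ Suc i) ` N"
  shows "(\<Sum>j<p. cscale (of_nat j) (piece x j)) \<in> cscale (u ^ Suc i) ` N"
proof -
  define c where "c = real p / (real p - 1)"
  have c: "c \<ge> 1" "p * c = p + c" using p_ge_2 by (auto simp: c_def field_simps)
  have sub: "SF_submodule N" and phi: "span_over kuu (frob ` N) \<subseteq> N"
    and crys: "\<And>\<sigma> m. \<sigma> \<in> GK \<Longrightarrow> m \<in> N \<Longrightarrow> gact \<sigma> m - m \<in> thick N c"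
    using N by (auto simp: L_crys_def L_le_def c_def)
  have frobN: "frob y \<in> N" if "y \<in> N" for y
    using phi span_over_member[OF is_subringD(2)[OF kuu_subring], of "frob y" "frob ` N"] that by blast
  obtain \<sigma> \<epsilon> where \<sigma>: "\<sigma> \<in> GK" "\<And>x y. tilt_act \<sigma> (x + y) = tilt_act \<sigma> x + tilt_act \<sigma> y"
    "\<And>x y. tilt_act \<sigma> (x * y) = tilt_act \<sigma> x * tilt_act \<sigma> y"
    and \<epsilon>: "\<epsilon> \<in> u_pow_O 0" "tilt_act \<sigma> u = \<epsilon> * u" "\<epsilon> \<noteq> 1" "vb (\<epsilon> - 1) = c"
    using exists_epsilon unfolding c_def by blast
  have \<epsilon>1: "\<epsilon> - 1 \<in> u_pow_O c" "1 / (\<epsilon> - 1) \<in> u_pow_O (- c)"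
    using \<epsilon>(3,4) by (auto simp: u_pow_O_def vb_divide)
  have \<epsilon>pow: "\<epsilon> ^ l \<in> u_pow_O 0" for l by (rule is_subring_power[OF is_subring_O \<epsilon>(1)])
  define q where "q j = (\<Sum>l<j. \<epsilon> ^ l)" for j :: nat
  have q: "\<epsilon> ^ j - 1 = (\<epsilon> - 1) * q j" for j unfolding q_def by (rule power_diff_1_eq)
  have qO: "q j \<in> u_pow_O 0" for j unfolding q_def by (rule u_pow_O_sum) (rule \<epsilon>pow)
  have \<epsilon>j: "\<epsilon> ^ j - 1 \<in> u_pow_O c" for j
    unfolding q using u_pow_O_mult[OF \<epsilon>1(1) qO] by simp
  have qj: "q j - of_nat j \<in> u_pow_O c" for j
  proof -
    have "q j - of_nat j = (\<Sum>l<j. \<epsilon> ^ l - 1)" by (simp add: q_def sum_subtractf)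
    then show ?thesis by (simp add: u_pow_O_sum \<epsilon>j)
  qed
  have act_1: "tilt_act \<sigma> 1 = 1"
  proof -
    have "tilt_act \<sigma> u * tilt_act \<sigma> 1 = tilt_act \<sigma> u * 1" by (simp flip: \<sigma>(3))
    moreover have "tilt_act \<sigma> u \<noteq> 0"
    proof
      assume "tilt_act \<sigma> u = 0"
      then have "\<epsilon> = 0" using \<epsilon>(2) u_nonzero by simp
      then have "vb (- 1) = c" using \<epsilon>(4) by simp
      then show False using c(1) by simp
    qed
    ultimately show ?thesis by (metis mult_left_cancel)
  qed
  have act_uj: "tilt_act \<sigma> (u ^ j) = \<epsilon> ^ j * u ^ j" for j
    using act_1 act_power[OF \<sigma>, of j u] by (cases "j = 0") (auto simp: \<epsilon>(2) power_mult_distrib)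
  let ?k = "Suc i"
  define tot where "tot = (\<Sum>j<p. piece x j)"
  obtain m0 where m0: "m0 \<in> N" "tot = cscale (u ^ ?k) m0" using sum by (auto simp: tot_def)
  (* sigma - 1 on the sum, first from its divisibility by u ^ Suc i, then piece by piece; there the terms
     phi ((sigma - 1) (x j)) are divisible by u ^ (p + c) and drop out because Suc i <= p. *)
  have X1: "gact \<sigma> tot - tot \<in> thick N (?k + c)"
  proof -
    have "gact \<sigma> tot = cscale (\<epsilon> ^ ?k * u ^ ?k) (gact \<sigma> m0)"
      unfolding m0(2) gact_cscale[OF \<sigma>] act_uj ..
    then have "gact \<sigma> tot - tot = cscale (\<epsilon> ^ ?k * u ^ ?k) (gact \<sigma> m0 - m0) + cscale ((\<epsilon> ^ ?k - 1) * u ^ ?k) m0"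
      by (simp only: m0(2) cs.scale_right_diff_distrib left_diff_distrib mult_1 cs.scale_left_diff_distrib) simp
    moreover have "cscale (\<epsilon> ^ ?k * u ^ ?k) (gact \<sigma> m0 - m0) \<in> thick N (?k + c)"
      by (rule thick_scale[OF u_pow_O_mult_left[OF \<epsilon>pow u_in_O] crys[OF \<sigma>(1) m0(1)]])
    moreover have "cscale ((\<epsilon> ^ ?k - 1) * u ^ ?k) m0 \<in> thick N (?k + c)"
      using thick_scale[OF u_pow_O_mult[OF \<epsilon>j u_in_O] thick_member[OF m0(1)], of ?k ?k] by (simp add: add.commute)
    ultimately show ?thesis by (simp only: span_over_add)
  qed
  define rem where "rem j = cscale (tilt_act \<sigma> (u ^ j)) (frob (gact \<sigma> (x j))) - cscale (\<epsilon> ^ j * u ^ j) (frob (x j))" for j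
  have R: "rem j \<in> thick N (?k + c)" if j: "j < p" for j
  proof -
    have "rem j = cscale (\<epsilon> ^ j * u ^ j) (frob (gact \<sigma> (x j) - x j))"
      by (simp only: rem_def act_uj frob_diff cs.scale_right_diff_distrib)
    moreover have "frob (gact \<sigma> (x j) - x j) \<in> thick N (p * c)"
      by (rule frob_thick[OF frobN crys[OF \<sigma>(1) x[OF j]]])
    moreover have "\<epsilon> ^ j * u ^ j \<in> u_pow_O 0"
      by (rule u_pow_O_mult_left[OF \<epsilon>pow u_pow_O_mono[OF u_in_O]]) simp
    ultimately have "rem j \<in> thick N (0 + p * c)" using thick_scale by metis
    then show ?thesis by (rule thick_mono) (use c i in simp)
  qed
  have piece_eq: "gact \<sigma> (piece x j) - piece x j = rem j + cscale (\<epsilon> ^ j - 1) (piece x j)" for j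
    by (simp add: rem_def gact_cscale[OF \<sigma>] gact_frob[OF \<sigma>] left_diff_distrib cs.scale_left_diff_distrib)
  have Xsum: "gact \<sigma> tot - tot = (\<Sum>j<p. rem j) + (\<Sum>j<p. cscale (\<epsilon> ^ j - 1) (piece x j))"
    by (simp only: tot_def gact_sum[OF \<sigma>] sum_subtractf[symmetric] piece_eq sum.distrib)
  have "(\<Sum>j<p. cscale (\<epsilon> ^ j - 1) (piece x j)) = (gact \<sigma> tot - tot) - (\<Sum>j<p. rem j)"
    unfolding Xsum by simp
  also have "\<dots> \<in> thick N (?k + c)"
    by (intro thick_diff X1 thick_sum R) simp
  finally have Y: "(\<Sum>j<p. cscale (\<epsilon> ^ j - 1) (piece x j)) \<in> thick N (?k + c)" .
  have "(\<Sum>j<p. cscale (q j) (piece x j)) = cscale (1 / (\<epsilon> - 1)) (\<Sum>j<p. cscale (\<epsilon> ^ j - 1) (piece x j))"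
    unfolding q using \<epsilon>(3) by (simp add: cs.scale_sum_right)
  also have "\<dots> \<in> thick N (- c + (?k + c))" by (rule thick_scale[OF \<epsilon>1(2) Y])
  finally have Q: "(\<Sum>j<p. cscale (q j) (piece x j)) \<in> thick N ?k" by simp
  have Z: "cscale (q j - of_nat j) (piece x j) \<in> thick N ?k" if j: "j < p" for j
  proof -
    obtain y where y: "y \<in> N" "piece x j = cscale (u ^ i) y" using pieces[OF j] by blast
    have "piece x j \<in> thick N (real i + 0)" unfolding y(2) by (rule thick_scale[OF u_in_O thick_member[OF y(1)]])
    from thick_scale[OF qj this] show ?thesis by (rule thick_mono) (use c in simp)
  qed
  have "(\<Sum>j<p. cscale (of_nat j) (piece x j)) =
      (\<Sum>j<p. cscale (q j) (piece x j)) - (\<Sum>j<p. cscale (q j - of_nat j) (piece x j))"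
    unfolding cs.scale_left_diff_distrib sum_subtractf by simp
  also have "\<dots> \<in> thick N ?k"
    by (intro thick_diff Q thick_sum Z) simp
  finally have thick: "(\<Sum>j<p. cscale (of_nat j) (piece x j)) \<in> thick N (real ?k)" .
  have "(\<Sum>j<p. cscale (of_nat j) (piece x j)) \<in> N"
    by (intro SF_submoduleD(3,4)[OF sub] frobN x u_power_kuu is_subring_of_nat[OF kuu_subring]) simp
  from thick_inter_lattice[OF I thick this] show ?thesis .
qed

lemma lattice_multiple:
  assumes "SF_submodule N"
  shows "x \<in> cscale (u ^ k) ` N \<Longrightarrow> y \<in> cscale (u ^ k) ` N \<Longrightarrow> x - y \<in> cscale (u ^ k) ` N"
    "c \<in> kuu \<Longrightarrow> x \<in> cscale (u ^ k) ` N \<Longrightarrow> cscale c x \<in> cscale (u ^ k) ` N"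
proof -
  show "x - y \<in> cscale (u ^ k) ` N" if xy: "x \<in> cscale (u ^ k) ` N" "y \<in> cscale (u ^ k) ` N"
  proof -
    obtain a b where "a \<in> N" "b \<in> N" "x = cscale (u ^ k) a" "y = cscale (u ^ k) b" using xy by blast
    then show ?thesis
      using SF_submoduleD(5)[OF assms] by (intro image_eqI[of _ _ "a - b"]) (auto simp: cs.scale_right_diff_distrib)
  qed
  show "cscale c x \<in> cscale (u ^ k) ` N" if c: "c \<in> kuu" "x \<in> cscale (u ^ k) ` N"
  proof -
    obtain a where "a \<in> N" "x = cscale (u ^ k) a" using c by blast
    then show ?thesis
      using SF_submoduleD(3)[OF assms] c by (intro image_eqI[of _ _ "cscale c a"]) (auto simp: mult.commute)
  qed
qed

text \<open>
  Induction on \<open>i\<close>: the operator multiplying the piece of degree \<open>j\<close> by \<open>j\<close> preserves divisibility of the sum by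
  \<open>u ^ i\<close>, and its eigenvalues \<open>j < p\<close> are distinct modulo \<open>p\<close>.
\<close>

lemma pieces_divisible:
  assumes N: "N \<in> L_crys M p" and I: "finite I" "N = lincomb cscale kuu I m" "indep_family cscale UNIV I m"
    and i: "i \<le> p" and x: "\<And>j. j < p \<Longrightarrow> x j \<in> N" and sum: "(\<Sum>j<p. piece x j) \<in> cscale (u ^ i) ` N" and j: "j < p"
  shows "piece x j \<in> cscale (u ^ i) ` N"
  using i x sum j
proof (induction i arbitrary: x j)
  case 0
  have "span_over kuu (frob ` N) \<subseteq> N" "SF_submodule N" using N by (auto simp: L_crys_def L_le_def)
  then have "piece x j \<in> N"
    using span_over_member[OF is_subringD(2)[OF kuu_subring], of "frob (x j)" "frob ` N"] 0(2,4)
      SF_submoduleD(3)[OF _ u_power_kuu] by blast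
  then show ?case by simp
next
  case (Suc i)
  have sub: "SF_submodule N" using N by (auto simp: L_crys_def L_le_def)
  define good where "good y \<longleftrightarrow> (\<forall>j<p. y j \<in> N) \<and> (\<forall>j<p. piece y j \<in> cscale (u ^ i) ` N) \<and>
      (\<Sum>j<p. piece y j) \<in> cscale (u ^ Suc i) ` N" for y
  have "(\<Sum>j<p. piece x j) \<in> cscale (u ^ i) ` N"
  proof -
    obtain a where a: "a \<in> N" "(\<Sum>j<p. piece x j) = cscale (u ^ Suc i) a" using Suc(4) by blast
    have "(\<Sum>j<p. piece x j) = cscale (u ^ i) (cscale u a)" unfolding a(2) by (simp add: mult.commute)
    then show ?thesis using SF_submoduleD(3)[OF sub u_in_kuu a(1)] by blast
  qed
  then have "good x"
    unfolding good_def using Suc.IH[of x] Suc.prems by auto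
  have step: "good (\<lambda>j. cscale (of_int (int j - l)) (y j))" if y: "good y" for y l
  proof -
    have 1: "(\<Sum>j<p. cscale (of_nat j) (piece y j)) \<in> cscale (u ^ Suc i) ` N"
      by (rule euler_step[OF N I _ Suc(2)]) (use y in \<open>auto simp: good_def\<close>)
    have 2: "cscale (of_int l) (\<Sum>j<p. piece y j) \<in> cscale (u ^ Suc i) ` N"
      by (rule lattice_multiple(2)[OF sub of_int_kuu]) (use y in \<open>auto simp: good_def\<close>)
    have "(\<Sum>j<p. piece (\<lambda>j. cscale (of_int (int j - l)) (y j)) j) =
        (\<Sum>j<p. cscale (of_nat j) (piece y j)) - cscale (of_int l) (\<Sum>j<p. piece y j)"
      unfolding piece_of_int[where a = "\<lambda>j. int j - l"] cs.scale_sum_right sum_subtractf[symmetric] cs.scale_left_diff_distrib[symmetric]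
      by simp
    then have "(\<Sum>j<p. piece (\<lambda>j. cscale (of_int (int j - l)) (y j)) j) \<in> cscale (u ^ Suc i) ` N"
      using lattice_multiple(1)[OF sub 1 2] by simp
    moreover have "piece (\<lambda>j. cscale (of_int (int j - l)) (y j)) j \<in> cscale (u ^ i) ` N" if "j < p" for j
      unfolding piece_of_int[where a = "\<lambda>j. int j - l"]
      by (rule lattice_multiple(2)[OF sub of_int_kuu]) (use y that in \<open>auto simp: good_def\<close>)
    moreover have "cscale (of_int (int j - l)) (y j) \<in> N" if "j < p" for j
      by (rule SF_submoduleD(3)[OF sub of_int_kuu]) (use y that in \<open>auto simp: good_def\<close>)
    ultimately show ?thesis unfolding good_def by blast
  qed
  have iter: "good (\<lambda>j. cscale (of_int (\<Prod>l\<in>S. int j - int l)) (x j))" if "finite S" for S :: "nat set"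
    using that
  proof (induction S)
    case empty
    show ?case using \<open>good x\<close> by simp
  next
    case (insert l S)
    show ?case using step[OF insert(3), of "int l"] insert(1,2) by simp
  qed
  define S where "S = {..<p} - {j}"
  define a where "a j' = (\<Prod>l\<in>S. int j' - int l)" for j' :: nat
  have "(\<Sum>j'<p. piece (\<lambda>j. cscale (of_int (a j)) (x j)) j') = (\<Sum>j'<p. if j' = j then cscale (of_int (a j)) (piece x j) else 0)"
  proof (rule sum.cong[OF refl])
    fix j' assume j': "j' \<in> {..<p}"
    show "piece (\<lambda>j. cscale (of_int (a j)) (x j)) j' = (if j' = j then cscale (of_int (a j)) (piece x j) else 0)"
    proof (cases "j' = j")
      case False
      then have "a j' = 0" using j' unfolding a_def by (intro prod_zero) (auto simp: S_def)
      then show ?thesis using False unfolding piece_of_int by simp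
    qed (simp add: frob_cscale frobenius_of_int mult.commute)
  qed
  also have "\<dots> = cscale (of_int (a j)) (piece x j)" using Suc(5) by simp
  finally have aj: "cscale (of_int (a j)) (piece x j) \<in> cscale (u ^ Suc i) ` N"
    using iter[of S] by (simp add: good_def a_def S_def)
  have "\<not> int p dvd a j"
  proof
    assume "int p dvd a j"
    then obtain l where l: "l \<in> S" "int p dvd int j - int l"
      unfolding a_def using prime_dvd_prod_iff[of S "int p" "\<lambda>l. int j - int l"] prime_p by (auto simp: S_def)
    then have "\<bar>int j - int l\<bar> < int p" "int j - int l \<noteq> 0" using Suc(5) by (auto simp: S_def)
    then show False using l(2) dvd_imp_le_int[of "int j - int l" "int p"] by simp
  qed
  then have a0: "of_int (a j) \<noteq> (0 :: 'd)" by (rule of_int_prime_to_p)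
  (* a j lies in the prime field, so its inverse is its power with exponent p - 2. *)
  have "(of_int (a j) :: 'd) * of_int (a j) ^ (p - 2) * of_int (a j) = of_int (a j) ^ p"
    using p_ge_2 by (simp flip: power_Suc power_Suc2 add: Suc_diff_Suc numeral_2_eq_2)
  then have "(of_int (a j) :: 'd) ^ (p - 2) * of_int (a j) = 1"
    using a0 by (simp add: frobenius_of_int mult.commute)
  then have eq: "cscale (of_int (a j) ^ (p - 2)) (cscale (of_int (a j)) (piece x j)) = piece x j"
    by (simp only: cs.scale_scale mult_1 mult.assoc[symmetric])
  have "cscale (of_int (a j) ^ (p - 2)) (cscale (of_int (a j)) (piece x j)) \<in> cscale (u ^ Suc i) ` N"
    by (rule lattice_multiple(2)[OF sub is_subring_power[OF kuu_subring of_int_kuu] aj])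
  then show ?case unfolding eq .
qed

end

section \<open>An adapted basis\<close>

context galois_rep
begin

text \<open>
  In coordinates for the basis \<open>\<phi> (b j)\<close> of \<open>M\<close> this is the uniqueness of the decomposition of \<open>k((u))\<close> over the \<open>p\<close>-th powers.
\<close>

lemma grading_unique:
  assumes M: "M = lincomb cscale ku {..<n} b" and indep: "indep_family cscale ku {..<n} (\<lambda>j. frob (b j))"
    and y: "\<And>s. s < p \<Longrightarrow> y s \<in> M" and sum: "(\<Sum>s<p. cscale (u ^ s) (frob (y s))) = 0" and s: "s < p"
  shows "frob (y s) = 0"
proof -
  have "\<forall>s. \<exists>\<beta>. s < p \<longrightarrow> (\<forall>j<n. \<beta> j \<in> ku) \<and> y s = (\<Sum>j<n. cscale (\<beta> j) (b j))"
    using y unfolding M lincomb_def by fastforce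
  then obtain \<beta> where \<beta>: "\<And>s j. s < p \<Longrightarrow> j < n \<Longrightarrow> \<beta> s j \<in> ku" "\<And>s. s < p \<Longrightarrow> y s = (\<Sum>j<n. cscale (\<beta> s j) (b j))"
    by metis
  have fy: "frob (y s) = (\<Sum>j<n. cscale (\<beta> s j ^ p) (frob (b j)))" if "s < p" for s
    unfolding \<beta>(2)[OF that] by (simp add: frob_sum frob_cscale)
  have "0 = (\<Sum>s<p. \<Sum>j<n. cscale (u ^ s * \<beta> s j ^ p) (frob (b j)))"
    unfolding sum[symmetric] by (rule sum.cong[OF refl]) (simp add: fy cs.scale_sum_right)
  also have "\<dots> = (\<Sum>j<n. cscale (\<Sum>s<p. u ^ s * \<beta> s j ^ p) (frob (b j)))"
    by (subst sum.swap) (simp add: cs.scale_sum_left)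
  finally have 0: "(\<Sum>j<n. cscale (\<Sum>s<p. u ^ s * \<beta> s j ^ p) (frob (b j))) = 0" by simp
  have ku: "(\<Sum>s<p. u ^ s * \<beta> s j ^ p) \<in> ku" if "j < n" for j
    by (intro is_subring_sum[OF ku_subring] is_subringD(4)[OF ku_subring] is_subring_power[OF ku_subring] \<beta>(1) that
        kuu_subset_ku u_in_kuu) simp
  have "\<beta> s j = 0" if j: "j < n" for j
  proof (rule ku_decompose_unique[where \<beta> = "\<lambda>s. \<beta> s j"])
    show "(\<Sum>s<p. u ^ s * \<beta> s j ^ p) = 0"
      by (rule indep_familyD[OF indep _ 0]) (use ku j in auto)
  qed (use \<beta>(1) j s in auto)
  then show ?thesis using fy[OF s] p_ge_2 by (simp add: power_0_left)
qed

text \<open>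
  A basis \<open>h\<close> of \<open>N\<close> with exponents \<open>r\<close> exhibits \<open>N\<close> as strongly divisible if the \<open>u ^ r i \<cdot> h i\<close> form a basis of
  \<open>\<phi> (N)\<close>; here they are only asked to lie in it, and \<open>h\<close> to generate \<open>N\<close>.
\<close>

definition graded_generators ::
  "('v, 'd) tensor set \<Rightarrow> 'i set \<Rightarrow> ('i \<Rightarrow> ('v, 'd) tensor) \<Rightarrow> ('i \<Rightarrow> nat) \<Rightarrow> bool"
  where "graded_generators N I h r \<longleftrightarrow> finite I \<and> N = lincomb cscale kuu I h \<and>
    (\<forall>i\<in>I. r i \<le> p \<and> cscale (u ^ r i) (h i) \<in> frob ` N)"

text \<open>
  For a basis element \<open>m l\<close>, the element \<open>u ^ p \<cdot> m l\<close> is a sum of pieces \<open>u ^ j \<phi> (x j)\<close>, each of which lies in \<open>u ^ p N\<close>. So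
  \<open>m l\<close> is the sum of the elements \<open>u ^ j \<phi> (x j) / u ^ p\<close> of \<open>N\<close>, which \<open>u ^ (p - j)\<close> takes into \<open>\<phi> (N)\<close>.
\<close>

lemma exists_graded_generators:
  fixes m :: "'i \<Rightarrow> ('v, 'd) tensor"
  assumes N: "N \<in> L_crys M p" and I: "finite I" "N = lincomb cscale kuu I m" "indep_family cscale UNIV I m"
  shows "\<exists>(J :: ('i \<times> nat) set) h r. graded_generators N J h r"
proof -
  have sub: "SF_submodule N" and up: "cscale (u ^ p) ` N \<subseteq> span_over kuu (frob ` N)"
    using N by (auto simp: L_crys_def L_le_def)
  have mN: "m l \<in> N" if "l \<in> I" for l
    unfolding I(2) by (rule cs.lincomb_member[OF kuu_subring I(1) that])
  have "\<exists>h. (\<forall>j<p. h j \<in> N \<and> cscale (u ^ (p - j)) (h j) \<in> frob ` N) \<and> m l = (\<Sum>j<p. h j)" if l: "l \<in> I" for l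
  proof -
    have "cscale (u ^ p) (m l) \<in> span_over kuu (frob ` N)" using up mN[OF l] by blast
    then obtain n c t where t: "cscale (u ^ p) (m l) = (\<Sum>a<(n::nat). cscale (c a) (t a))"
        "\<forall>a<n. c a \<in> kuu" "\<forall>a<n. t a \<in> frob ` N"
      by (auto simp: span_over_def)
    have "\<forall>a. \<exists>s. a < n \<longrightarrow> s \<in> N \<and> t a = frob s" using t(3) by blast
    then obtain s where s: "\<And>a. a < n \<Longrightarrow> s a \<in> N" "\<And>a. a < n \<Longrightarrow> t a = frob (s a)" by metis
    have "\<forall>a. \<exists>w. a < n \<longrightarrow> (\<forall>j. w j \<in> kuu) \<and> c a = (\<Sum>j<p. u ^ j * w j ^ p)"
      using t(2) kuu_decompose by metis
    then obtain w where w: "\<And>a j. a < n \<Longrightarrow> w a j \<in> kuu" "\<And>a. a < n \<Longrightarrow> c a = (\<Sum>j<p. u ^ j * w a j ^ p)" by metis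
    define x where "x j = (\<Sum>a<n. cscale (w a j) (s a))" for j
    have xN: "x j \<in> N" for j
      unfolding x_def by (intro SF_submoduleD(3,4)[OF sub] w(1) s(1)) auto
    have "cscale (u ^ p) (m l) = (\<Sum>a<n. \<Sum>j<p. cscale (u ^ j * w a j ^ p) (frob (s a)))"
      unfolding t(1) by (rule sum.cong[OF refl]) (simp add: w(2) s(2) cs.scale_sum_left)
    also have "\<dots> = (\<Sum>j<p. piece x j)"
      by (subst sum.swap) (simp add: x_def frob_sum frob_cscale cs.scale_sum_right)
    finally have eq: "cscale (u ^ p) (m l) = (\<Sum>j<p. piece x j)" .
    have "(\<Sum>j<p. piece x j) \<in> cscale (u ^ p) ` N" unfolding eq[symmetric] using mN[OF l] by blast
    then have "piece x j \<in> cscale (u ^ p) ` N" if "j < p" for j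
      using pieces_divisible[OF N I order_refl, of x j] xN that by simp
    then have "\<forall>j. \<exists>h. j < p \<longrightarrow> h \<in> N \<and> piece x j = cscale (u ^ p) h" by blast
    then obtain h where h: "\<And>j. j < p \<Longrightarrow> h j \<in> N" "\<And>j. j < p \<Longrightarrow> piece x j = cscale (u ^ p) (h j)" by metis
    have "cscale (u ^ (p - j)) (h j) = frob (x j)" if j: "j < p" for j
    proof -
      have "cscale (u ^ j) (cscale (u ^ (p - j)) (h j)) = cscale (u ^ j) (frob (x j))"
        using h(2)[OF j] j by (simp flip: power_add)
      then show ?thesis using u_nonzero by (simp only: cs.scale_cancel_left) simp
    qed
    then have "\<forall>j<p. h j \<in> N \<and> cscale (u ^ (p - j)) (h j) \<in> frob ` N" using h(1) xN by blast
    moreover have "m l = (\<Sum>j<p. h j)"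
    proof -
      have "cscale (u ^ p) (m l) = cscale (u ^ p) (\<Sum>j<p. h j)"
        unfolding eq cs.scale_sum_right by (rule sum.cong[OF refl]) (simp add: h(2))
      then show ?thesis using u_nonzero by (simp only: cs.scale_cancel_left) simp
    qed
    ultimately show ?thesis by blast
  qed
  then obtain h where h: "\<And>l j. l \<in> I \<Longrightarrow> j < p \<Longrightarrow> h l j \<in> N"
      "\<And>l j. l \<in> I \<Longrightarrow> j < p \<Longrightarrow> cscale (u ^ (p - j)) (h l j) \<in> frob ` N" "\<And>l. l \<in> I \<Longrightarrow> m l = (\<Sum>j<p. h l j)"
    by metis
  let ?J = "I \<times> {..<p}" and ?h = "\<lambda>(l, j). h l j" and ?r = "\<lambda>(l, j). p - j"
  have fin: "finite ?J" using I(1) by simp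
  have "N \<subseteq> lincomb cscale kuu ?J ?h"
    unfolding I(2)
  proof (rule cs.lincomb_subset[OF kuu_subring])
    fix l assume l: "l \<in> I"
    show "m l \<in> lincomb cscale kuu ?J ?h"
      unfolding h(3)[OF l]
    proof (rule cs.lincomb_sum[OF kuu_subring])
      fix j assume "j \<in> {..<p}"
      then show "h l j \<in> lincomb cscale kuu ?J ?h"
        using cs.lincomb_member[OF kuu_subring fin, of "(l, j)" ?h] l by simp
    qed
  qed
  moreover have "lincomb cscale kuu ?J ?h \<subseteq> N"
  proof
    fix z assume "z \<in> lincomb cscale kuu ?J ?h"
    then obtain c where c: "\<forall>i\<in>?J. c i \<in> kuu" "z = (\<Sum>i\<in>?J. cscale (c i) (?h i))" by (rule lincombE)
    show "z \<in> N" unfolding c(2)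
      by (intro SF_submoduleD(4)[OF sub] SF_submoduleD(3)[OF sub]) (use c(1) h(1) in auto)
  qed
  ultimately have "graded_generators N ?J ?h ?r"
    unfolding graded_generators_def using fin h(2) by auto
  then show ?thesis by blast
qed

text \<open>
  Take graded generators with \<open>\<Sum>i\<in>I. r i + 1\<close> minimal. None of them is redundant, so they form a basis. If an
  element of \<open>\<phi> (N)\<close> is a combination in which \<open>h l\<close> has a unit coefficient, then it can replace
  \<open>h l\<close> with exponent \<open>0\<close>; so \<open>r l = 0\<close> by minimality. Now expand an element of \<open>\<phi> (N)\<close> as \<open>\<Sum>i\<in>I. c i \<cdot> h i\<close>.
  Comparing the parts of degree \<open>0\<close> gives \<open>c i = u ^ r i * \<gamma> ^ p\<close> for some \<open>\<gamma>\<close> in \<open>k((u))\<close>. If \<open>\<gamma>\<close> were not integral,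
  then \<open>r i \<le> p\<close> would force \<open>r i = p\<close> and \<open>c i\<close> to be a unit, which was just excluded.
\<close>

lemma exists_adapted_basis:
  fixes h0 :: "'i \<Rightarrow> ('v, 'd) tensor"
  assumes sub: "SF_submodule N" and gen: "graded_generators N I0 h0 r0" and NM: "N \<subseteq> M" and phi: "frob ` N \<subseteq> N"
    and M: "M = lincomb cscale ku {..<n} b" and b: "indep_family cscale ku {..<n} (\<lambda>j. frob (b j))"
  shows "\<exists>(I :: 'i set) h r. finite I \<and> N = lincomb cscale kuu I h \<and> indep_family cscale kuu I h \<and>
    frob ` N = lincomb cscale (power_series (u ^ p)) I (\<lambda>i. cscale (u ^ r i) (h i)) \<and>
    indep_family cscale (power_series (u ^ p)) I (\<lambda>i. cscale (u ^ r i) (h i))"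
proof -
  define weight where "weight = (\<lambda>(I :: 'i set, h :: 'i \<Rightarrow> ('v, 'd) tensor, r). \<Sum>i\<in>I. r i + (1 :: nat))"
  define P where "P = (\<lambda>(I :: 'i set, h, r). graded_generators N I h r)"
  have "P (I0, h0, r0)" using gen by (simp add: P_def)
  then obtain t where t: "P t" "\<And>t'. P t' \<Longrightarrow> weight t \<le> weight t'"
    using ex_has_least_nat[of P "(I0, h0, r0)" weight] by blast
  obtain I h r where t_eq: "t = (I, h, r)" by (cases t)
  have G: "graded_generators N I h r" using t(1) by (simp add: t_eq P_def)
  have min: "(\<Sum>i\<in>I. r i + 1) \<le> (\<Sum>i\<in>I'. r' i + 1)" if "graded_generators N I' h' r'" for I' :: "'i set" and h' r'
    using t(2)[of "(I', h', r')"] that by (simp add: t_eq P_def weight_def)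
  have fin: "finite I" and N: "N = lincomb cscale kuu I h"
    and r: "\<And>i. i \<in> I \<Longrightarrow> r i \<le> p" "\<And>i. i \<in> I \<Longrightarrow> cscale (u ^ r i) (h i) \<in> frob ` N"
    using G by (auto simp: graded_generators_def)
  have indep: "indep_family cscale kuu I h"
  proof (rule cs.irredundant_imp_indep[OF kuu_subring kuu_division fin])
    fix l assume l: "l \<in> I"
    show "h l \<notin> lincomb cscale kuu (I - {l}) h"
    proof
      assume "h l \<in> lincomb cscale kuu (I - {l}) h"
      then have "N = lincomb cscale kuu (I - {l}) h"
        using cs.lincomb_remove[OF kuu_subring fin, of h l] N by simp
      then have "graded_generators N (I - {l}) h r" using fin r by (auto simp: graded_generators_def)
      from min[OF this] show False using fin l by (simp add: sum.remove[of I l])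
    qed
  qed
  have indep_ku: "indep_family cscale ku I h" by (rule indep_kuu_imp_ku[OF fin indep])
  let ?w = "\<lambda>i. cscale (u ^ r i) (h i)"
  have "\<forall>i\<in>I. \<exists>y. y \<in> N \<and> ?w i = frob y" using r(2) by blast
  then obtain y where y: "\<And>i. i \<in> I \<Longrightarrow> y i \<in> N" "\<And>i. i \<in> I \<Longrightarrow> ?w i = frob (y i)" by metis
  have unit: "r l = 0" if lam: "lam \<in> frob ` N" "\<forall>i\<in>I. c i \<in> kuu" "lam = (\<Sum>i\<in>I. cscale (c i) (h i))"
    and l: "l \<in> I" "c l \<noteq> 0" "vb (c l) = 0" for lam c l
  proof (rule ccontr)
    assume rl: "r l \<noteq> 0"
    define h' where "h' = h(l := lam)"
    define r' where "r' = r(l := 0)"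
    have lamN: "lam \<in> N" using lam(1) phi by blast
    have hN: "h i \<in> N" if "i \<in> I" for i unfolding N by (rule cs.lincomb_member[OF kuu_subring fin that])
    have div: "c i / c l \<in> kuu" if "i \<in> I" for i
    proof (rule kuu_divide)
      show "c i / c l \<in> u_pow_O 0"
        using kuu_subset_O[of "c i"] lam(2) that l by (cases "c i = 0") (auto simp: u_pow_O_def vb_divide)
    qed (use lam(2) that l in auto)
    have inv: "1 / c l \<in> kuu"
    proof (rule kuu_divide)
      show "1 / c l \<in> u_pow_O 0" using l by (simp add: u_pow_O_def vb_divide)
    qed (use lam(2) l is_subringD(2)[OF kuu_subring] in auto)
    have mem: "h' i \<in> lincomb cscale kuu I h'" if "i \<in> I" for i by (rule cs.lincomb_member[OF kuu_subring fin that])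
    have "h l \<in> lincomb cscale kuu I h'"
    proof (rule cs.lincomb_isolate[OF kuu_subring fin l(1) lam(3) l(2) div])
      show "cscale (1 / c l) lam \<in> lincomb cscale kuu I h'"
        using cs.lincomb_scale[OF kuu_subring inv mem[OF l(1)]] by (simp add: h'_def)
      show "h i \<in> lincomb cscale kuu I h'" if "i \<in> I - {l}" for i
        using mem[of i] that by (simp add: h'_def)
    qed
    then have "h i \<in> lincomb cscale kuu I h'" if "i \<in> I" for i
      using mem[OF that] by (cases "i = l") (simp_all add: h'_def)
    then have "N \<subseteq> lincomb cscale kuu I h'" unfolding N by (rule cs.lincomb_subset[OF kuu_subring])
    moreover have "lincomb cscale kuu I h' \<subseteq> N"
      unfolding N
    proof (rule cs.lincomb_subset[OF kuu_subring])
      fix i assume "i \<in> I"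
      then show "h' i \<in> lincomb cscale kuu I h" using hN lamN by (simp add: h'_def flip: N)
    qed
    ultimately have "graded_generators N I h' r'"
      using fin r lam(1) by (auto simp: graded_generators_def h'_def r'_def)
    from min[OF this] have "(\<Sum>i\<in>I. r i + 1) \<le> (\<Sum>i\<in>I. r' i + 1)" .
    moreover have "(\<Sum>i\<in>I. r' i + 1) < (\<Sum>i\<in>I. r i + 1)"
      by (rule sum_strict_mono_ex1[OF fin]) (use l(1) rl in \<open>auto simp: r'_def\<close>)
    ultimately show False by simp
  qed
  have "frob ` N \<subseteq> lincomb cscale (power_series (u ^ p)) I ?w"
  proof
    fix lam assume lam: "lam \<in> frob ` N"
    then obtain z where z: "z \<in> N" "lam = frob z" by blast
    have "lam \<in> N" using lam phi by blast
    then obtain c where c: "\<forall>i\<in>I. c i \<in> kuu" "lam = (\<Sum>i\<in>I. cscale (c i) (h i))" unfolding N by (rule lincombE)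
    have "\<forall>i. \<exists>\<gamma>. i \<in> I \<longrightarrow> (\<forall>s. \<gamma> s \<in> ku) \<and> c i / u ^ r i = (\<Sum>s<p. u ^ s * \<gamma> s ^ p)"
    proof
      fix i
      show "\<exists>\<gamma>. i \<in> I \<longrightarrow> (\<forall>s. \<gamma> s \<in> ku) \<and> c i / u ^ r i = (\<Sum>s<p. u ^ s * \<gamma> s ^ p)"
      proof (cases "i \<in> I")
        case True
        then have "c i / u ^ r i \<in> ku" using c(1) kuu_subset_ku u_inverse_ku by blast
        then obtain \<gamma> where "\<And>s. \<gamma> s \<in> ku" "c i / u ^ r i = (\<Sum>s<p. u ^ s * \<gamma> s ^ p)"
          by (rule ku_decompose) blast
        then show ?thesis by blast
      qed simp
    qed
    then obtain \<gamma> where \<gamma>: "\<And>i s. i \<in> I \<Longrightarrow> \<gamma> i s \<in> ku" "\<And>i. i \<in> I \<Longrightarrow> c i / u ^ r i = (\<Sum>s<p. u ^ s * \<gamma> i s ^ p)"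
      by metis
    (* x s is the difference of the two expressions for the part of lam of degree s. *)
    define x where "x s = (\<Sum>i\<in>I. cscale (\<gamma> i s) (y i)) - (if s = 0 then z else 0)" for s :: nat
    have frob_x: "frob (x s) = (\<Sum>i\<in>I. cscale (\<gamma> i s ^ p) (?w i)) - (if s = 0 then lam else 0)" for s
    proof -
      have "frob (\<Sum>i\<in>I. cscale (\<gamma> i s) (y i)) = (\<Sum>i\<in>I. cscale (\<gamma> i s ^ p) (?w i))"
        unfolding frob_sum by (rule sum.cong[OF refl]) (simp only: frob_cscale y(2))
      then show ?thesis by (simp add: x_def frob_diff frob_zero z(2))
    qed
    have "(\<Sum>s<p. cscale (u ^ s) (frob (x s))) = 0"
    proof -
      have "lam = (\<Sum>i\<in>I. cscale (c i / u ^ r i) (?w i))"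
        unfolding c(2) using u_nonzero by simp
      also have "\<dots> = (\<Sum>i\<in>I. \<Sum>s<p. cscale (u ^ s * \<gamma> i s ^ p) (?w i))"
        by (rule sum.cong[OF refl]) (simp only: \<gamma>(2) cs.scale_sum_left)
      also have "\<dots> = (\<Sum>s<p. cscale (u ^ s) (\<Sum>i\<in>I. cscale (\<gamma> i s ^ p) (?w i)))"
        by (subst sum.swap) (simp only: cs.scale_sum_right cs.scale_scale mult.assoc)
      finally have 1: "lam = (\<Sum>s<p. cscale (u ^ s) (\<Sum>i\<in>I. cscale (\<gamma> i s ^ p) (?w i)))" .
      have 2: "(\<Sum>s<p. cscale (u ^ s) (if s = 0 then lam else 0)) = lam"
        using p_ge_2 by (simp add: if_distrib[of "cscale _"] if_distrib[of "\<lambda>x. cscale x _"] sum.delta cong: if_cong)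
      show ?thesis
        unfolding frob_x cs.scale_right_diff_distrib sum_subtractf 2 using 1 by simp
    qed
    moreover have "x s \<in> M" for s
    proof -
      have Msum: "(\<Sum>i\<in>I. cscale (\<gamma> i s) (y i)) \<in> M"
        unfolding M using y(1) NM \<gamma>(1)
        by (intro cs.lincomb_sum[OF ku_subring] cs.lincomb_scale[OF ku_subring]) (auto simp: M)
      moreover have "(if s = 0 then - z else 0) \<in> M"
        using cs.lincomb_scale[OF ku_subring is_subringD(5)[OF ku_subring is_subringD(2)[OF ku_subring]], of z "{..<n}" b]
          cs.lincomb_zero[OF ku_subring] z(1) NM by (auto simp: M)
      ultimately have "(\<Sum>i\<in>I. cscale (\<gamma> i s) (y i)) + (if s = 0 then - z else 0) \<in> M"
        unfolding M by (rule cs.lincomb_add[OF ku_subring])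
      then show ?thesis by (simp add: x_def split: if_splits)
    qed
    ultimately have "frob (x 0) = 0" by (intro grading_unique[OF M b]) auto
    then have lam_eq: "lam = (\<Sum>i\<in>I. cscale (\<gamma> i 0 ^ p) (?w i))" unfolding frob_x by simp
    have c_eq: "c i = u ^ r i * \<gamma> i 0 ^ p" if i: "i \<in> I" for i
    proof -
      have "(\<Sum>i\<in>I. cscale (c i - u ^ r i * \<gamma> i 0 ^ p) (h i)) = lam - lam"
        unfolding cs.scale_left_diff_distrib sum_subtractf
        by (subst (1) lam_eq, subst c(2)) (simp add: mult.commute)
      moreover have "c i - u ^ r i * \<gamma> i 0 ^ p \<in> ku" if "i \<in> I" for i
        by (intro is_subringD(4,6)[OF ku_subring] is_subring_power[OF ku_subring] \<gamma>(1) that kuu_subset_ku u_in_kuu c(1)[rule_format])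
      ultimately have "c i - u ^ r i * \<gamma> i 0 ^ p = 0"
        using indep_familyD[OF indep_ku, of "\<lambda>i. c i - u ^ r i * \<gamma> i 0 ^ p" i] i by simp
      then show ?thesis by simp
    qed
    have "\<gamma> i 0 \<in> kuu" if i: "i \<in> I" for i
    proof (rule ku_integral[OF \<gamma>(1)[OF i]], rule ccontr)
      assume "\<gamma> i 0 \<notin> u_pow_O 0"
      then have nz: "\<gamma> i 0 \<noteq> 0" and neg: "vb (\<gamma> i 0) < 0" by (auto simp: u_pow_O_def)
      obtain k :: int where k: "vb (\<gamma> i 0) = k" using ku_vb[OF \<gamma>(1)[OF i] nz] by blast
      have ci: "c i \<noteq> 0" "vb (c i) = r i + p * vb (\<gamma> i 0)"
        using nz u_nonzero by (simp_all add: c_eq[OF i] vb_mult vb_power)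
      have "vb (c i) \<ge> 0" using kuu_subset_O[of "c i"] c(1) i ci(1) by (simp add: u_pow_O_def)
      moreover have "vb (\<gamma> i 0) \<le> - 1" using neg k by simp
      then have "real p * vb (\<gamma> i 0) \<le> real p * (- 1)" by (intro mult_left_mono) auto
      ultimately have "real p \<le> real (r i)" using ci(2) by linarith
      then have "r i = p" using r(1)[OF i] by simp
      then have "vb (c i) = 0" "r i \<noteq> 0"
        using \<open>vb (c i) \<ge> 0\<close> \<open>real p * vb (\<gamma> i 0) \<le> real p * (- 1)\<close> ci(2) p_pos by auto
      then show False using unit[OF lam c i ci(1)] by simp
    qed
    then have "\<gamma> i 0 ^ p \<in> power_series (u ^ p)" if "i \<in> I" for i
      using that by (simp add: power_series_frobenius)
    then show "lam \<in> lincomb cscale (power_series (u ^ p)) I ?w"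
      using lam_eq by (intro lincombI[of I "\<lambda>i. \<gamma> i 0 ^ p" _ lam cscale ?w]) auto
  qed
  moreover have "lincomb cscale (power_series (u ^ p)) I ?w \<subseteq> frob ` N"
  proof
    fix x assume "x \<in> lincomb cscale (power_series (u ^ p)) I ?w"
    then obtain e where e: "\<forall>i\<in>I. e i \<in> power_series (u ^ p)" "x = (\<Sum>i\<in>I. cscale (e i) (?w i))" by (rule lincombE)
    have "\<forall>i\<in>I. \<exists>a. a \<in> kuu \<and> e i = a ^ p" using e(1) unfolding power_series_frobenius by blast
    then obtain a where a: "\<And>i. i \<in> I \<Longrightarrow> a i \<in> kuu" "\<And>i. i \<in> I \<Longrightarrow> e i = a i ^ p" by metis
    have "x = frob (\<Sum>i\<in>I. cscale (a i) (y i))"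
      unfolding e(2) frob_sum by (rule sum.cong[OF refl]) (simp only: frob_cscale a(2) y(2))
    moreover have "(\<Sum>i\<in>I. cscale (a i) (y i)) \<in> N"
      by (intro SF_submoduleD(4)[OF sub] SF_submoduleD(3)[OF sub] a(1) y(1))
    ultimately show "x \<in> frob ` N" by blast
  qed
  moreover have "indep_family cscale (power_series (u ^ p)) I ?w"
    unfolding indep_family_def
  proof (intro allI impI ballI)
    fix e i assume e: "\<forall>i\<in>I. e i \<in> power_series (u ^ p)" "(\<Sum>i\<in>I. cscale (e i) (?w i)) = 0" and i: "i \<in> I"
    have "e i * u ^ r i \<in> kuu" if "i \<in> I" for i
      using e(1) that unfolding power_series_frobenius
      by (auto intro!: is_subringD(4)[OF kuu_subring] is_subring_power[OF kuu_subring] u_in_kuu)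
    then have "e i * u ^ r i = 0"
      using indep_familyD[OF indep, of "\<lambda>i. e i * u ^ r i" i] e(2) i by simp
    then show "e i = 0" using u_nonzero by simp
  qed
  ultimately have "frob ` N = lincomb cscale (power_series (u ^ p)) I ?w \<and>
      indep_family cscale (power_series (u ^ p)) I ?w" by blast
  then show ?thesis using fin N indep by blast
qed

lemma L_crys_subset_L_SD:
  assumes M: "etale_phi_module M"
  shows "L_crys M p \<subseteq> L_SD M"
proof
  fix N assume N: "N \<in> L_crys M p"
  then have le: "N \<in> L_le M p" by (simp add: L_crys_def)
  then have sub: "SF_submodule N" and proj: "SF_finite_projective N" and NM: "N \<subseteq> M"
    and M_eq: "{x. \<exists>n::nat. cscale (u ^ n) x \<in> N} = M" and phi: "span_over kuu (frob ` N) \<subseteq> N"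
    by (auto simp: L_le_def)
  obtain n b where b: "is_basis ku M n b" "is_basis UNIV UNIV n b" "is_basis ku M n (\<lambda>i. frob (b i))"
    using M by (auto simp: etale_phi_module_def)
  obtain I0 :: "(nat \<times> 'f) set" and g where g: "finite I0" "N = lincomb cscale kuu I0 g"
    using finite_projective_generated[OF sub proj] by blast
  obtain I1 where I1: "I1 \<subseteq> I0" "lincomb cscale kuu I1 g = lincomb cscale kuu I0 g" "indep_family cscale kuu I1 g"
    using cs.exists_indep_subfamily[OF kuu_subring kuu_division g(1)] by blast
  have fin: "finite I1" using I1(1) g(1) by (rule finite_subset)
  have N1: "N = lincomb cscale kuu I1 g" using g(2) I1(2) by simp
  have "indep_family cscale UNIV I1 g"
    by (rule indep_kuu_imp_UNIV[OF fin I1(3) N1 NM M_eq b(1,2)])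
  then obtain J :: "((nat \<times> 'f) \<times> nat) set" and h r where "graded_generators N J h r"
    using exists_graded_generators[OF N fin N1] by blast
  moreover have "frob ` N \<subseteq> N"
    using phi span_over_member[OF is_subringD(2)[OF kuu_subring], of _ "frob ` N"] by blast
  moreover have "M = lincomb cscale ku {..<n} b" "indep_family cscale ku {..<n} (\<lambda>i. frob (b i))"
    using b(1,3) by (simp_all add: is_basis_iff)
  ultimately obtain I :: "((nat \<times> 'f) \<times> nat) set" and h r where I: "finite I" "N = lincomb cscale kuu I h"
    "indep_family cscale kuu I h"
    "frob ` N = lincomb cscale (power_series (u ^ p)) I (\<lambda>i. cscale (u ^ r i) (h i))"
    "indep_family cscale (power_series (u ^ p)) I (\<lambda>i. cscale (u ^ r i) (h i))"
    using exists_adapted_basis[OF sub _ NM] by blast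
  obtain f where "bij_betw f {0..<card I} I" using ex_bij_betw_nat_finite[OF I(1)] by blast
  then have f: "bij_betw f {..<card I} I" by (simp add: lessThan_atLeast0)
  have "is_basis kuu N (card I) (\<lambda>i. h (f i))" by (rule is_basis_reindex[OF f I(2,3)])
  moreover have "is_basis (power_series (u ^ p)) (frob ` N) (card I) (\<lambda>i. cscale (u powi int (r (f i))) (h (f i)))"
    using is_basis_reindex[OF f I(4,5)] by simp
  ultimately show "N \<in> L_SD M"
    unfolding L_SD_def using le
    by (intro CollectI conjI exI[of _ "card I"] exI[of _ "\<lambda>i. h (f i)"] exI[of _ "\<lambda>i. int (r (f i))"])
qed

end

theorem proposition3p3p1:
  fixes p :: nat
    and nrm :: "'c::field_char_0 \<Rightarrow> real"
    and K Kbar :: "'c set"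
    and pw :: "nat \<Rightarrow> 'c"
    and \<iota> :: "(nat \<Rightarrow> 'c set) \<Rightarrow> 'd::field"
    and vb :: "'d \<Rightarrow> real"
    and scaleV :: "'f::{field, finite} \<Rightarrow> 'v::ab_group_add \<Rightarrow> 'v"
    and \<rho> :: "('c \<Rightarrow> 'c) \<Rightarrow> 'v \<Rightarrow> 'v"
    and M :: "('v, 'd) tensor set"
  assumes "galois_rep p nrm K Kbar pw \<iota> vb scaleV \<rho>"
    and "galois_rep.etale_phi_module p nrm K Kbar pw \<iota> vb \<rho> M"
  shows "galois_rep.L_crys p nrm K Kbar pw \<iota> vb scaleV \<rho> M p
    \<subseteq> galois_rep.L_SD p nrm K pw \<iota> vb scaleV M"
  by (rule galois_rep.L_crys_subset_L_SD[OF assms])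

end
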